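(* Let $\varphi,\psi$ be admissible functions satisfying $$\sum_{\nu\in\mathbb{Z}}\overline{\hat\varphi(2^{-\nu}\xi)}\,\hat\psi(2^{-\nu}\xi)=1\qquad\text{for all }\xi\neq0.$$ Then for every $f\in\mathcal S'/\mathcal P$ one has, with convergence in $\mathcal Z'(\mathbb{R}^n)$, $$f=\sum_{Q\in\mathcal Q}\langle f,\varphi_Q\rangle\psi_Q=T_\psi(S_\varphi f),$$ where the sum over $Q$ denotes the Pettis integral defining $T_\psi$. More precisely, for $f\in\mathcal S'$ of $\mathcal S'$-order $d$ there is, for each integer $m\ge-1$ and each $N\in\mathbb{N}$, the identity in $\mathcal S'$ $$f=\sum_{\nu=-N}^{\infty}\Big(\sum_{k\in\mathbb{Z}^n}\langle f,\varphi_{Q_{\nu k}}\rangle\psi_{Q_{\nu k}}\Big)+P_{m,N}+R_m,$$ where the iterated sum converges in $\mathcal S'$, $P_{m,N}$ is the Taylor polynomial of degree $m$ at $x=0$ of the function $2^{-nN}\Phi(2^{-N}\cdot)*f$, and the error term satisfies $R_m=\mathcal O(2^{-N(n+m+1-d)})$ for $N\to\infty$, i.e. $\langle R_m,\omega\rangle=\mathcal O(2^{-N(n+m+1-d)})$ for every $\omega\in\mathcal S$.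
   Context: Fourier transform: $\hat f(\xi)=\int e^{-i x\cdot\xi}f(x)\,dx$ on $\mathbb{R}^n$. Pairings are anti-linear in the second slot: $\langle f,\phi\rangle=\int f\overline{\phi}\,dx$ for functions. $\mathcal S$, $\mathcal S'$ are the Schwartz functions and tempered distributions on $\mathbb{R}^n$. Admissibility: fix constants $0<K_0<K_1<1<K^1<K^0$ with $2K_1<K^1$ and $K^0<\pi$. A function $\varphi\in\mathcal S$ is admissible (always for these same constants) if $\operatorname{supp}\hat\varphi\subset\{\xi: K_0\le|\xi|\le K^0\}$ and, for some $c>0$, $|\hat\varphi(\xi)|\ge c$ for $K_1\le|\xi|\le K^1$. Dyadic cubes: for $\nu\in\mathbb{Z}$, $k\in\mathbb{Z}^n$, $Q_{\nu k}=\{x\in\mathbb{R}^n: k_i\le 2^\nu x_i<k_i+1,\ i=1,\dots,n\}$; $\mathcal Q$ is the set of all of these. For $Q=Q_{\nu k}$ set $\varphi_Q(x)=2^{n\nu/2}\varphi(2^\nu x-k)$, similarly $\psi_Q$. $\mathcal P$ is the space of polynomials; $\mathcal Z=\{\phi\in\mathcal S:\int x^\alpha\phi(x)\,dx=0\ \text{for all multiindices }\alpha\}$ with topology from $\mathcal S$; $\mathcal Z'=\mathcal S'/\mathcal P$ is its dual with the w$^*$-topology. Admissible functions belong to $\mathcal Z$ and are identified with their classes in $\mathcal Z'$. For $f\in\mathcal S'/\mathcal P$, $S_\varphi f=\{\langle f,\varphi_Q\rangle\}_{Q\in\mathcal Q}$. $D(T_\psi)$ is the set of complex families $a=\{a_Q\}_{Q\in\mathcal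 Q}$ with $\sum_{Q}|a_Q||\langle\psi_Q,\phi\rangle|<\infty$ for every $\phi\in\mathcal Z$; for $a\in D(T_\psi)$, $T_\psi a=\int_{\mathcal Q}a_Q\psi_Q\,d\tau_{1+n}$ ($\tau_{1+n}$ counting measure) is the (well-defined) element of $\mathcal Z'$ with $\langle T_\psi a,\phi\rangle=\sum_{Q\in\mathcal Q}a_Q\langle\psi_Q,\phi\rangle$ for all $\phi\in\mathcal Z$. (Always $S_\varphi f\in D(T_\psi)$.) $f\in\mathcal S'$ has $\mathcal S'$-order $d$ if $d\ge0$ is the smallest integer such that, for some $c$, $|\langle f,\omega\rangle|\le c\sup_{|\alpha|\le d}\|(1+|x|)^dD^\alpha\omega\|_\infty$ for all $\omega\in\mathcal S$. $\Phi\in\mathcal S$ is defined by $\hat\Phi(\xi)=1-\sum_{\nu=0}^\infty\overline{\hat\varphi(2^{-\nu}\xi)}\,\hat\psi(2^{-\nu}\xi)$. The Taylor polynomial of degree $m=-1$ is $0$. *)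

theory Defs
  imports "HOL-Analysis.Analysis" "HOL-Library.Landau_Symbols"
begin

section \<open>Partial derivatives and multiindices\<close>

text \<open>A multiindex is a function \<open>\<alpha> :: 'n \<Rightarrow> nat\<close> on the finite type of coordinates; its length is
  \<open>sum \<alpha> UNIV\<close>.\<close>

definition partial_deriv :: "'n::finite \<Rightarrow> (real^'n \<Rightarrow> complex) \<Rightarrow> real^'n \<Rightarrow> complex" where
  "partial_deriv i f x = vector_derivative (\<lambda>t. f (x + t *\<^sub>R axis i 1)) (at 0)"

definition smooth :: "(real^'n::finite \<Rightarrow> complex) \<Rightarrow> bool" where
  "smooth f \<longleftrightarrow> (\<forall>is x. foldr partial_deriv is f differentiable (at x))"

text \<open>The operator \<open>D\<^sup>\<alpha>\<close>. The order in which the partial derivatives are taken is left to the choice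
  operator; it is immaterial for smooth functions, the only ones to which \<open>mderiv\<close> is applied.\<close>

definition mderiv :: "('n::finite \<Rightarrow> nat) \<Rightarrow> (real^'n \<Rightarrow> complex) \<Rightarrow> real^'n \<Rightarrow> complex" where
  "mderiv \<alpha> f = foldr partial_deriv (SOME is. \<forall>i. count_list is i = \<alpha> i) f"

definition mpower :: "real^'n::finite \<Rightarrow> ('n \<Rightarrow> nat) \<Rightarrow> real" where
  "mpower x \<alpha> = (\<Prod>i\<in>UNIV. (x $ i) ^ \<alpha> i)"

definition mfact :: "('n::finite \<Rightarrow> nat) \<Rightarrow> nat" where
  "mfact \<alpha> = (\<Prod>i\<in>UNIV. fact (\<alpha> i))"

text \<open>The degree is an integer so that degree \<open>-1\<close> is allowed; the sum is then empty.\<close>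

definition taylor_poly :: "int \<Rightarrow> (real^'n::finite \<Rightarrow> complex) \<Rightarrow> real^'n \<Rightarrow> complex" where
  "taylor_poly m g x =
     (\<Sum>\<alpha> | int (sum \<alpha> UNIV) \<le> m. mderiv \<alpha> g 0 / of_nat (mfact \<alpha>) * of_real (mpower x \<alpha>))"

section \<open>Function spaces\<close>

definition schwartz :: "(real^'n::finite \<Rightarrow> complex) set" where
  "schwartz = {f. smooth f \<and> (\<forall>d::nat. \<forall>\<alpha>. bounded (range (\<lambda>x. (1 + norm x) ^ d *\<^sub>R mderiv \<alpha> f x)))}"

definition schwartz_norm :: "nat \<Rightarrow> (real^'n::finite \<Rightarrow> complex) \<Rightarrow> real" where
  "schwartz_norm d f =
     (SUP (\<alpha>, x) \<in> {\<alpha>. sum \<alpha> UNIV \<le> d} \<times> UNIV. (1 + norm x) ^ d * cmod (mderiv \<alpha> f x))"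

definition fourier :: "(real^'n::finite \<Rightarrow> complex) \<Rightarrow> real^'n \<Rightarrow> complex" where
  "fourier f \<xi> = (\<integral>x. exp (- \<i> * of_real (x \<bullet> \<xi>)) * f x \<partial>lborel)"

definition pairing :: "(real^'n::finite \<Rightarrow> complex) \<Rightarrow> (real^'n \<Rightarrow> complex) \<Rightarrow> complex" where
  "pairing f \<phi> = (\<integral>x. f x * cnj (\<phi> x) \<partial>lborel)"

definition Zspace :: "(real^'n::finite \<Rightarrow> complex) set" where
  "Zspace = {\<phi> \<in> schwartz. \<forall>\<alpha>. (\<integral>x. of_real (mpower x \<alpha>) * \<phi> x \<partial>lborel) = 0}"

section \<open>Distributions\<close>

text \<open>A distribution \<open>u\<close> is the functional \<open>\<phi> \<mapsto> \<langle>u, \<phi>\<rangle>\<close>, hence conjugate-linear, and is undefined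
  outside of the space of test functions. The \<open>schwartz_norm d\<close> increase with \<open>d\<close> and generate
  the topology of \<open>schwartz\<close> and \<open>Zspace\<close>, so that continuity is domination by one of them.\<close>

type_synonym 'n distribution = "(real^'n \<Rightarrow> complex) \<Rightarrow> complex"

definition antidual :: "(real^'n::finite \<Rightarrow> complex) set \<Rightarrow> 'n distribution set" where
  "antidual V = {u \<in> extensional V.
     (\<forall>\<phi>\<in>V. \<forall>\<theta>\<in>V. u (\<lambda>x. \<phi> x + \<theta> x) = u \<phi> + u \<theta>) \<and>
     (\<forall>a. \<forall>\<phi>\<in>V. u (\<lambda>x. a * \<phi> x) = cnj a * u \<phi>) \<and>
     (\<exists>d c. \<forall>\<phi>\<in>V. cmod (u \<phi>) \<le> c * schwartz_norm d \<phi>)}"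

abbreviation tempered :: "'n::finite distribution set" where
  "tempered \<equiv> antidual schwartz"

abbreviation Zdual :: "'n::finite distribution set" where
  "Zdual \<equiv> antidual Zspace"

text \<open>Convergence of the net of finite partial sums in the weak-star topology.\<close>

definition has_weak_sum ::
  "(real^'n::finite \<Rightarrow> complex) set \<Rightarrow> ('i \<Rightarrow> 'n distribution) \<Rightarrow> 'n distribution \<Rightarrow> 'i set \<Rightarrow> bool" where
  "has_weak_sum V u s A \<longleftrightarrow> s \<in> antidual V \<and> (\<forall>\<omega>\<in>V. ((\<lambda>i. u i \<omega>) has_sum s \<omega>) A)"

text \<open>Convergence of the sequence of partial sums in the weak-star topology.\<close>

definition weak_sums ::
  "(real^'n::finite \<Rightarrow> complex) set \<Rightarrow> (nat \<Rightarrow> 'n distribution) \<Rightarrow> 'n distribution \<Rightarrow> bool" where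
  "weak_sums V u s \<longleftrightarrow> s \<in> antidual V \<and> (\<forall>\<omega>\<in>V. (\<lambda>j. u j \<omega>) sums s \<omega>)"

definition S_order :: "'n::finite distribution \<Rightarrow> nat" where
  "S_order f = (LEAST d. \<exists>c. \<forall>\<omega>\<in>schwartz. cmod (f \<omega>) \<le> c * schwartz_norm d \<omega>)"

text \<open>\<open>\<S>'/\<P>\<close> as a quotient, and its canonical map into the dual of \<open>Zspace\<close>: polynomials vanish
  on \<open>Zspace\<close>, so the value at \<open>\<phi> \<in> Zspace\<close> does not depend on the representative.\<close>

definition poly_equiv :: "('n::finite distribution \<times> 'n distribution) set" where
  "poly_equiv = {(u, v). u \<in> tempered \<and> v \<in> tempered \<and>
     (\<exists>p. polynomial_function p \<and> (\<forall>\<omega>\<in>schwartz. u \<omega> - v \<omega> = pairing p \<omega>))}"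

definition tempered_mod_poly :: "'n::finite distribution set set" where
  "tempered_mod_poly = tempered // poly_equiv"

definition Zfunctional :: "'n::finite distribution set \<Rightarrow> 'n distribution" where
  "Zfunctional F = (\<lambda>\<phi>\<in>Zspace. the_elem ((\<lambda>u. u \<phi>) ` F))"

text \<open>The factor \<open>cnj\<close> compensates the antilinearity of the pairing: \<open>conv\<close> is the usual
  (bilinear) convolution of a Schwartz function with a distribution.\<close>

definition conv :: "(real^'n::finite \<Rightarrow> complex) \<Rightarrow> 'n distribution \<Rightarrow> real^'n \<Rightarrow> complex" where
  "conv \<Phi> f x = f (\<lambda>y. cnj (\<Phi> (x - y)))"

section \<open>Dyadic cubes and the \<open>\<phi>\<close>-transform\<close>

text \<open>\<open>K0 < K1 < 1 < L1 < L0\<close>, where \<open>L1\<close>, \<open>L0\<close> are the upper constants.\<close>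

definition admissible :: "real \<Rightarrow> real \<Rightarrow> real \<Rightarrow> real \<Rightarrow> (real^'n::finite \<Rightarrow> complex) \<Rightarrow> bool" where
  "admissible K0 K1 L1 L0 \<phi> \<longleftrightarrow>
     \<phi> \<in> schwartz \<and>
     closure {\<xi>. fourier \<phi> \<xi> \<noteq> 0} \<subseteq> {\<xi>. K0 \<le> norm \<xi> \<and> norm \<xi> \<le> L0} \<and>
     (\<exists>c>0. \<forall>\<xi>. K1 \<le> norm \<xi> \<and> norm \<xi> \<le> L1 \<longrightarrow> c \<le> cmod (fourier \<phi> \<xi>))"

definition dyadic_cube :: "int \<Rightarrow> int^'n::finite \<Rightarrow> (real^'n) set" where
  "dyadic_cube \<nu> k = {x. \<forall>i. of_int (k $ i) \<le> 2 powi \<nu> * x $ i \<and> 2 powi \<nu> * x $ i < of_int (k $ i) + 1}"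

definition dyadic_cubes :: "(real^'n::finite) set set" where
  "dyadic_cubes = {dyadic_cube \<nu> k | \<nu> k. True}"

lemma inj_dyadic_cube: "inj (\<lambda>(\<nu>, k :: int^'n::finite). dyadic_cube \<nu> k)"
proof -
  have le: "of_int (l $ i) * 2 powi (-\<mu>) \<le> (of_int (k $ i) * 2 powi (-\<nu>) :: real)"
    if "dyadic_cube \<nu> k = dyadic_cube \<mu> l" for \<nu> \<mu> and k l :: "int^'n" and i
  proof -
    have "(\<chi> i. of_int (k $ i) * 2 powi (-\<nu>)) \<in> dyadic_cube \<nu> k"
      by (simp add: dyadic_cube_def power_int_minus field_simps)
    then have "(\<chi> i. of_int (k $ i) * 2 powi (-\<nu>)) \<in> dyadic_cube \<mu> l"
      by (simp only: that)
    then have "of_int (l $ i) \<le> 2 powi \<mu> * (of_int (k $ i) * 2 powi (-\<nu>) :: real)"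
      by (simp add: dyadic_cube_def)
    then show ?thesis
      by (simp add: power_int_minus field_simps)
  qed
  have less: "\<nu> \<le> \<mu>" if eq: "dyadic_cube \<nu> k = dyadic_cube \<mu> l" for \<nu> \<mu> and k l :: "int^'n"
  proof (rule ccontr)
    assume "\<not> \<nu> \<le> \<mu>"
    then have lt: "(2::real) powi \<mu> * 2 powi (-\<nu>) < 1"
      by (simp add: power_int_minus divide_simps power_int_strict_increasing)
    have c: "of_int (l $ i) * 2 powi (-\<mu>) = (of_int (k $ i) * 2 powi (-\<nu>) :: real)" for i
      using le[OF eq] le[OF eq[symmetric]] by (meson order_antisym)
    define x :: "real^'n" where "x = (\<chi> i. of_int (k $ i) * 2 powi (-\<nu>) + 2 powi (-\<nu>))"
    have "2 powi \<mu> * x $ i = of_int (l $ i) + 2 powi \<mu> * 2 powi (-\<nu>)" for i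
      by (simp add: x_def c[symmetric] algebra_simps) (simp add: power_int_minus)
    then have "x \<in> dyadic_cube \<mu> l"
      using lt by (simp add: dyadic_cube_def)
    moreover have "x \<notin> dyadic_cube \<nu> k"
      by (simp add: x_def dyadic_cube_def algebra_simps power_int_minus)
    ultimately show False using eq by simp
  qed
  show ?thesis
  proof (rule injI, clarify)
    fix \<nu> \<mu> and k l :: "int^'n"
    assume eq: "dyadic_cube \<nu> k = dyadic_cube \<mu> l"
    have "\<nu> = \<mu>" using less[OF eq] less[OF eq[symmetric]] by simp
    moreover have "k $ i = l $ i" for i
      using le[OF eq, of i] le[OF eq[symmetric], of i] \<open>\<nu> = \<mu>\<close> by simp
    ultimately show "\<nu> = \<mu> \<and> k = l" by (simp add: vec_eq_iff)
  qed
qed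

definition at_cube ::
  "(real^'n::finite \<Rightarrow> complex) \<Rightarrow> (real^'n) set \<Rightarrow> real^'n \<Rightarrow> complex" where
  "at_cube \<phi> Q x = (case the_inv (\<lambda>(\<nu>, k). dyadic_cube \<nu> k) Q of (\<nu>, k) \<Rightarrow>
     of_real (2 powr (real CARD('n) * of_int \<nu> / 2)) * \<phi> (2 powi \<nu> *\<^sub>R x - (\<chi> i. of_int (k $ i))))"

lemma at_cube_dyadic_cube:
  "at_cube \<phi> (dyadic_cube \<nu> k) x =
     of_real (2 powr (real CARD('n) * of_int \<nu> / 2)) *
       \<phi> (2 powi \<nu> *\<^sub>R x - (\<chi> i. of_int (k $ i)) :: real^'n::finite)"
  using the_inv_f_f[OF inj_dyadic_cube, of "(\<nu>, k)"] by (simp add: at_cube_def)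

definition S_op ::
  "(real^'n::finite \<Rightarrow> complex) \<Rightarrow> 'n distribution \<Rightarrow> (real^'n) set \<Rightarrow> complex" where
  "S_op \<phi> f = (\<lambda>Q\<in>dyadic_cubes. f (at_cube \<phi> Q))"

definition T_domain :: "(real^'n::finite \<Rightarrow> complex) \<Rightarrow> ((real^'n) set \<Rightarrow> complex) set" where
  "T_domain \<psi> = {a \<in> extensional dyadic_cubes.
     \<forall>\<phi>\<in>Zspace. (\<lambda>Q. cmod (a Q) * cmod (pairing (at_cube \<psi> Q) \<phi>)) summable_on dyadic_cubes}"

definition T_op ::
  "(real^'n::finite \<Rightarrow> complex) \<Rightarrow> ((real^'n) set \<Rightarrow> complex) \<Rightarrow> 'n distribution" where
  "T_op \<psi> a = (THE u. u \<in> Zdual \<and>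
     (\<forall>\<phi>\<in>Zspace. u \<phi> = (\<Sum>\<^sub>\<infinity>Q\<in>dyadic_cubes. a Q * pairing (at_cube \<psi> Q) \<phi>)))"

definition Phi :: "(real^'n::finite \<Rightarrow> complex) \<Rightarrow> (real^'n \<Rightarrow> complex) \<Rightarrow> real^'n \<Rightarrow> complex" where
  "Phi \<phi> \<psi> = (THE \<Phi>. \<Phi> \<in> schwartz \<and> (\<forall>\<xi>. fourier \<Phi> \<xi> =
     1 - (\<Sum>\<nu>. cnj (fourier \<phi> ((1/2) ^ \<nu> *\<^sub>R \<xi>)) * fourier \<psi> ((1/2) ^ \<nu> *\<^sub>R \<xi>))))"

definition dilate :: "nat \<Rightarrow> (real^'n::finite \<Rightarrow> complex) \<Rightarrow> real^'n \<Rightarrow> complex" where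
  "dilate N \<Phi> x = of_real ((1/2) ^ (CARD('n) * N)) * \<Phi> ((1/2) ^ N *\<^sub>R x)"

end

(* Everything is tested against a Schwartz function w. By continuity of f,
   sum_k <f, phi_Q> <psi_Q, w> = f (sum_k <w, psi_Q> phi_Q), with Q of side 2^(-nu) on both sides,
   and since the transforms of phi and psi live in |xi| < pi, Poisson summation evaluates the inner
   sum: its transform is that of w times the conjugate of theta(2^(-nu) xi), where theta is the
   product of the conjugate of the transform of phi with the transform of psi. As
   theta(2 xi) = Phi^(xi) - Phi^(2 xi), the levels telescope, and the levels nu >= -N add up to
   f(w) - f(C w), where C w has the transform of w times the conjugate of Phi^(2^N xi). Now
   f(C w) is the pairing of w with the convolution 2^(-nN) Phi(2^(-N) .) * f; Taylor expansion of
   its kernel at 0 splits it into P_{m,N} and R_m. Beside the factor 2^(-nN), each of the m + 1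
   orders of the expansion gains a factor 2^(-N), whereas the weight in the Schwartz seminorm of
   order d costs 2^(Nd).

   If all moments of w vanish, so does the pairing with P_{m,N}, hence f(C w) tends to 0; the terms
   of the double sum decay rapidly in nu and k by Taylor expansion against the vanishing moments
   of psi (large nu) and of w (small nu), which gives the unconditional convergence in Z'.

   Poisson summation is only needed for functions whose transform vanishes at all nonzero points of
   the dual lattice. *)

theory Submission
  imports Defs "HOL-Probability.Probability" "HOL-Combinatorics.Multiset_Permutations"
begin

section \<open>Iterated partial derivatives\<close>

text \<open>Every average is an instance of \<open>smear u w s y\<close>, the integral of u(z) w(y +
  s z): convolution for s = -1, an approximate identity as s tends to 0, the low-frequency operator
  \<open>C w\<close> for s = 2^N. It commutes with derivatives of w and is a multiplier on the
  Fourier side, so one set of estimates serves all levels. A Taylor expansion is only useful on a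
  factor that is nearly constant at the scale of the other one; two substitutions,
  \<open>smear_cPhi_eq\<close> and \<open>coef_alt\<close>, therefore move the dilation from one
  factor to the other.

  A distribution is known only as an antilinear functional dominated by a seminorm. Exchanging it
  with a derivative or with a sum over the lattice always means estimating the
  \<open>schwartz_norm\<close> of an explicit error function. Antilinearity is also the reason for
  the conjugates on \<open>Phi\<close> and \<open>\<psi>\<close> inside the argument of f.

  Iterated derivatives are indexed by lists of coordinates, so that induction on the list replaces
  induction on multiindices; the symmetry of second derivatives leads back to multiindices.\<close>

abbreviation D :: "'n::finite list \<Rightarrow> (real^'n \<Rightarrow> complex) \<Rightarrow> real^'n \<Rightarrow> complex" where
  "D is f \<equiv> foldr partial_deriv is f"

lemma partial_deriv_eq_apply:
  assumes "(f has_derivative f') (at x)"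
  shows "partial_deriv i f x = f' (axis i 1)"
proof -
  have "((\<lambda>t. x + t *\<^sub>R axis i 1) has_derivative (\<lambda>t. t *\<^sub>R axis i 1)) (at (0::real))"
    by (auto intro!: derivative_eq_intros)
  moreover have "(f has_derivative f') (at (x + (0::real) *\<^sub>R axis i 1))"
    using assms by simp
  ultimately have "((\<lambda>t. f (x + t *\<^sub>R axis i 1)) has_derivative (\<lambda>t. f' (t *\<^sub>R axis i 1))) (at (0::real))"
    by (rule has_derivative_compose)
  moreover have "bounded_linear f'"
    using assms by (rule has_derivative_bounded_linear)
  ultimately have "((\<lambda>t. f (x + t *\<^sub>R axis i 1)) has_vector_derivative f' (axis i 1)) (at (0::real))"
    by (simp add: has_vector_derivative_def linear_simps)
  then show ?thesis
    unfolding partial_deriv_def by (rule vector_derivative_at)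
qed

lemma partial_deriv_eq_coeff:
  assumes "(f has_derivative (\<lambda>h. \<Sum>i\<in>UNIV. of_real (h $ i) * L i)) (at x)"
  shows "partial_deriv i f x = L i"
proof -
  have "partial_deriv i f x = (\<Sum>j\<in>UNIV. of_real (axis i 1 $ j) * L j)"
    by (rule partial_deriv_eq_apply[OF assms])
  also have "\<dots> = (\<Sum>j\<in>UNIV. if j = i then L j else 0)"
    by (intro sum.cong) (auto simp: axis_def)
  finally show ?thesis by simp
qed

lemma has_derivative_partial_derivs:
  assumes "f differentiable (at x)"
  shows "(f has_derivative (\<lambda>h. \<Sum>i\<in>UNIV. of_real (h $ i) * partial_deriv i f x)) (at x)"
proof -
  obtain f' where f': "(f has_derivative f') (at x)"
    using assms by (auto simp: differentiable_def)
  interpret bounded_linear f' by (rule has_derivative_bounded_linear[OF f'])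
  have "f' h = (\<Sum>i\<in>UNIV. of_real (h $ i) * partial_deriv i f x)" for h
  proof -
    have "f' h = f' (\<Sum>i\<in>UNIV. (h $ i) *\<^sub>R axis i 1)"
      using basis_expansion[of h] by (simp add: scalar_mult_eq_scaleR)
    also have "\<dots> = (\<Sum>i\<in>UNIV. (h $ i) *\<^sub>R f' (axis i 1))"
      by (simp add: sum scaleR)
    finally show ?thesis
      by (simp add: partial_deriv_eq_apply[OF f'] scaleR_conv_of_real)
  qed
  then show ?thesis using f' by presburger
qed

text \<open>Differentiation under an integral and of a convolution with a distribution go through
  this criterion: a second-order Taylor remainder, integrated or estimated in a seminorm, is already
  a bound of the required form.\<close>

lemma has_derivative_if_quadratic_error:
  fixes f :: "real^'n::finite \<Rightarrow> complex"
  assumes "\<And>h. norm h \<le> 1 \<Longrightarrow>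
    cmod (f (x + h) - f x - (\<Sum>i\<in>UNIV. of_real (h $ i) * L i)) \<le> C * (norm h)\<^sup>2"
  shows "(f has_derivative (\<lambda>h. \<Sum>i\<in>UNIV. of_real (h $ i) * L i)) (at x)"
  unfolding has_derivative_at
proof (intro conjI)
  show "bounded_linear (\<lambda>h::real^'n. \<Sum>i\<in>UNIV. of_real (h $ i) * L i)"
    by (intro bounded_linear_sum bounded_linear_compose[OF bounded_linear_mult_left]
        bounded_linear_compose[OF bounded_linear_of_real] bounded_linear_vec_nth)
  have "((\<lambda>h::real^'n. C * norm h) \<longlongrightarrow> C * norm (0::real^'n)) (at 0)"
    by (intro tendsto_intros)
  then have 1: "((\<lambda>h::real^'n. C * norm h) \<longlongrightarrow> 0) (at 0)" by simp
  show "(\<lambda>h. norm (f (x + h) - f x - (\<Sum>i\<in>UNIV. of_real (h $ i) * L i)) / norm h) \<midarrow>0\<rightarrow> 0"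
  proof (rule tendsto_sandwich[OF _ _ tendsto_const 1])
    show "\<forall>\<^sub>F h in at 0. norm (f (x + h) - f x - (\<Sum>i\<in>UNIV. of_real (h $ i) * L i)) / norm h \<le> C * norm h"
      unfolding eventually_at
    proof (intro exI[of _ 1] conjI ballI impI)
      fix h :: "real^'n" assume "h \<noteq> 0 \<and> dist h 0 < 1"
      then have "norm h \<le> 1" "norm h > 0" by auto
      then show "norm (f (x + h) - f x - (\<Sum>i\<in>UNIV. of_real (h $ i) * L i)) / norm h \<le> C * norm h"
        using assms[of h] by (simp add: divide_simps power2_eq_square mult.assoc)
    qed simp
  qed auto
qed

lemma has_vector_derivative_along_axis:
  assumes "\<And>x. f differentiable (at x)"
  shows "((\<lambda>t. f (x + t *\<^sub>R axis i 1)) has_vector_derivative partial_deriv i f (x + t *\<^sub>R axis i 1)) (at t within S)"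
proof -
  have 1: "((\<lambda>t. x + t *\<^sub>R axis i 1) has_derivative (\<lambda>t. t *\<^sub>R axis i 1)) (at t within S)"
    by (auto intro!: derivative_eq_intros)
  obtain f' where f': "(f has_derivative f') (at (x + t *\<^sub>R axis i 1))"
    using assms unfolding differentiable_def by blast
  interpret bounded_linear f' by (rule has_derivative_bounded_linear[OF f'])
  show ?thesis
    using has_derivative_compose[OF 1 f']
    by (simp add: has_vector_derivative_def scaleR partial_deriv_eq_apply[OF f'])
qed

text \<open>The integral over [0,s] of d_i f along the i-th axis is a difference of values of f.
  Differentiating it along the j-th axis under the integral gives a difference of values of d_j f,
  which is the integral of d_i d_j f. So d_j d_i f and d_i d_j f have equal integrals over every
  [0,s], and differentiating in s at 0 gives the claim.\<close>

lemma partial_deriv_commute: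
  assumes "smooth f"
  shows "partial_deriv i (partial_deriv j f) = partial_deriv j (partial_deriv i f)"
proof
  fix x
  have diff: "D is f differentiable (at y)" for "is" y
    using assms by (auto simp: smooth_def)
  have d0: "f differentiable (at y)" for y using diff[of "[]"] by simp
  have d1: "partial_deriv k f differentiable (at y)" for k y using diff[of "[k]"] by simp
  have d2: "partial_deriv k (partial_deriv l f) differentiable (at y)" for k l y
    using diff[of "[k, l]"] by simp
  have cont: "continuous_on UNIV (partial_deriv k (partial_deriv l f))" for k l
    by (intro continuous_at_imp_continuous_on ballI differentiable_imp_continuous_within d2)
  have cont1: "continuous_on UNIV (partial_deriv k f)" for k
    by (intro continuous_at_imp_continuous_on ballI differentiable_imp_continuous_within d1)
  have FTC: "((\<lambda>s. partial_deriv i g (y + s *\<^sub>R axis i 1)) has_integral g (y + s *\<^sub>R axis i 1) - g y) {0..s}"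
    if "\<And>y. g differentiable (at y)" "s \<ge> 0" for g y s
    using fundamental_theorem_of_calculus[OF that(2) has_vector_derivative_along_axis[OF that(1), of y i]]
    by simp
  have eq: "integral {0..s} (\<lambda>s. partial_deriv j (partial_deriv i f) (x + s *\<^sub>R axis i 1))
      = integral {0..s} (\<lambda>s. partial_deriv i (partial_deriv j f) (x + s *\<^sub>R axis i 1))" if "s \<ge> 0" for s
  proof -
    have "((\<lambda>t. integral (cbox 0 s) (\<lambda>s. partial_deriv i f (x + s *\<^sub>R axis i 1 + t *\<^sub>R axis j 1)))
       has_vector_derivative integral (cbox 0 s) (\<lambda>s. partial_deriv j (partial_deriv i f) (x + s *\<^sub>R axis i 1 + 0 *\<^sub>R axis j 1)))
         (at (0::real) within UNIV)"
    proof (rule leibniz_rule_vector_derivative)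
      show "((\<lambda>t. partial_deriv i f (x + s *\<^sub>R axis i 1 + t *\<^sub>R axis j 1)) has_vector_derivative
          partial_deriv j (partial_deriv i f) (x + s *\<^sub>R axis i 1 + t *\<^sub>R axis j 1)) (at t within UNIV)" for s t
        by (rule has_vector_derivative_along_axis[OF d1])
      show "(\<lambda>s. partial_deriv i f (x + s *\<^sub>R axis i 1 + t *\<^sub>R axis j 1)) integrable_on cbox 0 s" for t
        by (intro integrable_continuous continuous_on_compose2[OF cont1]) (auto intro!: continuous_intros)
      show "continuous_on (UNIV \<times> cbox 0 s) (\<lambda>(t, s). partial_deriv j (partial_deriv i f) (x + s *\<^sub>R axis i 1 + t *\<^sub>R axis j 1))"
        unfolding split_def
        by (intro continuous_on_compose2[OF cont]) (auto intro!: continuous_intros)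
    qed auto
    moreover have "integral (cbox 0 s) (\<lambda>s. partial_deriv i f (x + s *\<^sub>R axis i 1 + t *\<^sub>R axis j 1))
       = f (x + s *\<^sub>R axis i 1 + t *\<^sub>R axis j 1) - f (x + t *\<^sub>R axis j 1)" for t
      using FTC[OF d0 that, of "x + t *\<^sub>R axis j 1"] by (simp add: has_integral_iff add.assoc add.commute add.left_commute)
    moreover have "((\<lambda>t. f (x + s *\<^sub>R axis i 1 + t *\<^sub>R axis j 1) - f (x + t *\<^sub>R axis j 1)) has_vector_derivative
        partial_deriv j f (x + s *\<^sub>R axis i 1 + 0 *\<^sub>R axis j 1) - partial_deriv j f (x + 0 *\<^sub>R axis j 1)) (at 0 within UNIV)"
      by (intro has_vector_derivative_diff has_vector_derivative_along_axis d0)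
    ultimately have "integral (cbox 0 s) (\<lambda>s. partial_deriv j (partial_deriv i f) (x + s *\<^sub>R axis i 1))
        = partial_deriv j f (x + s *\<^sub>R axis i 1) - partial_deriv j f x"
      using vector_derivative_unique_at by fastforce
    then show ?thesis
      using FTC[OF d1 that, of j x] by (simp add: has_integral_iff)
  qed
  \<comment> \<open>The integrals are only compared for s >= 0, hence the one-sided derivative
    within \<open>{0..1}\<close>.\<close>
  have deriv0: "((\<lambda>s. integral {0..s} (\<lambda>s. partial_deriv k (partial_deriv l f) (x + s *\<^sub>R axis i 1)))
     has_vector_derivative partial_deriv k (partial_deriv l f) (x + 0 *\<^sub>R axis i 1)) (at 0 within {0..1})" for k l
    by (intro integral_has_vector_derivative continuous_on_compose2[OF cont]) (auto intro!: continuous_intros)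
  have "((\<lambda>s. integral {0..s} (\<lambda>s. partial_deriv j (partial_deriv i f) (x + s *\<^sub>R axis i 1)))
     has_vector_derivative partial_deriv i (partial_deriv j f) (x + 0 *\<^sub>R axis i 1)) (at 0 within {0..1})"
    by (rule has_vector_derivative_transform[OF _ _ deriv0[of i j]]) (auto simp: eq)
  then show "partial_deriv i (partial_deriv j f) x = partial_deriv j (partial_deriv i f) x"
    using vector_derivative_unique_within[OF _ deriv0[of j i]] by (auto simp: trivial_limit_within islimpt_Icc)
qed

lemma smooth_D: "smooth f \<Longrightarrow> smooth (D is f)"
  unfolding smooth_def foldr_append[symmetric] comp_def by (metis foldr_append comp_apply)

lemma D_remove1:
  assumes "smooth f" "i \<in> set is"
  shows "D is f = partial_deriv i (D (remove1 i is) f)"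
  using assms(2)
proof (induction "is")
  case (Cons j "is")
  show ?case
  proof (cases "i = j")
    case False
    then have "D (j # is) f = partial_deriv j (partial_deriv i (D (remove1 i is) f))"
      using Cons by simp
    also have "\<dots> = partial_deriv i (partial_deriv j (D (remove1 i is) f))"
      by (intro partial_deriv_commute smooth_D assms(1))
    finally show ?thesis using False by auto
  qed simp
qed simp

lemma D_cong_mset:
  assumes "smooth f" "mset is = mset js"
  shows "D is f = D js f"
  using assms(2)
proof (induction "is" arbitrary: js)
  case (Cons i "is")
  have "i \<in> set js" using Cons.prems by (metis list.set_intros(1) set_mset_mset)
  moreover from this have "mset is = mset (remove1 i js)"
    using Cons.prems by (metis add_mset_remove_trivial mset.simps(2) mset_remove1)
  ultimately show ?case
    using Cons.IH[of "remove1 i js"] D_remove1[OF assms(1), of i js] by simp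
qed simp

lemma mset_eq_count_list: "mset is = mset js \<longleftrightarrow> count_list is = count_list js"
  by (auto simp: multiset_eq_iff count_mset fun_eq_iff)

lemma ex_count_list_eq:
  fixes \<alpha> :: "'n::finite \<Rightarrow> nat"
  obtains "is" where "count_list is = \<alpha>"
proof -
  obtain "is" where "mset is = (\<Sum>i\<in>UNIV. replicate_mset (\<alpha> i) i)"
    using ex_mset by blast
  then have "count_list is = \<alpha>"
    by (auto simp: fun_eq_iff count_mset[symmetric] count_sum)
  with that show ?thesis by blast
qed

text \<open>Removes the choice operator from \<open>mderiv\<close>: the list it picks is a
  rearrangement of \<open>is\<close>. Every multiindex is the count of some list
  (\<open>ex_count_list_eq\<close>), so seminorms and Taylor polynomials can be handled through
  \<open>D\<close>.\<close>

lemma mderiv_count_list: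
  assumes "smooth f"
  shows "mderiv (count_list is) f = D is f"
proof -
  have "count_list (SOME js. \<forall>i. count_list js i = count_list is i) = count_list is"
    using someI_ex[of "\<lambda>js. \<forall>i. count_list js i = count_list is i"] by auto
  then show ?thesis
    unfolding mderiv_def by (intro D_cong_mset[OF assms]) (simp add: mset_eq_count_list)
qed

lemma sum_count_list_UNIV: "sum (count_list is) (UNIV :: 'n::finite set) = length is"
  by (rule sum_count_set) auto

section \<open>Schwartz functions\<close>

lemma schwartz_iff:
  fixes f :: "real^'n::finite \<Rightarrow> complex"
  shows "f \<in> schwartz \<longleftrightarrow> smooth f \<and> (\<forall>m is. \<exists>B. \<forall>x. (1 + norm x) ^ m * cmod (D is f x) \<le> B)"
proof -
  have "(\<forall>\<alpha>. bounded (range (\<lambda>x. (1 + norm x) ^ d *\<^sub>R mderiv \<alpha> f x))) \<longleftrightarrow>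
     (\<forall>is. \<exists>B. \<forall>x. (1 + norm x) ^ d * cmod (D is f x) \<le> B)" if "smooth f" for d
  proof (intro iffI allI)
    fix "is" assume "\<forall>\<alpha>. bounded (range (\<lambda>x. (1 + norm x) ^ d *\<^sub>R mderiv \<alpha> f x))"
    then have "bounded (range (\<lambda>x. (1 + norm x) ^ d *\<^sub>R D is f x))"
      using mderiv_count_list[OF that, of "is"] by metis
    then show "\<exists>B. \<forall>x. (1 + norm x) ^ d * cmod (D is f x) \<le> B"
      by (auto simp: bounded_iff)
  next
    fix \<alpha> :: "'n \<Rightarrow> nat" assume *: "\<forall>is. \<exists>B. \<forall>x. (1 + norm x) ^ d * cmod (D is f x) \<le> B"
    obtain "is" where "count_list is = \<alpha>" by (rule ex_count_list_eq[of \<alpha>])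
    then show "bounded (range (\<lambda>x. (1 + norm x) ^ d *\<^sub>R mderiv \<alpha> f x))"
      using *[rule_format, of "is"] mderiv_count_list[OF that, of "is"] by (auto simp: bounded_iff)
  qed
  then show ?thesis unfolding schwartz_def by blast
qed

text \<open>Closure under one partial derivative replaces an induction over iterated derivatives.
  The families X used below are sums, functions x_i f + g, averages, transforms, and functions that
  are smooth on a ball and zero outside a smaller one.\<close>

lemma schwartz_coinduct [consumes 1, case_names differentiable decay partial_deriv]:
  assumes "f \<in> X" "\<And>g x. g \<in> X \<Longrightarrow> g differentiable (at x)"
    "\<And>g m. g \<in> X \<Longrightarrow> \<exists>B. \<forall>x. (1 + norm x) ^ m * cmod (g x) \<le> B"
    "\<And>g i. g \<in> X \<Longrightarrow> partial_deriv i g \<in> X"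
  shows "f \<in> schwartz"
proof -
  have "D is f \<in> X" for "is"
    using assms(1,4) by (induction "is") auto
  then show ?thesis
    using assms(2,3) unfolding schwartz_iff smooth_def by blast
qed

lemma schwartz_smooth: "f \<in> schwartz \<Longrightarrow> smooth f"
  by (simp add: schwartz_iff)

lemma schwartz_D: "f \<in> schwartz \<Longrightarrow> D is f \<in> schwartz"
  using smooth_D[of f "is"] unfolding schwartz_iff by (metis comp_apply foldr_append)

lemma schwartz_partial_deriv: "f \<in> schwartz \<Longrightarrow> partial_deriv i f \<in> schwartz"
  using schwartz_D[of f "[i]"] by simp

lemma schwartz_differentiable: "f \<in> schwartz \<Longrightarrow> f differentiable (at x)"
  using schwartz_smooth[of f] unfolding smooth_def by (metis foldr_Nil id_apply)

lemma schwartz_has_derivative: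
  "f \<in> schwartz \<Longrightarrow> (f has_derivative (\<lambda>h. \<Sum>i\<in>UNIV. of_real (h $ i) * partial_deriv i f x)) (at x)"
  by (intro has_derivative_partial_derivs schwartz_differentiable)

lemma schwartz_continuous_on: "f \<in> schwartz \<Longrightarrow> continuous_on S f"
  by (intro continuous_at_imp_continuous_on ballI differentiable_imp_continuous_within schwartz_differentiable)

lemma schwartz_measurable: "f \<in> schwartz \<Longrightarrow> f \<in> borel_measurable borel"
  by (intro borel_measurable_continuous_onI schwartz_continuous_on)

lemma one_add_norm_power_pos [simp]: "0 < (1 + norm x) ^ m" "0 \<le> (1 + norm x) ^ m"
  "(1 + norm x) ^ m \<noteq> 0" "1 \<le> (1 + norm x) ^ m"
  by (auto intro!: zero_less_power one_le_power simp: add_pos_nonneg add_nonneg_eq_0_iff)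

lemma one_add_norm_power_mono: "m \<le> k \<Longrightarrow> (1 + norm x) ^ m \<le> (1 + norm x) ^ k"
  by (rule power_increasing) auto

lemma finite_multiindices_le: "finite {\<alpha> :: 'n::finite \<Rightarrow> nat. sum \<alpha> UNIV \<le> d}"
proof (rule finite_subset)
  show "{\<alpha> :: 'n \<Rightarrow> nat. sum \<alpha> UNIV \<le> d} \<subseteq> PiE UNIV (\<lambda>_. {..d})"
  proof
    fix \<alpha> :: "'n \<Rightarrow> nat" assume "\<alpha> \<in> {\<alpha>. sum \<alpha> UNIV \<le> d}"
    then have "\<alpha> i \<le> d" for i using member_le_sum[of i UNIV \<alpha>] by simp
    then show "\<alpha> \<in> PiE UNIV (\<lambda>_. {..d})" by (simp add: PiE_iff)
  qed
  show "finite (PiE (UNIV :: 'n set) (\<lambda>_. {..d}))"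
    by (rule finite_PiE) auto
qed

text \<open>The supremum defining \<open>schwartz_norm\<close> must be shown finite before it
  dominates anything: each multiindex has its own bound, and there are only finitely many
  multiindices of length at most d.\<close>

lemma schwartz_norm_bound:
  assumes "f \<in> schwartz" "length is \<le> d"
  shows "(1 + norm x) ^ d * cmod (D is f x) \<le> schwartz_norm d f"
proof -
  let ?h = "\<lambda>(\<alpha>, x). (1 + norm x) ^ d * cmod (mderiv \<alpha> f x)"
  have "\<exists>B. \<forall>x. ?h (\<alpha>, x) \<le> B" for \<alpha>
  proof -
    obtain "is" where "count_list is = \<alpha>" by (rule ex_count_list_eq[of \<alpha>])
    moreover obtain B where "\<And>x. (1 + norm x) ^ d * cmod (D is f x) \<le> B"
      using assms(1) unfolding schwartz_iff by blast
    ultimately show ?thesis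
      using mderiv_count_list[OF schwartz_smooth[OF assms(1)], of "is"] by auto
  qed
  then have "\<exists>B. \<forall>\<alpha> x. ?h (\<alpha>, x) \<le> B \<alpha>" by (intro choice allI)
  then obtain B where B: "\<And>\<alpha> x. ?h (\<alpha>, x) \<le> B \<alpha>" by blast
  have "bdd_above (?h ` ({\<alpha>. sum \<alpha> UNIV \<le> d} \<times> UNIV))"
  proof (rule bdd_aboveI2)
    fix p assume "p \<in> {\<alpha> :: 'a \<Rightarrow> nat. sum \<alpha> UNIV \<le> d} \<times> (UNIV :: (real^'a) set)"
    then have p: "fst p \<in> {\<alpha>. sum \<alpha> UNIV \<le> d}" by auto
    have "?h p \<le> B (fst p)" using B[of "fst p" "snd p"] by (simp add: case_prod_beta)
    also have "\<dots> \<le> Max (B ` {\<alpha>. sum \<alpha> UNIV \<le> d})"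
      using p finite_multiindices_le by (intro Max_ge) auto
    finally show "?h p \<le> Max (B ` {\<alpha>. sum \<alpha> UNIV \<le> d})" .
  qed
  from cSUP_upper[OF _ this, of "(count_list is, x)"] show ?thesis
    using assms(2) mderiv_count_list[OF schwartz_smooth[OF assms(1)], of "is"]
    by (simp add: schwartz_norm_def sum_count_list_UNIV)
qed

lemma schwartz_norm_le:
  fixes f :: "real^'a::finite \<Rightarrow> complex"
  assumes "f \<in> schwartz" "\<And>is x. length is \<le> d \<Longrightarrow> (1 + norm x) ^ d * cmod (D is f x) \<le> B"
  shows "schwartz_norm d f \<le> B"
  unfolding schwartz_norm_def
proof (rule cSUP_least)
  show "{\<alpha>::'a \<Rightarrow> nat. sum \<alpha> UNIV \<le> d} \<times> (UNIV::(real^'a) set) \<noteq> {}"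
    by (auto intro!: exI[of _ "\<lambda>_. 0"])
  fix p :: "('a \<Rightarrow> nat) \<times> (real^'a)" assume p: "p \<in> {\<alpha>. sum \<alpha> UNIV \<le> d} \<times> UNIV"
  obtain "is" where "count_list is = fst p" by (rule ex_count_list_eq[of "fst p"])
  then show "(case p of (\<alpha>, x) \<Rightarrow> (1 + norm x) ^ d * cmod (mderiv \<alpha> f x)) \<le> B"
    using p assms(2)[of "is" "snd p"] mderiv_count_list[OF schwartz_smooth[OF assms(1)], of "is"]
      sum_count_list_UNIV[of "is"]
    by (auto simp: case_prod_beta)
qed

lemma schwartz_norm_nonneg: "f \<in> schwartz \<Longrightarrow> 0 \<le> schwartz_norm d f"
  using schwartz_norm_bound[of f "[]" d 0] by (simp add: order_trans[OF norm_ge_zero])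

text \<open>The single index \<open>max k m\<close> of the seminorm serves both as number of
  derivatives and as power of the weight.\<close>

lemma schwartz_decay:
  assumes "f \<in> schwartz"
  obtains B where "B \<ge> 0" "\<And>is x. length is \<le> k \<Longrightarrow> cmod (D is f x) \<le> B / (1 + norm x) ^ m"
proof
  let ?B = "schwartz_norm (max k m) f"
  show "?B \<ge> 0" by (rule schwartz_norm_nonneg[OF assms])
  fix "is" x assume "length (is :: 'a list) \<le> k"
  then have "(1 + norm x) ^ max k m * cmod (D is f x) \<le> ?B"
    by (intro schwartz_norm_bound assms) auto
  moreover have "(1 + norm x) ^ m * cmod (D is f x) \<le> (1 + norm x) ^ max k m * cmod (D is f x)"
    by (intro mult_right_mono one_add_norm_power_mono) auto
  ultimately show "cmod (D is f x) \<le> ?B / (1 + norm x) ^ m"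
    by (simp add: field_simps)
qed

lemma schwartz_decay0:
  assumes "f \<in> schwartz"
  obtains B where "B \<ge> 0" "\<And>x. cmod (f x) \<le> B / (1 + norm x) ^ m"
  using schwartz_decay[OF assms, of 0 m] by (metis foldr_Nil id_apply le_refl list.size(3))

subsection \<open>Closure properties\<close>

lemma schwartz_add:
  assumes "f \<in> schwartz" "g \<in> schwartz"
  shows D_add: "D is (\<lambda>x. f x + g x) = (\<lambda>x. D is f x + D is g x)"
    and schwartz_add': "(\<lambda>x. f x + g x) \<in> schwartz"
proof -
  have pd: "(\<lambda>x. f x + g x) differentiable (at x) \<and>
      partial_deriv i (\<lambda>x. f x + g x) x = partial_deriv i f x + partial_deriv i g x"
    if "f \<in> schwartz" "g \<in> schwartz" for f g :: "real^'a \<Rightarrow> complex" and x i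
  proof -
    have "((\<lambda>x. f x + g x) has_derivative (\<lambda>h. \<Sum>i\<in>UNIV. of_real (h $ i) * (partial_deriv i f x + partial_deriv i g x))) (at x)"
      using has_derivative_add[OF schwartz_has_derivative[OF that(1)] schwartz_has_derivative[OF that(2)]]
      by (simp add: algebra_simps sum.distrib)
    then show ?thesis using partial_deriv_eq_coeff by (auto simp: differentiable_def)
  qed
  show "D is (\<lambda>x. f x + g x) = (\<lambda>x. D is f x + D is g x)"
    by (induction "is") (use pd[OF schwartz_D[OF assms(1)] schwartz_D[OF assms(2)]] in auto)
  have "(\<lambda>x. f x + g x) \<in> {\<lambda>x. f x + g x | f g. f \<in> schwartz \<and> g \<in> schwartz}"
    using assms by blast
  then show "(\<lambda>x. f x + g x) \<in> schwartz"
  proof (induct rule: schwartz_coinduct)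
    case (differentiable g x)
    then show ?case using pd by blast
  next
    case (decay h m)
    then obtain f g where h: "h = (\<lambda>x. f x + g x)" "f \<in> schwartz" "g \<in> schwartz" by blast
    obtain B where B: "B \<ge> 0" "\<And>x. cmod (f x) \<le> B / (1 + norm x) ^ m"
      using schwartz_decay0[OF h(2), of m] by blast
    obtain C where C: "C \<ge> 0" "\<And>x. cmod (g x) \<le> C / (1 + norm x) ^ m"
      using schwartz_decay0[OF h(3), of m] by blast
    have "(1 + norm x) ^ m * cmod (h x) \<le> B + C" for x
    proof -
      have "cmod (h x) \<le> B / (1 + norm x) ^ m + C / (1 + norm x) ^ m"
        unfolding h by (intro order_trans[OF norm_triangle_ineq] add_mono B(2) C(2))
      then have "cmod (h x) \<le> (B + C) / (1 + norm x) ^ m" by (simp add: add_divide_distrib)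
      then show ?thesis by (simp add: pos_le_divide_eq mult.commute)
    qed
    then show ?case by blast
  next
    case (partial_deriv h i)
    then obtain f g where h: "h = (\<lambda>x. f x + g x)" "f \<in> schwartz" "g \<in> schwartz" by blast
    have "partial_deriv i h = (\<lambda>x. partial_deriv i f x + partial_deriv i g x)"
      using pd[OF h(2,3)] unfolding h(1) by auto
    then show ?case using h schwartz_partial_deriv by blast
  qed
qed

lemma schwartz_cmult:
  assumes "f \<in> schwartz"
  shows D_cmult: "D is (\<lambda>x. c * f x) = (\<lambda>x. c * D is f x)"
    and schwartz_cmult': "(\<lambda>x. c * f x) \<in> schwartz"
proof -
  have pd: "(\<lambda>x. c * f x) differentiable (at x) \<and>
      partial_deriv i (\<lambda>x. c * f x) x = c * partial_deriv i f x"
    if "f \<in> schwartz" for f :: "real^'a \<Rightarrow> complex" and x i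
  proof -
    have "((\<lambda>x. c * f x) has_derivative (\<lambda>h. \<Sum>i\<in>UNIV. of_real (h $ i) * (c * partial_deriv i f x))) (at x)"
      using has_derivative_mult_right[OF schwartz_has_derivative[OF that], of c x]
      by (simp add: algebra_simps sum_distrib_left)
    then show ?thesis using partial_deriv_eq_coeff by (auto simp: differentiable_def)
  qed
  show *: "D is (\<lambda>x. c * f x) = (\<lambda>x. c * D is f x)" for "is"
    by (induction "is") (use pd[OF schwartz_D[OF assms]] in auto)
  have "\<exists>B. \<forall>x. (1 + norm x) ^ m * cmod (D is (\<lambda>x. c * f x) x) \<le> B" for m "is"
  proof -
    obtain B where "\<And>x. cmod (D is f x) \<le> B / (1 + norm x) ^ m"
      using schwartz_decay0[OF schwartz_D[OF assms]] by metis
    then have "(1 + norm x) ^ m * cmod (D is (\<lambda>x. c * f x) x) \<le> cmod c * B" for x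
      unfolding * norm_mult mult.left_commute[of _ "cmod c"]
      by (intro mult_left_mono) (simp_all add: field_simps)
    then show ?thesis by blast
  qed
  then show "(\<lambda>x. c * f x) \<in> schwartz"
    unfolding schwartz_iff smooth_def using pd[OF schwartz_D[OF assms]] * by auto
qed

lemma schwartz_zero: "(\<lambda>x. 0) \<in> schwartz"
proof -
  have "(\<lambda>x. 0) \<in> {\<lambda>x::real^'a. 0::complex}" by simp
  then show ?thesis
  proof (induct rule: schwartz_coinduct)
    case (partial_deriv g i)
    then show ?case by (auto simp: partial_deriv_def)
  qed auto
qed

lemma schwartz_sum:
  assumes "finite A" "\<And>k. k \<in> A \<Longrightarrow> u k \<in> schwartz"
  shows D_sum: "D is (\<lambda>x. \<Sum>k\<in>A. u k x) = (\<lambda>x. \<Sum>k\<in>A. D is (u k) x)" (is "?P A")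
    and schwartz_sum': "(\<lambda>x. \<Sum>k\<in>A. u k x) \<in> schwartz" (is "?Q A")
proof -
  have z: "D is (\<lambda>x. 0) = (\<lambda>x. 0)" for "is" :: "'b list"
    by (induction "is") (auto simp: partial_deriv_def fun_eq_iff)
  from assms have "?P A \<and> ?Q A"
    by (induction A rule: finite_induct) (auto simp: z schwartz_zero schwartz_add' D_add)
  then show "?P A" "?Q A" by auto
qed

lemma schwartz_diff:
  assumes "f \<in> schwartz" "g \<in> schwartz"
  shows D_diff: "D is (\<lambda>x. f x - g x) = (\<lambda>x. D is f x - D is g x)"
    and schwartz_diff': "(\<lambda>x. f x - g x) \<in> schwartz"
  using schwartz_add[OF assms(1) schwartz_cmult'[OF assms(2), of "-1"]] D_cmult[OF assms(2), of _ "-1"]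
  by auto

lemma one_add_norm_add_le: "1 + norm (x + y) \<le> (1 + norm x) * (1 + norm y)"
proof -
  have "(1 + norm x) * (1 + norm y) = 1 + norm x + norm y + norm x * norm y"
    by (simp add: algebra_simps)
  moreover have "0 \<le> norm x * norm y" by simp
  ultimately show ?thesis using norm_triangle_ineq[of x y] by linarith
qed

text \<open>Peetre's inequality: a weight can be moved from one point to another at the price of a
  weight in the displacement. All decay estimates below rest on it.\<close>

lemma one_add_norm_power_add_le: "(1 + norm (x + y)) ^ m \<le> (1 + norm x) ^ m * (1 + norm y) ^ m"
  unfolding power_mult_distrib[symmetric] by (intro power_mono one_add_norm_add_le) auto

lemma one_add_norm_scaleR_le:
  assumes "c \<noteq> 0" "max 1 (1 / \<bar>c\<bar>) \<le> K"
  shows "1 + norm x \<le> K * (1 + norm (c *\<^sub>R x))"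
proof -
  have "1 / \<bar>c\<bar> \<le> K" "1 \<le> K" using assms by auto
  then have "norm x \<le> K * (\<bar>c\<bar> * norm x)"
    using assms(1) mult_right_mono[of "1 / \<bar>c\<bar>" K "\<bar>c\<bar> * norm x"] by simp
  with \<open>1 \<le> K\<close> show ?thesis by (simp add: algebra_simps)
qed

lemma one_add_norm_affine_power_le:
  assumes "c \<noteq> 0" "max 1 (1 / \<bar>c\<bar>) \<le> K"
  shows "(1 + norm x) ^ m \<le> K ^ m * ((1 + norm (c *\<^sub>R x + a)) ^ m * (1 + norm a) ^ m)"
proof -
  have "K \<ge> 1" using assms(2) by simp
  have "(1 + norm x) ^ m \<le> K ^ m * (1 + norm (c *\<^sub>R x)) ^ m"
    unfolding power_mult_distrib[symmetric] by (intro power_mono one_add_norm_scaleR_le assms) auto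
  also have "(1 + norm (c *\<^sub>R x)) ^ m \<le> (1 + norm (c *\<^sub>R x + a)) ^ m * (1 + norm a) ^ m"
    using one_add_norm_power_add_le[of "c *\<^sub>R x + a" "-a" m] by simp
  finally show ?thesis using \<open>K \<ge> 1\<close> by simp
qed

lemma smooth_affine:
  assumes "smooth f"
  shows D_affine: "D is (\<lambda>x. f (c *\<^sub>R x + a)) = (\<lambda>x. of_real (c ^ length is) * D is f (c *\<^sub>R x + a))"
    and smooth_affine': "smooth (\<lambda>x. f (c *\<^sub>R x + a))"
proof -
  have hd: "((\<lambda>x. e * D is f (c *\<^sub>R x + a)) has_derivative
     (\<lambda>h. \<Sum>i\<in>UNIV. of_real (h $ i) * (e * (of_real c * D (i # is) f (c *\<^sub>R x + a))))) (at x)" for x "is" e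
  proof -
    have 1: "((\<lambda>x. c *\<^sub>R x + a) has_derivative (\<lambda>h. c *\<^sub>R h)) (at x)"
      by (auto intro!: derivative_eq_intros)
    have "D is f differentiable (at (c *\<^sub>R x + a))" using assms by (auto simp: smooth_def)
    from has_derivative_mult_right[OF has_derivative_compose[OF 1 has_derivative_partial_derivs[OF this]], of e]
    show ?thesis by (simp add: sum_distrib_left mult_ac)
  qed
  show *: "D is (\<lambda>x. f (c *\<^sub>R x + a)) = (\<lambda>x. of_real (c ^ length is) * D is f (c *\<^sub>R x + a))" for "is"
  proof (induction "is")
    case (Cons i "is")
    show ?case
      by (rule ext) (use partial_deriv_eq_coeff[OF hd, of i "of_real (c ^ length is)" "is"] Cons in
          \<open>simp add: mult_ac\<close>)
  qed simp
  show "smooth (\<lambda>x. f (c *\<^sub>R x + a))"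
    unfolding smooth_def * differentiable_def using hd by blast
qed

lemma schwartz_affine:
  assumes "f \<in> schwartz" "c \<noteq> 0"
  shows "(\<lambda>x. f (c *\<^sub>R x + a)) \<in> schwartz"
proof -
  note sm = schwartz_smooth[OF assms(1)]
  define K where "K = max 1 (1 / \<bar>c\<bar>)"
  have "\<exists>B. \<forall>x. (1 + norm x) ^ m * cmod (D is (\<lambda>x. f (c *\<^sub>R x + a)) x) \<le> B" for m "is"
  proof -
    obtain B where B: "B \<ge> 0" "\<And>x. cmod (D is f x) \<le> B / (1 + norm x) ^ m"
      using schwartz_decay0[OF schwartz_D[OF assms(1), of "is"], of m] by blast
    have "(1 + norm x) ^ m * cmod (D is (\<lambda>x. f (c *\<^sub>R x + a)) x) \<le> \<bar>c\<bar> ^ length is * (K ^ m * ((1 + norm a) ^ m * B))" for x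
    proof -
      have "(1 + norm x) ^ m * cmod (D is (\<lambda>x. f (c *\<^sub>R x + a)) x)
        \<le> (K ^ m * ((1 + norm (c *\<^sub>R x + a)) ^ m * (1 + norm a) ^ m)) * (\<bar>c\<bar> ^ length is * cmod (D is f (c *\<^sub>R x + a)))"
        unfolding D_affine[OF sm] norm_mult norm_of_real power_abs
        by (intro mult_right_mono one_add_norm_affine_power_le assms) (auto simp: K_def)
      also have "\<dots> = (K ^ m * ((1 + norm a) ^ m * \<bar>c\<bar> ^ length is)) * ((1 + norm (c *\<^sub>R x + a)) ^ m * cmod (D is f (c *\<^sub>R x + a)))"
        by (simp only: mult_ac)
      also have "\<dots> \<le> (K ^ m * ((1 + norm a) ^ m * \<bar>c\<bar> ^ length is)) * B"
        using B(2)[of "c *\<^sub>R x + a"] by (intro mult_left_mono) (auto simp: K_def field_simps)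
      finally show ?thesis by (simp add: mult_ac)
    qed
    then show ?thesis by blast
  qed
  then show ?thesis unfolding schwartz_iff using smooth_affine'[OF sm] by auto
qed

lemma schwartz_cnj:
  assumes "f \<in> schwartz"
  shows D_cnj: "D is (\<lambda>x. cnj (f x)) = (\<lambda>x. cnj (D is f x))"
    and schwartz_cnj': "(\<lambda>x. cnj (f x)) \<in> schwartz"
proof -
  have pd: "(\<lambda>x. cnj (f x)) differentiable (at x) \<and>
      partial_deriv i (\<lambda>x. cnj (f x)) x = cnj (partial_deriv i f x)"
    if "f \<in> schwartz" for f :: "real^'a \<Rightarrow> complex" and x i
  proof -
    have "((\<lambda>x. cnj (f x)) has_derivative (\<lambda>h. \<Sum>i\<in>UNIV. of_real (h $ i) * cnj (partial_deriv i f x))) (at x)"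
      using bounded_linear.has_derivative[OF bounded_linear_cnj schwartz_has_derivative[OF that, of x]]
      by simp
    then show ?thesis using partial_deriv_eq_coeff by (auto simp: differentiable_def)
  qed
  show *: "D is (\<lambda>x. cnj (f x)) = (\<lambda>x. cnj (D is f x))" for "is"
    by (induction "is") (use pd[OF schwartz_D[OF assms]] in auto)
  show "(\<lambda>x. cnj (f x)) \<in> schwartz"
    using assms unfolding schwartz_iff smooth_def * using pd[OF schwartz_D[OF assms]] by auto
qed

text \<open>The products x_i f alone are not closed under d_i, which also yields the summand f; the
  family x_i f + g is.\<close>

lemma schwartz_times_component:
  assumes "f \<in> schwartz"
  shows "(\<lambda>x. of_real (x $ i) * f x) \<in> schwartz"
proof -
  have "(\<lambda>x. of_real (x $ i) * f x) \<in> {\<lambda>x. of_real (x $ i) * f x + g x | f g. f \<in> schwartz \<and> g \<in> schwartz}"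
    using assms schwartz_zero by force
  then show ?thesis
  proof (induct rule: schwartz_coinduct)
    case (differentiable h x)
    moreover have "(\<lambda>x::real^'a. complex_of_real (x $ i)) differentiable (at x)"
      by (intro bounded_linear_imp_differentiable bounded_linear_compose[OF bounded_linear_of_real bounded_linear_vec_nth])
    ultimately show ?case using schwartz_differentiable by (auto intro!: derivative_intros)
  next
    case (decay h m)
    then obtain f g where h: "h = (\<lambda>x. of_real (x $ i) * f x + g x)" "f \<in> schwartz" "g \<in> schwartz" by blast
    obtain B where B: "B \<ge> 0" "\<And>x. cmod (f x) \<le> B / (1 + norm x) ^ Suc m"
      using schwartz_decay0[OF h(2), of "Suc m"] by blast
    obtain C where C: "C \<ge> 0" "\<And>x. cmod (g x) \<le> C / (1 + norm x) ^ m"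
      using schwartz_decay0[OF h(3), of m] by blast
    have "(1 + norm x) ^ m * cmod (h x) \<le> B + C" for x
    proof -
      have "cmod (h x) \<le> norm x * (B / (1 + norm x) ^ Suc m) + C / (1 + norm x) ^ m"
        unfolding h
        by (intro order_trans[OF norm_triangle_ineq] add_mono C(2))
          (simp only: norm_mult norm_of_real, intro mult_mono B(2) component_le_norm_cart, auto)
      also have "norm x * (B / (1 + norm x) ^ Suc m) \<le> (1 + norm x) * (B / (1 + norm x) ^ Suc m)"
        using B(1) by (intro mult_right_mono divide_nonneg_nonneg) auto
      also have "\<dots> = B / (1 + norm x) ^ m"
        using one_add_norm_power_pos(3)[of x 1] by (simp del: one_add_norm_power_pos)
      finally have "cmod (h x) \<le> (B + C) / (1 + norm x) ^ m" by (simp add: add_divide_distrib)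
      then show ?thesis by (simp add: pos_le_divide_eq mult.commute)
    qed
    then show ?case by blast
  next
    case (partial_deriv h j)
    then obtain f g where h: "h = (\<lambda>x. of_real (x $ i) * f x + g x)" "f \<in> schwartz" "g \<in> schwartz" by blast
    have HD: "(h has_derivative (\<lambda>k. \<Sum>j\<in>UNIV. of_real (k $ j) *
        (of_real (x $ i) * partial_deriv j f x + ((if i = j then 1 else 0) * f x + partial_deriv j g x)))) (at x)" for x
    proof -
      have 1: "((\<lambda>x::real^'a. complex_of_real (x $ i)) has_derivative (\<lambda>k. of_real (k $ i))) (at x)"
        by (intro bounded_linear_imp_has_derivative bounded_linear_compose[OF bounded_linear_of_real bounded_linear_vec_nth])
      have A: "of_real (k $ i) * f x = (\<Sum>j\<in>UNIV. of_real (k $ j) * ((if i = j then 1 else 0) * f x))" for k :: "real^'a"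
      proof -
        have "(\<Sum>j\<in>UNIV. of_real (k $ j) * ((if i = j then 1 else 0) * f x)) = (\<Sum>j\<in>UNIV. if j = i then of_real (k $ i) * f x else 0)"
          by (intro sum.cong) auto
        then show ?thesis by simp
      qed
      have "(\<lambda>k::real^'a. \<Sum>j\<in>UNIV. of_real (k $ j) *
          (of_real (x $ i) * partial_deriv j f x + ((if i = j then 1 else 0) * f x + partial_deriv j g x)))
        = (\<lambda>k. (of_real (x $ i) * (\<Sum>j\<in>UNIV. of_real (k $ j) * partial_deriv j f x) + of_real (k $ i) * f x)
            + (\<Sum>j\<in>UNIV. of_real (k $ j) * partial_deriv j g x))"
        unfolding A sum_distrib_left sum.distrib[symmetric]
        by (intro ext sum.cong refl) (simp only: distrib_left mult.left_commute add.assoc)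
      then show ?thesis
        unfolding h(1)
        by (simp only:) (rule has_derivative_add[OF has_derivative_mult[OF 1 schwartz_has_derivative[OF h(2)]] schwartz_has_derivative[OF h(3)]])
    qed
    have "partial_deriv j h = (\<lambda>x. of_real (x $ i) * partial_deriv j f x + ((if i = j then 1 else 0) * f x + partial_deriv j g x))"
      by (rule ext) (rule partial_deriv_eq_coeff[OF HD])
    moreover have "(\<lambda>x. (if i = j then 1 else 0) * f x + partial_deriv j g x) \<in> schwartz"
      by (intro schwartz_add' schwartz_cmult' schwartz_partial_deriv h)
    ultimately show ?case
      unfolding mem_Collect_eq
      by (intro exI[of _ "partial_deriv j f"] exI[of _ "\<lambda>x. (if i = j then 1 else 0) * f x + partial_deriv j g x"]
          conjI schwartz_partial_deriv h(2))
  qed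
qed

section \<open>Integration on Euclidean space\<close>

text \<open>\<open>lborel\<close> on \<open>real^'n\<close> is the image of a product measure
  indexed by \<open>Basis\<close>, so the factors are first reindexed from coordinates to basis
  vectors through \<open>inv ?e\<close>.\<close>

lemma
  fixes h :: "'n::finite \<Rightarrow> real \<Rightarrow> 'b::{real_normed_field,banach,second_countable_topology}"
  assumes "\<And>i. integrable lborel (h i)"
  shows integrable_prod_components: "integrable lborel (\<lambda>x::real^'n. \<Prod>i\<in>UNIV. h i (x $ i))"
    and integral_prod_components: "(\<integral>x. (\<Prod>i\<in>UNIV. h i (x $ i)) \<partial>(lborel :: (real^'n) measure)) = (\<Prod>i\<in>UNIV. \<integral>t. h i t \<partial>lborel)"
proof -
  let ?e = "\<lambda>i::'n. axis i (1::real)"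
  define H where "H = (\<lambda>b. h (inv ?e b))"
  have inj: "inj ?e" by (auto intro!: injI simp: axis_eq_axis)
  have Basis: "(Basis :: (real^'n) set) = range ?e" by (auto simp: Basis_vec_def)
  have [measurable]: "h i \<in> borel_measurable borel" for i
    using assms[of i] by simp
  have [measurable]: "H b \<in> borel_measurable borel" for b by (simp add: H_def)
  have eq: "(\<Prod>i\<in>UNIV. h i (x $ i)) = (\<Prod>b\<in>Basis. H b (x \<bullet> b))" for x :: "real^'n"
    unfolding Basis by (subst prod.reindex[OF inj]) (simp add: H_def inv_f_f[OF inj] inner_axis)
  have eq': "(\<Prod>i\<in>UNIV. \<integral>t. h i t \<partial>lborel) = (\<Prod>b\<in>(Basis :: (real^'n) set). \<integral>t. H b t \<partial>lborel)"
    unfolding Basis by (subst prod.reindex[OF inj]) (simp add: H_def inv_f_f[OF inj])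
  interpret product_sigma_finite "\<lambda>_::real^'n. lborel :: real measure"
    by (simp add: product_sigma_finite_def sigma_finite_lborel)
  let ?P = "\<Pi>\<^sub>M b\<in>(Basis :: (real^'n) set). (lborel :: real measure)"
  let ?T = "\<lambda>f. \<Sum>b\<in>(Basis :: (real^'n) set). f b *\<^sub>R b"
  have I: "integrable ?P (\<lambda>x. \<Prod>b\<in>Basis. H b (x b))"
    by (intro product_integrable_prod) (auto simp: H_def assms)
  have J: "(\<integral>x. (\<Prod>b\<in>Basis. H b (x b)) \<partial>?P) = (\<Prod>b\<in>(Basis :: (real^'n) set). \<integral>t. H b t \<partial>lborel)"
    by (intro product_integral_prod) (auto simp: H_def assms)
  have T: "?T \<in> measurable ?P borel" by measurable
  have g: "(\<lambda>x::real^'n. \<Prod>b\<in>Basis. H b (x \<bullet> b)) \<in> borel_measurable borel" by measurable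
  have gT: "(\<Prod>b\<in>Basis. H b (?T f \<bullet> b)) = (\<Prod>b\<in>Basis. H b (f b))" for f
    by (intro prod.cong) auto
  show "integrable lborel (\<lambda>x::real^'n. \<Prod>i\<in>UNIV. h i (x $ i))"
    unfolding eq by (subst lborel_eq, subst integrable_distr_eq[OF T g]) (simp only: gT I)
  show "(\<integral>x. (\<Prod>i\<in>UNIV. h i (x $ i)) \<partial>(lborel :: (real^'n) measure)) = (\<Prod>i\<in>UNIV. \<integral>t. h i t \<partial>lborel)"
    unfolding eq eq' by (subst lborel_eq, subst integral_distr[OF T g]) (simp only: gT J)
qed

text \<open>Origin of the exponent 2 n that governs integrability and lattice sums throughout: each
  1 + x_i^2 is at most (1 + |x|)^2, so the function lies below a product of n one-dimensional
  functions 1 / (1 + t^2).\<close>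

lemma integrable_inverse_power_norm:
  "integrable lborel (\<lambda>x::real^'n::finite. 1 / (1 + norm x) ^ (2 * CARD('n)))"
proof (rule Bochner_Integration.integrable_bound)
  have "integrable lborel (\<lambda>t::real. inverse (1 + t\<^sup>2))"
    using integrable_inverse_1_plus_square by (simp add: set_integrable_def)
  then show "integrable lborel (\<lambda>x::real^'n. \<Prod>i\<in>UNIV. inverse (1 + (x $ i)\<^sup>2))"
    by (intro integrable_prod_components)
  have "continuous_on UNIV (\<lambda>x::real^'n. 1 / (1 + norm x) ^ (2 * CARD('n)))"
    by (intro continuous_intros ballI one_add_norm_power_pos)
  then show "(\<lambda>x::real^'n. 1 / (1 + norm x) ^ (2 * CARD('n))) \<in> borel_measurable lborel"
    by (simp add: borel_measurable_continuous_onI)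
  have "1 / (1 + norm x) ^ (2 * CARD('n)) \<le> (\<Prod>i\<in>UNIV. inverse (1 + (x $ i)\<^sup>2))" for x :: "real^'n"
  proof -
    have "1 + (x $ i)\<^sup>2 \<le> (1 + norm x)\<^sup>2" for i
    proof -
      have "(x $ i)\<^sup>2 \<le> (norm x)\<^sup>2"
        using component_le_norm_cart[of x i] by (metis abs_le_square_iff abs_norm_cancel)
      then show ?thesis using norm_ge_zero[of x] unfolding power2_sum by (auto intro: add_nonneg_nonneg simp: add_increasing2)
    qed
    then have "(\<Prod>i\<in>UNIV. 1 + (x $ i)\<^sup>2) \<le> (\<Prod>i\<in>(UNIV::'n set). (1 + norm x)\<^sup>2)"
      by (intro prod_mono) (auto intro: add_nonneg_nonneg)
    moreover have "(\<Prod>i\<in>(UNIV::'n set). (1 + norm x)\<^sup>2) = (1 + norm x) ^ (2 * CARD('n))"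
      by (simp add: power_mult)
    moreover have "0 < (\<Prod>i\<in>UNIV. 1 + (x $ i)\<^sup>2)"
      by (intro prod_pos) (auto simp: add_pos_nonneg)
    ultimately show ?thesis
      using le_imp_inverse_le prod_inversef[of "\<lambda>i. 1 + (x $ i)\<^sup>2" UNIV]
      by (simp add: comp_def inverse_eq_divide frac_le)
  qed
  then show "AE x in lborel. norm (1 / (1 + norm x) ^ (2 * CARD('n))) \<le> norm (\<Prod>i\<in>UNIV. inverse (1 + ((x::real^'n) $ i)\<^sup>2))"
    by (intro AE_I2) (auto simp: abs_of_nonneg intro!: order_trans[OF _ abs_ge_self])
qed

lemma integrable_of_decay:
  fixes f :: "real^'n::finite \<Rightarrow> 'b::{banach,second_countable_topology}"
  assumes "f \<in> borel_measurable borel" "\<And>x. norm (f x) \<le> B / (1 + norm x) ^ (2 * CARD('n))"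
  shows "integrable lborel f"
proof (rule Bochner_Integration.integrable_bound)
  show "integrable lborel (\<lambda>x::real^'n. B * (1 / (1 + norm x) ^ (2 * CARD('n))))"
    by (intro integrable_mult_right integrable_inverse_power_norm)
  show "AE x in lborel. norm (f x) \<le> norm (B * (1 / (1 + norm x) ^ (2 * CARD('n))))"
    using assms(2) by (intro AE_I2) (auto simp: abs_mult intro!: order_trans[OF _ divide_right_mono[OF abs_ge_self]])
qed (use assms in simp)

lemma
  fixes f :: "real^'n::finite \<Rightarrow> 'b::{banach,second_countable_topology}"
  assumes "c \<noteq> 0" "f \<in> borel_measurable borel"
  shows integral_affine: "(\<integral>x. f (c *\<^sub>R x + a) \<partial>lborel) = (1 / \<bar>c\<bar> ^ CARD('n)) *\<^sub>R (\<integral>x. f x \<partial>lborel)"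
    and integrable_affine_iff: "integrable lborel (\<lambda>x. f (c *\<^sub>R x + a)) \<longleftrightarrow> integrable lborel f"
proof -
  have T: "(\<lambda>x::real^'n. a + c *\<^sub>R x) \<in> measurable lborel borel" by measurable
  have "(\<integral>x. f x \<partial>lborel) = (\<integral>x. f x \<partial>density (distr lborel borel (\<lambda>x. a + c *\<^sub>R x)) (\<lambda>_. \<bar>c\<bar> ^ DIM(real^'n)))"
    by (subst lborel_affine[OF assms(1), of a]) simp
  also have "\<dots> = (\<integral>x. (\<bar>c\<bar> ^ DIM(real^'n)) *\<^sub>R f x \<partial>distr lborel borel (\<lambda>x. a + c *\<^sub>R x))"
    using assms(2) by (subst integral_density) auto
  also have "\<dots> = (\<integral>x. (\<bar>c\<bar> ^ DIM(real^'n)) *\<^sub>R f (a + c *\<^sub>R x) \<partial>lborel)"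
    using assms(2) by (subst integral_distr[OF T]) auto
  finally show "(\<integral>x. f (c *\<^sub>R x + a) \<partial>lborel) = (1 / \<bar>c\<bar> ^ CARD('n)) *\<^sub>R (\<integral>x. f x \<partial>lborel)"
    using assms(1) by (simp add: add.commute)
  have "integrable lborel f \<longleftrightarrow> integrable (density (distr lborel borel (\<lambda>x. a + c *\<^sub>R x)) (\<lambda>_. \<bar>c\<bar> ^ DIM(real^'n))) f"
    by (subst lborel_affine[OF assms(1), of a]) simp
  also have "\<dots> \<longleftrightarrow> integrable (distr lborel borel (\<lambda>x. a + c *\<^sub>R x)) (\<lambda>x. (\<bar>c\<bar> ^ DIM(real^'n)) *\<^sub>R f x)"
    using assms(2) by (subst integrable_density) auto
  also have "\<dots> \<longleftrightarrow> integrable lborel (\<lambda>x. (\<bar>c\<bar> ^ DIM(real^'n)) *\<^sub>R f (a + c *\<^sub>R x))"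
    using assms(2) by (subst integrable_distr_eq[OF T]) auto
  finally show "integrable lborel (\<lambda>x. f (c *\<^sub>R x + a)) \<longleftrightarrow> integrable lborel f"
    using assms(1) integrable_scaleR_right[of "\<bar>c\<bar> ^ CARD('n)" lborel "\<lambda>x. f (a + c *\<^sub>R x)"]
      integrable_scaleR_right[of "1 / \<bar>c\<bar> ^ CARD('n)" lborel "\<lambda>x. (\<bar>c\<bar> ^ CARD('n)) *\<^sub>R f (a + c *\<^sub>R x)"]
    by (auto simp: add.commute)
qed

lemma integral_translation:
  fixes f :: "real^'n::finite \<Rightarrow> 'b::{banach,second_countable_topology}"
  assumes "f \<in> borel_measurable borel"
  shows "(\<integral>x. f (x + a) \<partial>lborel) = (\<integral>x. f x \<partial>lborel)"
  using integral_affine[of 1 f a] assms by simp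

text \<open>Decay without smoothness is what the factor u of an average has to satisfy; in
  \<open>sampling\<close> this u is a Schwartz function times a character, and only its decay has to
  be checked there.\<close>

definition rapid :: "(real^'n::finite \<Rightarrow> complex) \<Rightarrow> bool" where
  "rapid u \<longleftrightarrow> u \<in> borel_measurable borel \<and> (\<forall>m. \<exists>B. \<forall>x. (1 + norm x) ^ m * cmod (u x) \<le> B)"

lemma rapid_measurable [measurable_dest]: "rapid u \<Longrightarrow> u \<in> borel_measurable borel"
  by (simp add: rapid_def)

lemma schwartz_rapid: "f \<in> schwartz \<Longrightarrow> rapid f"
  unfolding rapid_def schwartz_iff using schwartz_measurable[unfolded schwartz_iff]
  by (metis foldr_Nil id_apply)

lemma rapid_mult_bounded:
  assumes "rapid u" "b \<in> borel_measurable borel" "\<And>x. cmod (b x) \<le> K"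
  shows "rapid (\<lambda>x. b x * u x)"
  unfolding rapid_def
proof (intro conjI allI)
  show "(\<lambda>x. b x * u x) \<in> borel_measurable borel" using assms(1,2) by (auto simp: rapid_def intro: borel_measurable_times)
  fix m
  obtain B where B: "\<And>x. (1 + norm x) ^ m * cmod (u x) \<le> B" using assms(1) by (auto simp: rapid_def)
  have "(1 + norm x) ^ m * cmod (b x * u x) \<le> K * B" for x
    using mult_mono[OF assms(3) B] order_trans[OF norm_ge_zero assms(3)]
    by (simp add: norm_mult mult_ac)
  then show "\<exists>B. \<forall>x. (1 + norm x) ^ m * cmod (b x * u x) \<le> B" by blast
qed

lemma integrable_rapid_weight:
  fixes u :: "real^'n::finite \<Rightarrow> complex"
  assumes "rapid u"
  shows "integrable lborel (\<lambda>x. cmod (u x) * (1 + norm x) ^ m)"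
proof -
  obtain B where B: "\<And>x. (1 + norm x) ^ (2 * CARD('n) + m) * cmod (u x) \<le> B"
    using assms by (auto simp: rapid_def)
  show ?thesis
  proof (rule integrable_of_decay)
    show "(\<lambda>x. cmod (u x) * (1 + norm x) ^ m) \<in> borel_measurable borel"
      using assms by measurable
    show "norm (cmod (u x) * (1 + norm x) ^ m) \<le> B / (1 + norm x) ^ (2 * CARD('n))" for x
      using B[of x] by (simp add: power_add field_simps abs_mult)
  qed
qed

lemma integrable_rapid: "rapid u \<Longrightarrow> integrable lborel u"
  using integrable_rapid_weight[of u 0] by (simp add: integrable_norm_iff rapid_def)

lemma integrable_rapid_mult:
  fixes u b :: "real^'n::finite \<Rightarrow> complex"
  assumes "rapid u" "b \<in> borel_measurable borel" "\<And>x. cmod (b x) \<le> K * (1 + norm x) ^ m"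
  shows "integrable lborel (\<lambda>x. u x * b x)"
proof (rule Bochner_Integration.integrable_bound)
  show "integrable lborel (\<lambda>x. K * (cmod (u x) * (1 + norm x) ^ m))"
    by (intro integrable_mult_right integrable_rapid_weight assms)
  show "AE x in lborel. norm (u x * b x) \<le> norm (K * (cmod (u x) * (1 + norm x) ^ m))"
  proof (rule AE_I2)
    fix x show "norm (u x * b x) \<le> norm (K * (cmod (u x) * (1 + norm x) ^ m))"
      using mult_left_mono[OF assms(3)[of x] norm_ge_zero[of "u x"]]
      by (simp add: norm_mult mult_ac)
  qed
  show "(\<lambda>x. u x * b x) \<in> borel_measurable lborel"
    using assms(1,2) by (auto simp: rapid_def intro: borel_measurable_times)
qed

lemma cmod_integral_le:
  fixes f :: "'a::euclidean_space \<Rightarrow> complex"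
  assumes "integrable lborel g" "\<And>x. cmod (f x) \<le> g x"
  shows "cmod (\<integral>x. f x \<partial>lborel) \<le> (\<integral>x. g x \<partial>lborel)"
proof (cases "integrable lborel f")
  case True
  then show ?thesis
    using assms by (intro order_trans[OF integral_norm_bound] integral_mono) auto
next
  \<comment> \<open>The integral of a non-integrable f is 0 by convention, while g dominates a norm
    and so has a nonnegative integral.\<close>
  case False
  then show ?thesis
    using order_trans[OF norm_ge_zero assms(2)] by (simp add: not_integrable_integral_eq)
qed

section \<open>Taylor expansion\<close>

text \<open>Indexing monomials and derivatives by lists of coordinates turns the weights \<open>1 / \<alpha>!\<close> of the
  Taylor polynomial into \<open>1 / k!\<close>: a multiindex \<open>\<alpha>\<close> of length \<open>k\<close> is the count of \<open>k! / \<alpha>!\<close> lists.\<close>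

definition lpow :: "real^'n::finite \<Rightarrow> 'n list \<Rightarrow> real" where
  "lpow h is = prod_list (map (\<lambda>i. h $ i) is)"

lemma lpow_Nil [simp]: "lpow h [] = 1" and lpow_Cons [simp]: "lpow h (i # is) = h $ i * lpow h is"
  by (simp_all add: lpow_def)

lemma abs_lpow_le: "\<bar>lpow h is\<bar> \<le> norm h ^ length is"
  by (induction "is") (auto simp: abs_mult intro!: mult_mono component_le_norm_cart)

lemma lpow_scaleR: "lpow (c *\<^sub>R h) is = c ^ length is * lpow h is"
  by (induction "is") auto

lemma mpower_count_list: "mpower h (count_list is) = lpow h is"
proof (induction "is")
  case (Cons i "is")
  have "(\<Prod>j\<in>UNIV. (h $ j) ^ count_list (i # is) j) = (\<Prod>j\<in>UNIV. (if j = i then h $ i else 1) * (h $ j) ^ count_list is j)"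
    by (intro prod.cong) auto
  then show ?case using Cons by (simp add: mpower_def prod.distrib)
qed (simp add: mpower_def)

lemma finite_lists_length: "finite {is :: 'n::finite list. length is = k}"
  using finite_lists_length_eq[of "UNIV :: 'n set" k] by simp

lemma card_lists_length: "card {is :: 'n::finite list. length is = k} = CARD('n) ^ k"
  using card_lists_length_eq[of "UNIV :: 'n set" k] by simp

lemma sum_lists_length_Suc:
  fixes F :: "'n::finite list \<Rightarrow> 'b::comm_monoid_add"
  shows "(\<Sum>is | length is = Suc k. F is) = (\<Sum>is | length is = k. \<Sum>i\<in>UNIV. F (i # is))"
proof -
  have "{is :: 'n list. length is = Suc k} = (\<lambda>(is, i). i # is) ` ({is. length is = k} \<times> UNIV)"
    by (auto simp: length_Suc_conv image_iff)
  moreover have "inj_on (\<lambda>(is, i). i # is) ({is :: 'n list. length is = k} \<times> UNIV)"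
    by (auto simp: inj_on_def)
  ultimately show ?thesis
    by (simp add: sum.reindex sum.cartesian_product split_def)
qed

text \<open>\<open>p\<close> counts the orders that are kept: degree m is p = m + 1, and degree -1
  is the empty sum p = 0.\<close>

definition taylor_sum :: "nat \<Rightarrow> (real^'n::finite \<Rightarrow> complex) \<Rightarrow> real^'n \<Rightarrow> real^'n \<Rightarrow> complex" where
  "taylor_sum p g y h = (\<Sum>k<p. (\<Sum>is | length is = k. of_real (lpow h is) * D is g y) / fact k)"

lemma taylor_sum_0 [simp]: "taylor_sum 0 g y h = 0"
  by (simp add: taylor_sum_def)

lemma taylor_sum_1: "taylor_sum (Suc 0) g y h = g y"
  by (simp add: taylor_sum_def)

lemma taylor_sum_2: "taylor_sum 2 g y h = g y + (\<Sum>i\<in>UNIV. of_real (h $ i) * partial_deriv i g y)"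
  by (simp add: taylor_sum_def numeral_2_eq_2 sum_lists_length_Suc)

text \<open>Taylor's formula with integral remainder on the segment from y to y + h. The derivatives
  at y + t h decay in y + t h; Peetre's inequality turns this into decay in y at the price of (1 +
  |h|)^M. The factor n^p counts the lists of length p.\<close>

lemma schwartz_taylor_remainder:
  fixes g :: "real^'n::finite \<Rightarrow> complex"
  assumes "g \<in> schwartz"
  obtains B where "B \<ge> 0" "\<And>y h. cmod (g (y + h) - taylor_sum p g y h)
    \<le> B * norm h ^ p * (1 + norm h) ^ M / (1 + norm y) ^ M"
proof -
  obtain B where B: "B \<ge> 0" "\<And>is x. length is \<le> p \<Longrightarrow> cmod (D is g x) \<le> B / (1 + norm x) ^ M"
    using schwartz_decay[OF assms, of p M] by blast
  have shift: "1 / (1 + norm (y + t *\<^sub>R h)) ^ M \<le> (1 + norm h) ^ M / (1 + norm y) ^ M"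
    if "0 \<le> t" "t \<le> 1" for y h :: "real^'n" and t
  proof -
    have "(1 + norm y) ^ M \<le> (1 + norm (y + t *\<^sub>R h)) ^ M * (1 + norm (- (t *\<^sub>R h))) ^ M"
      using one_add_norm_power_add_le[of "y + t *\<^sub>R h" "- (t *\<^sub>R h)" M] by simp
    also have "\<dots> \<le> (1 + norm (y + t *\<^sub>R h)) ^ M * (1 + norm h) ^ M"
      using that by (intro mult_left_mono power_mono) (auto intro: mult_left_le_one_le)
    finally show ?thesis by (simp add: divide_simps mult_ac)
  qed
  define Td where "Td k h y = (\<Sum>is | length is = k. of_real (lpow h is) * D is g y)" for k h and y :: "real^'n"
  have Td_bound: "cmod (Td p h (y + t *\<^sub>R h)) \<le> real (CARD('n) ^ p) * B * norm h ^ p * (1 + norm h) ^ M / (1 + norm y) ^ M"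
    if "0 \<le> t" "t \<le> 1" for y h t
  proof -
    have "cmod (Td p h (y + t *\<^sub>R h)) \<le> (\<Sum>is | length (is :: 'n list) = p. norm h ^ p * (B * ((1 + norm h) ^ M / (1 + norm y) ^ M)))"
      unfolding Td_def
    proof (rule sum_norm_le)
      fix "is" :: "'n list" assume "is \<in> {is. length is = p}"
      then have l: "length is = p" by simp
      have "cmod (D is g (y + t *\<^sub>R h)) \<le> B * (1 / (1 + norm (y + t *\<^sub>R h)) ^ M)"
        using B(2)[of "is"] l by simp
      also have "\<dots> \<le> B * ((1 + norm h) ^ M / (1 + norm y) ^ M)"
        by (intro mult_left_mono shift that B)
      finally show "cmod (of_real (lpow h is) * D is g (y + t *\<^sub>R h)) \<le> norm h ^ p * (B * ((1 + norm h) ^ M / (1 + norm y) ^ M))"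
        unfolding norm_mult norm_of_real using abs_lpow_le[of h "is"] l by (intro mult_mono) auto
    qed
    then show ?thesis by (simp add: card_lists_length mult_ac)
  qed
  have Td_deriv: "((\<lambda>t. Td k h (y + t *\<^sub>R h)) has_vector_derivative Td (Suc k) h (y + t *\<^sub>R h)) (at t within S)" for k h y t S
  proof -
    have "((\<lambda>t. D is g (y + t *\<^sub>R h)) has_vector_derivative (\<Sum>i\<in>UNIV. of_real (h $ i) * D (i # is) g (y + t *\<^sub>R h))) (at t within S)" for "is"
    proof -
      have 1: "((\<lambda>t. y + t *\<^sub>R h) has_derivative (\<lambda>t. t *\<^sub>R h)) (at t within S)"
        by (auto intro!: derivative_eq_intros)
      from has_derivative_compose[OF 1 schwartz_has_derivative[OF schwartz_D[OF assms, of "is"]]]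
      moreover have "of_real ((t *\<^sub>R h) $ i) * z = t *\<^sub>R (of_real (h $ i) * z)" for t i and z :: complex
        by (simp add: scaleR_conv_of_real[of t "_ :: complex"])
      ultimately show ?thesis
        by (simp only: has_vector_derivative_def scaleR_sum_right foldr.simps comp_apply)
    qed
    then have "((\<lambda>t. Td k h (y + t *\<^sub>R h)) has_vector_derivative
        (\<Sum>is | length is = k. of_real (lpow h is) * (\<Sum>i\<in>UNIV. of_real (h $ i) * D (i # is) g (y + t *\<^sub>R h)))) (at t within S)"
      unfolding Td_def by (intro has_vector_derivative_sum has_vector_derivative_mult_right)
    then show ?thesis
      by (simp add: Td_def sum_lists_length_Suc sum_distrib_left mult_ac)
  qed
  show thesis
  proof (rule that[of "real (CARD('n) ^ p) * B"])
    show "0 \<le> real (CARD('n) ^ p) * B" using B(1) by simp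
    fix y h
    show "cmod (g (y + h) - taylor_sum p g y h) \<le> real (CARD('n) ^ p) * B * norm h ^ p * (1 + norm h) ^ M / (1 + norm y) ^ M"
    \<comment> \<open>The integral remainder requires p > 0; for p = 0 the claim is the decay of g
      itself, read off at t = 1.\<close>
    proof (cases "p = 0")
      case True
      then show ?thesis using Td_bound[of 1 h y] by (simp add: Td_def)
    next
      case False
      have 0: "(\<lambda>t. Td 0 h (y + t *\<^sub>R h)) = (\<lambda>t. g (y + t *\<^sub>R h))" by (simp add: Td_def)
      have "((\<lambda>t. ((1 - t) ^ (p - 1) / fact (p - 1)) *\<^sub>R Td p h (y + t *\<^sub>R h)) has_integral
          g (y + 1 *\<^sub>R h) - (\<Sum>k<p. ((1 - 0) ^ k / fact k) *\<^sub>R Td k h (y + 0 *\<^sub>R h))) {0..1}"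
        by (rule Taylor_has_integral[OF _ 0 Td_deriv]) (use False in auto)
      then have I: "((\<lambda>t. ((1 - t) ^ (p - 1) / fact (p - 1)) *\<^sub>R Td p h (y + t *\<^sub>R h)) has_integral
          g (y + h) - taylor_sum p g y h) {0..1}"
        by (simp add: taylor_sum_def Td_def scaleR_conv_of_real divide_inverse mult.commute)
      let ?K = "real (CARD('n) ^ p) * B * norm h ^ p * (1 + norm h) ^ M / (1 + norm y) ^ M"
      have "cmod (g (y + h) - taylor_sum p g y h) \<le> ?K * measure lborel {0..1::real}"
      proof (rule has_integral_bound_real[OF _ _ I])
        show "0 \<le> ?K" using B(1) by simp
        fix t :: real assume t: "t \<in> {0..1} - {}"
        have "(1 - t) ^ (p - 1) / fact (p - 1) \<le> 1"
        proof -
          have "(1 - t) ^ (p - 1) \<le> 1" using t by (intro power_le_one) auto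
          also have "1 \<le> (fact (p - 1) :: real)" by (rule fact_ge_1)
          finally show ?thesis by simp
        qed
        then have "cmod (((1 - t) ^ (p - 1) / fact (p - 1)) *\<^sub>R Td p h (y + t *\<^sub>R h)) \<le> 1 * cmod (Td p h (y + t *\<^sub>R h))"
          unfolding norm_scaleR using t by (intro mult_right_mono) auto
        also have "\<dots> \<le> ?K" using Td_bound[of t h y] t by simp
        finally show "cmod (((1 - t) ^ (p - 1) / fact (p - 1)) *\<^sub>R Td p h (y + t *\<^sub>R h)) \<le> ?K" .
      qed auto
      then show ?thesis by simp
    qed
  qed
qed

section \<open>Averages of translates\<close>

definition smear :: "(real^'n::finite \<Rightarrow> complex) \<Rightarrow> (real^'n \<Rightarrow> complex) \<Rightarrow> real \<Rightarrow> real^'n \<Rightarrow> complex" where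
  "smear u w s y = (\<integral>z. u z * w (y + s *\<^sub>R z) \<partial>lborel)"

definition moment :: "(real^'n::finite \<Rightarrow> complex) \<Rightarrow> nat \<Rightarrow> real" where
  "moment u m = (\<integral>z. cmod (u z) * (1 + norm z) ^ m \<partial>lborel)"

lemma moment_nonneg: "0 \<le> moment u m"
  unfolding moment_def by (intro Bochner_Integration.integral_nonneg) auto

text \<open>The weight at y is split by 1 + |y| <= (1 + |y + s z|) (1 + |s|) (1 + |z|): the first
  factor is absorbed by w, the last by a moment of u.\<close>

lemma smear_decay:
  assumes "rapid u" "\<And>x. (1 + norm x) ^ m * cmod (w x) \<le> B"
  shows "(1 + norm y) ^ m * cmod (smear u w s y) \<le> moment u m * (1 + \<bar>s\<bar>) ^ m * B"
proof -
  have "cmod (smear u w s y) \<le> (\<integral>z. cmod (u z) * (1 + norm z) ^ m * ((1 + \<bar>s\<bar>) ^ m * B / (1 + norm y) ^ m) \<partial>lborel)"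
    unfolding smear_def
  proof (rule cmod_integral_le)
    show "integrable lborel (\<lambda>z. cmod (u z) * (1 + norm z) ^ m * ((1 + \<bar>s\<bar>) ^ m * B / (1 + norm y) ^ m))"
      by (intro integrable_mult_left integrable_rapid_weight assms)
    fix z
    have "(1 + norm y) ^ m \<le> (1 + norm (y + s *\<^sub>R z)) ^ m * (1 + norm (- (s *\<^sub>R z))) ^ m"
      using one_add_norm_power_add_le[of "y + s *\<^sub>R z" "- (s *\<^sub>R z)" m] by simp
    also have "\<dots> \<le> (1 + norm (y + s *\<^sub>R z)) ^ m * ((1 + \<bar>s\<bar>) ^ m * (1 + norm z) ^ m)"
      unfolding power_mult_distrib[symmetric]
      by (intro mult_left_mono power_mono) (auto simp: algebra_simps)
    finally have "(1 + norm y) ^ m * cmod (w (y + s *\<^sub>R z))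
        \<le> ((1 + norm (y + s *\<^sub>R z)) ^ m * ((1 + \<bar>s\<bar>) ^ m * (1 + norm z) ^ m)) * cmod (w (y + s *\<^sub>R z))"
      by (intro mult_right_mono) auto
    also have "\<dots> = ((1 + \<bar>s\<bar>) ^ m * (1 + norm z) ^ m) * ((1 + norm (y + s *\<^sub>R z)) ^ m * cmod (w (y + s *\<^sub>R z)))"
      by (simp only: mult_ac)
    also have "\<dots> \<le> ((1 + \<bar>s\<bar>) ^ m * (1 + norm z) ^ m) * B"
      by (intro mult_left_mono assms) auto
    finally have "cmod (w (y + s *\<^sub>R z)) \<le> (1 + norm z) ^ m * ((1 + \<bar>s\<bar>) ^ m * B / (1 + norm y) ^ m)"
      by (simp add: pos_le_divide_eq mult_ac)
    then have "cmod (u z) * cmod (w (y + s *\<^sub>R z)) \<le> cmod (u z) * ((1 + norm z) ^ m * ((1 + \<bar>s\<bar>) ^ m * B / (1 + norm y) ^ m))"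
      by (intro mult_left_mono) auto
    then show "cmod (u z * w (y + s *\<^sub>R z)) \<le> cmod (u z) * (1 + norm z) ^ m * ((1 + \<bar>s\<bar>) ^ m * B / (1 + norm y) ^ m)"
      by (simp only: norm_mult mult.assoc)
  qed
  also have "\<dots> = moment u m * ((1 + \<bar>s\<bar>) ^ m * B / (1 + norm y) ^ m)"
    unfolding moment_def by (rule integral_mult_left_zero)
  finally show ?thesis
    by (simp add: pos_le_divide_eq mult_ac)
qed

lemma schwartz_bounded:
  assumes "w \<in> schwartz"
  obtains B where "B \<ge> 0" "\<And>x. cmod (w x) \<le> B"
  using schwartz_decay0[OF assms, of 0] by auto

lemma schwartz_affine_measurable:
  "w \<in> schwartz \<Longrightarrow> (\<lambda>z. w (y + s *\<^sub>R z)) \<in> borel_measurable borel"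
  by (intro borel_measurable_continuous_onI continuous_on_compose2[OF schwartz_continuous_on[of w UNIV]])
    (auto intro!: continuous_intros)

lemma integrable_smear:
  assumes "rapid u" "w \<in> schwartz"
  shows "integrable lborel (\<lambda>z. u z * w (y + s *\<^sub>R z))"
proof -
  obtain B where "\<And>x. cmod (w x) \<le> B" using schwartz_bounded[OF assms(2)] by metis
  then show ?thesis
    by (intro integrable_rapid_mult[where K = B and m = 0] assms schwartz_affine_measurable) auto
qed

lemma has_derivative_smear:
  assumes "rapid u" "w \<in> schwartz"
  shows "(smear u w s has_derivative (\<lambda>h. \<Sum>i\<in>UNIV. of_real (h $ i) * smear u (partial_deriv i w) s y)) (at y)"
proof -
  obtain B where B: "B \<ge> 0" "\<And>y h. cmod (w (y + h) - taylor_sum 2 w y h) \<le> B * (norm h)\<^sup>2"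
    using schwartz_taylor_remainder[OF assms(2), of 2 0] by auto
  show ?thesis
  proof (rule has_derivative_if_quadratic_error)
    fix h :: "real^'a"
    have I: "integrable lborel (\<lambda>z. u z * partial_deriv i w (y + s *\<^sub>R z))" for i
      by (intro integrable_smear assms schwartz_partial_deriv)
    have "smear u w s (y + h) - smear u w s y - (\<Sum>i\<in>UNIV. of_real (h $ i) * smear u (partial_deriv i w) s y)
       = (\<integral>z. u z * w (y + h + s *\<^sub>R z) - u z * w (y + s *\<^sub>R z)
            - (\<Sum>i\<in>UNIV. of_real (h $ i) * (u z * partial_deriv i w (y + s *\<^sub>R z))) \<partial>lborel)"
      unfolding smear_def using integrable_smear[OF assms] I by simp
    also have "\<dots> = (\<integral>z. u z * (w (y + s *\<^sub>R z + h) - taylor_sum 2 w (y + s *\<^sub>R z) h) \<partial>lborel)"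
      by (intro Bochner_Integration.integral_cong refl)
        (simp add: taylor_sum_2 algebra_simps sum_distrib_left)
    also have "cmod \<dots> \<le> (\<integral>z. cmod (u z) * (1 + norm z) ^ 0 * (B * (norm h)\<^sup>2) \<partial>lborel)"
    proof (rule cmod_integral_le)
      show "integrable lborel (\<lambda>z. cmod (u z) * (1 + norm z) ^ 0 * (B * (norm h)\<^sup>2))"
        by (intro integrable_mult_left integrable_rapid_weight assms)
      show "cmod (u z * (w (y + s *\<^sub>R z + h) - taylor_sum 2 w (y + s *\<^sub>R z) h)) \<le> cmod (u z) * (1 + norm z) ^ 0 * (B * (norm h)\<^sup>2)" for z
        unfolding norm_mult using B(2) by (auto intro!: mult_left_mono)
    qed
    also have "\<dots> = moment u 0 * B * (norm h)\<^sup>2"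
      unfolding moment_def integral_mult_left_zero by simp
    finally show "cmod (smear u w s (y + h) - smear u w s y - (\<Sum>i\<in>UNIV. of_real (h $ i) * smear u (partial_deriv i w) s y))
       \<le> moment u 0 * B * (norm h)\<^sup>2" .
  qed
qed

lemma
  assumes "rapid u" "w \<in> schwartz"
  shows D_smear: "D is (smear u w s) = smear u (D is w) s"
    and schwartz_smear: "smear u w s \<in> schwartz"
proof -
  have pd: "partial_deriv i (smear u w s) = smear u (partial_deriv i w) s" if "w \<in> schwartz" for i and w :: "real^'a \<Rightarrow> complex"
    using partial_deriv_eq_coeff[OF has_derivative_smear[OF assms(1) that]] by blast
  show "D is (smear u w s) = smear u (D is w) s"
    by (induction "is") (auto simp: pd schwartz_D assms(2))
  have "smear u w s \<in> {smear u w s | w. w \<in> schwartz}" using assms(2) by blast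
  then show "smear u w s \<in> schwartz"
  proof (induct rule: schwartz_coinduct)
    case (differentiable g x)
    then show ?case
      using has_derivative_smear[OF assms(1)] unfolding differentiable_def by blast
  next
    case (decay g m)
    then obtain w where w: "g = smear u w s" "w \<in> schwartz" by blast
    obtain B where "\<And>x. cmod (w x) \<le> B / (1 + norm x) ^ m"
      using schwartz_decay0[OF w(2)] by metis
    then have "(1 + norm x) ^ m * cmod (w x) \<le> B" for x
      by (simp add: pos_le_divide_eq mult.commute)
    from smear_decay[OF assms(1) this] show ?case unfolding w(1) by blast
  next
    case (partial_deriv g i)
    then show ?case using pd schwartz_partial_deriv by blast
  qed
qed

lemma schwartz_norm_smear_le:
  assumes "rapid u" "w \<in> schwartz"
  shows "schwartz_norm d (smear u w s) \<le> moment u d * (1 + \<bar>s\<bar>) ^ d * schwartz_norm d w"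
proof (rule schwartz_norm_le)
  show "smear u w s \<in> schwartz" by (rule schwartz_smear[OF assms])
  show "(1 + norm x) ^ d * cmod (D is (smear u w s) x) \<le> moment u d * (1 + \<bar>s\<bar>) ^ d * schwartz_norm d w"
    if "length is \<le> d" for "is" x
    unfolding D_smear[OF assms]
    by (intro smear_decay assms schwartz_norm_bound that)
qed

section \<open>The Fourier transform on Schwartz functions\<close>

lemma cmod_exp_minus_i_of_real [simp]: "cmod (exp (- (\<i> * of_real t))) = 1"
  "cmod (exp (\<i> * of_real t)) = 1"
  by (auto simp: norm_exp_eq_Re)

lemma integrable_fourier:
  fixes f :: "real^'n::finite \<Rightarrow> complex"
  assumes "integrable lborel f"
  shows "integrable lborel (\<lambda>x. exp (- \<i> * of_real (x \<bullet> \<xi>)) * f x)"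
proof (rule Bochner_Integration.integrable_bound[OF assms])
  have [measurable]: "f \<in> borel_measurable borel" using assms by auto
  show "(\<lambda>x. exp (- \<i> * of_real (x \<bullet> \<xi>)) * f x) \<in> borel_measurable lborel" by measurable
qed (simp add: norm_mult)

lemma fourier_cmult: "fourier (\<lambda>x. c * f x) \<xi> = c * fourier f \<xi>"
  unfolding fourier_def mult.left_commute[of _ c] by simp

lemma fourier_diff:
  assumes "integrable lborel f" "integrable lborel g"
  shows "fourier (\<lambda>x. f x - g x) \<xi> = fourier f \<xi> - fourier g \<xi>"
  unfolding fourier_def right_diff_distrib
  by (intro Bochner_Integration.integral_diff integrable_fourier assms)

lemma fourier_cnj: "fourier (\<lambda>x. cnj (f x)) \<xi> = cnj (fourier f (- \<xi>))"
  unfolding fourier_def by (subst Bochner_Integration.integral_cnj[symmetric]) (simp add: exp_cnj)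

lemma cmod_fourier_le: "cmod (fourier f \<xi>) \<le> (\<integral>x. cmod (f x) \<partial>lborel)"
  unfolding fourier_def by (rule order_trans[OF integral_norm_bound]) (simp add: norm_mult)

lemma fourier_affine:
  fixes f :: "real^'n::finite \<Rightarrow> complex"
  assumes "f \<in> borel_measurable borel" "c \<noteq> 0"
  shows "fourier (\<lambda>x. f (c *\<^sub>R x + a)) \<xi> =
    of_real (1 / \<bar>c\<bar> ^ CARD('n)) * exp (\<i> * of_real ((a \<bullet> \<xi>) / c)) * fourier f ((1 / c) *\<^sub>R \<xi>)"
proof -
  have [measurable]: "f \<in> borel_measurable borel" by fact
  have "fourier (\<lambda>x. f (c *\<^sub>R x + a)) \<xi> = (\<integral>x. exp (\<i> * of_real ((a \<bullet> \<xi>) / c)) *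
      (exp (- \<i> * of_real ((c *\<^sub>R x + a) \<bullet> ((1 / c) *\<^sub>R \<xi>))) * f (c *\<^sub>R x + a)) \<partial>lborel)"
    unfolding fourier_def
  proof (intro Bochner_Integration.integral_cong refl)
    fix x
    have "exp (- \<i> * of_real (x \<bullet> \<xi>)) = exp (\<i> * of_real ((a \<bullet> \<xi>) / c)) * exp (- \<i> * of_real ((c *\<^sub>R x + a) \<bullet> ((1 / c) *\<^sub>R \<xi>)))"
      using assms(2) by (simp add: exp_add[symmetric] inner_add_left algebra_simps add_divide_distrib)
    then show "exp (- \<i> * of_real (x \<bullet> \<xi>)) * f (c *\<^sub>R x + a) = exp (\<i> * of_real ((a \<bullet> \<xi>) / c)) *
      (exp (- \<i> * of_real ((c *\<^sub>R x + a) \<bullet> ((1 / c) *\<^sub>R \<xi>))) * f (c *\<^sub>R x + a))" by simp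
  qed
  also have "\<dots> = exp (\<i> * of_real ((a \<bullet> \<xi>) / c)) * (\<integral>x.
      exp (- \<i> * of_real ((c *\<^sub>R x + a) \<bullet> ((1 / c) *\<^sub>R \<xi>))) * f (c *\<^sub>R x + a) \<partial>lborel)" by simp
  also have "(\<integral>x. exp (- \<i> * of_real ((c *\<^sub>R x + a) \<bullet> ((1 / c) *\<^sub>R \<xi>))) * f (c *\<^sub>R x + a) \<partial>lborel)
      = (1 / \<bar>c\<bar> ^ CARD('n)) *\<^sub>R fourier f ((1 / c) *\<^sub>R \<xi>)"
    unfolding fourier_def
    by (rule integral_affine[where f = "\<lambda>x. exp (- \<i> * of_real (x \<bullet> ((1 / c) *\<^sub>R \<xi>))) * f x", OF assms(2)]) measurable
  finally show ?thesis by (simp add: scaleR_conv_of_real[where 'a = complex] mult_ac)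
qed

lemma fourier_translation:
  fixes f :: "real^'n::finite \<Rightarrow> complex"
  assumes "f \<in> borel_measurable borel"
  shows "fourier (\<lambda>x. f (x + a)) \<xi> = exp (\<i> * of_real (a \<bullet> \<xi>)) * fourier f \<xi>"
  using fourier_affine[OF assms, of 1 a \<xi>] by simp

text \<open>One Fubini majorant for two uses: s is the scale of an average in
  \<open>fourier_smear\<close>, and s = 0 gives the plain product in
  \<open>fourier_multiplication_formula\<close>.\<close>

lemma integrable_pair_product:
  fixes F :: "(real^'n::finite) \<times> (real^'n) \<Rightarrow> complex" and u v :: "real^'n \<Rightarrow> complex"
  assumes "F \<in> borel_measurable borel" "integrable lborel u" "integrable lborel v"
    "\<And>x y. cmod (F (x, y)) \<le> cmod (u x) * cmod (v (y + s *\<^sub>R x))"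
  shows "integrable (lborel \<Otimes>\<^sub>M lborel) F"
proof -
  have [measurable]: "u \<in> borel_measurable borel" "v \<in> borel_measurable borel" using assms by auto
  have v: "integrable lborel (\<lambda>y. v (y + a))" for a
    using integrable_affine_iff[of 1 v a] assms(3) by simp
  show ?thesis
  proof (rule Bochner_Integration.integrable_bound)
    show "integrable (lborel \<Otimes>\<^sub>M lborel) (\<lambda>(x, y). u x * v (y + s *\<^sub>R x))"
    proof (rule lborel_pair.Fubini_integrable)
      show "(\<lambda>(x, y). u x * v (y + s *\<^sub>R x)) \<in> borel_measurable (lborel \<Otimes>\<^sub>M lborel)"
        unfolding split_def by measurable
      have "(\<integral>y. norm (case (x, y) of (x, y) \<Rightarrow> u x * v (y + s *\<^sub>R x)) \<partial>lborel) = cmod (u x) * (\<integral>y. cmod (v y) \<partial>lborel)" for x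
        using integral_translation[of "\<lambda>y. cmod (v y)" "s *\<^sub>R x"] by (simp add: norm_mult)
      then show "integrable lborel (\<lambda>x. \<integral>y. norm (case (x, y) of (x, y) \<Rightarrow> u x * v (y + s *\<^sub>R x)) \<partial>lborel)"
        using assms(2) by simp
      show "AE x in lborel. integrable lborel (\<lambda>y. case (x, y) of (x, y) \<Rightarrow> u x * v (y + s *\<^sub>R x))"
        using v by simp
    qed
    show "F \<in> borel_measurable (lborel \<Otimes>\<^sub>M lborel)"
      using assms(1) by (simp add: lborel_prod)
  qed (use assms(4) in \<open>auto simp: norm_mult\<close>)
qed

text \<open>When the integration in y is done first, the translation of w by s z leaves a phase
  exp(i s z \<xi>), and the remaining integral in z is the transform of u at - s \<xi>.\<close>

lemma fourier_smear:
  assumes "rapid u" "w \<in> schwartz"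
  shows "fourier (smear u w s) \<xi> = fourier w \<xi> * fourier u (- s *\<^sub>R \<xi>)"
proof -
  have [measurable]: "u \<in> borel_measurable borel" "w \<in> borel_measurable borel"
    using assms by (auto simp: rapid_def schwartz_measurable)
  have w: "integrable lborel w" by (intro integrable_rapid schwartz_rapid assms)
  have E [measurable]: "(\<lambda>p. exp (- \<i> * of_real (snd p \<bullet> \<xi>))) \<in> borel_measurable (borel :: ((real^'a) \<times> (real^'a)) measure)"
    by (intro borel_measurable_continuous_onI continuous_intros)
  have "(\<lambda>(z, y). exp (- \<i> * of_real (y \<bullet> \<xi>)) * (u z * w (y + s *\<^sub>R z))) \<in> borel_measurable (borel \<Otimes>\<^sub>M borel)"
    using E unfolding split_def borel_prod[symmetric] by measurable
  then have I: "integrable (lborel \<Otimes>\<^sub>M lborel) (\<lambda>(z, y). exp (- \<i> * of_real (y \<bullet> \<xi>)) * (u z * w (y + s *\<^sub>R z)))"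
    by (intro integrable_pair_product[where u = u and v = w and s = s] integrable_rapid assms w)
      (auto simp: norm_mult borel_prod)
  have "fourier (smear u w s) \<xi> = (\<integral>y. (\<integral>z. exp (- \<i> * of_real (y \<bullet> \<xi>)) * (u z * w (y + s *\<^sub>R z)) \<partial>lborel) \<partial>lborel)"
    unfolding fourier_def smear_def by simp
  also have "\<dots> = (\<integral>z. (\<integral>y. exp (- \<i> * of_real (y \<bullet> \<xi>)) * (u z * w (y + s *\<^sub>R z)) \<partial>lborel) \<partial>lborel)"
    using lborel_pair.Fubini_integral[OF I] .
  also have "\<dots> = (\<integral>z. u z * fourier (\<lambda>y. w (y + s *\<^sub>R z)) \<xi> \<partial>lborel)"
    unfolding fourier_def by (simp add: mult.left_commute)
  also have "\<dots> = (\<integral>z. fourier w \<xi> * (exp (- \<i> * of_real (z \<bullet> (- s *\<^sub>R \<xi>))) * u z) \<partial>lborel)"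
    by (intro Bochner_Integration.integral_cong refl) (simp add: fourier_translation mult_ac)
  finally show ?thesis unfolding fourier_def by simp
qed

lemma fourier_multiplication_formula:
  fixes f g :: "real^'n::finite \<Rightarrow> complex"
  assumes "integrable lborel f" "integrable lborel g"
  shows "(\<integral>\<xi>. fourier f \<xi> * g \<xi> \<partial>lborel) = (\<integral>x. f x * fourier g x \<partial>lborel)"
proof -
  have [measurable]: "f \<in> borel_measurable borel" "g \<in> borel_measurable borel" using assms by auto
  have E [measurable]: "(\<lambda>p. exp (- \<i> * of_real (fst p \<bullet> snd p))) \<in> borel_measurable (borel :: ((real^'n) \<times> (real^'n)) measure)"
    by (intro borel_measurable_continuous_onI continuous_intros)
  have "(\<lambda>(x, \<xi>). exp (- \<i> * of_real (x \<bullet> \<xi>)) * (f x * g \<xi>)) \<in> borel_measurable (borel \<Otimes>\<^sub>M borel)"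
    using E unfolding split_def borel_prod[symmetric] by measurable
  then have I: "integrable (lborel \<Otimes>\<^sub>M lborel) (\<lambda>(x, \<xi>). exp (- \<i> * of_real (x \<bullet> \<xi>)) * (f x * g \<xi>))"
    by (intro integrable_pair_product[where u = f and v = g and s = 0] assms) (auto simp: norm_mult borel_prod)
  have "(\<integral>\<xi>. fourier f \<xi> * g \<xi> \<partial>lborel) = (\<integral>\<xi>. (\<integral>x. exp (- \<i> * of_real (x \<bullet> \<xi>)) * (f x * g \<xi>) \<partial>lborel) \<partial>lborel)"
    unfolding fourier_def by (simp add: mult.assoc[symmetric])
  also have "\<dots> = (\<integral>x. (\<integral>\<xi>. exp (- \<i> * of_real (x \<bullet> \<xi>)) * (f x * g \<xi>) \<partial>lborel) \<partial>lborel)"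
    using lborel_pair.Fubini_integral[OF I] .
  also have "\<dots> = (\<integral>x. f x * fourier g x \<partial>lborel)"
    unfolding fourier_def by (simp add: mult.left_commute inner_commute)
  finally show ?thesis .
qed

text \<open>The quadratic error comes from |exp(i t) - 1 - i t| <= t^2 / 2 with t = - x \<bullet> h;
  the second moment of f absorbs |x|^2.\<close>

lemma has_derivative_fourier:
  fixes f :: "real^'n::finite \<Rightarrow> complex"
  assumes "f \<in> schwartz"
  shows "(fourier f has_derivative (\<lambda>h. \<Sum>i\<in>UNIV. of_real (h $ i) * fourier (\<lambda>x. - \<i> * (of_real (x $ i) * f x)) \<xi>)) (at \<xi>)"
proof (rule has_derivative_if_quadratic_error)
  fix h :: "real^'n"
  let ?e = "\<lambda>x. exp (- \<i> * of_real (x \<bullet> \<xi>)) :: complex"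
  have I: "integrable lborel (\<lambda>x. exp (- \<i> * of_real (x \<bullet> \<xi>)) * f x)" for \<xi>
    by (intro integrable_fourier integrable_rapid schwartz_rapid assms)
  have J: "integrable lborel (\<lambda>x. ?e x * (- \<i> * (of_real (x $ i) * f x)))" for i
    by (intro integrable_fourier integrable_rapid schwartz_rapid schwartz_cmult' schwartz_times_component assms)
  have "fourier f (\<xi> + h) - fourier f \<xi> - (\<Sum>i\<in>UNIV. of_real (h $ i) * fourier (\<lambda>x. - \<i> * (of_real (x $ i) * f x)) \<xi>)
     = (\<integral>x. exp (- \<i> * of_real (x \<bullet> (\<xi> + h))) * f x - ?e x * f x - (\<Sum>i\<in>UNIV. of_real (h $ i) * (?e x * (- \<i> * (of_real (x $ i) * f x)))) \<partial>lborel)"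
    unfolding fourier_def using I[of "\<xi> + h"] I[of \<xi>] J by (simp del: mult_minus_left mult_minus_right)
  also have "cmod \<dots> \<le> (\<integral>x. cmod (f x) * (1 + norm x) ^ 2 * (norm h)\<^sup>2 \<partial>lborel)"
  proof (rule cmod_integral_le)
    show "integrable lborel (\<lambda>x. cmod (f x) * (1 + norm x) ^ 2 * (norm h)\<^sup>2)"
      by (intro integrable_mult_left integrable_rapid_weight schwartz_rapid assms)
    fix x
    have "exp (- \<i> * of_real (x \<bullet> (\<xi> + h))) * f x - ?e x * f x - (\<Sum>i\<in>UNIV. of_real (h $ i) * (?e x * (- \<i> * (of_real (x $ i) * f x))))
        = ?e x * f x * (exp (\<i> * of_real (- (x \<bullet> h))) - (1 + \<i> * of_real (- (x \<bullet> h))))"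
    proof -
      have 1: "exp (- \<i> * of_real (x \<bullet> (\<xi> + h))) = ?e x * exp (\<i> * of_real (- (x \<bullet> h)))"
        by (simp add: exp_add[symmetric] inner_add_right algebra_simps)
      have 2: "(\<Sum>i\<in>UNIV. of_real (h $ i) * (e * (- \<i> * (of_real (x $ i) * F)))) = e * F * (\<i> * of_real (- (x \<bullet> h)))" for e F
        by (simp add: inner_vec_def sum_distrib_left mult_ac sum_negf)
      show ?thesis unfolding 1 2 by (simp add: algebra_simps)
    qed
    also have "cmod \<dots> = cmod (f x) * cmod (exp (\<i> * of_real (- (x \<bullet> h))) - (1 + \<i> * of_real (- (x \<bullet> h))))"
      by (simp add: norm_mult)
    also have "\<dots> \<le> cmod (f x) * ((1 + norm x) ^ 2 * (norm h)\<^sup>2)"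
    proof (intro mult_left_mono)
      have "cmod (exp (\<i> * of_real (- (x \<bullet> h))) - (1 + \<i> * of_real (- (x \<bullet> h)))) \<le> \<bar>- (x \<bullet> h)\<bar>\<^sup>2 / 2"
        using iexp_approx1[of "- (x \<bullet> h)" 1] by (simp add: numeral_2_eq_2)
      also have "\<dots> \<le> \<bar>x \<bullet> h\<bar>\<^sup>2" by simp
      also have "\<dots> \<le> (norm x * norm h)\<^sup>2" by (intro power_mono Cauchy_Schwarz_ineq2) auto
      also have "\<dots> \<le> ((1 + norm x) * norm h)\<^sup>2" by (intro power_mono mult_right_mono) auto
      finally show "cmod (exp (\<i> * of_real (- (x \<bullet> h))) - (1 + \<i> * of_real (- (x \<bullet> h)))) \<le> (1 + norm x) ^ 2 * (norm h)\<^sup>2"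
        by (simp add: power_mult_distrib)
    qed auto
    finally show "cmod (exp (- \<i> * of_real (x \<bullet> (\<xi> + h))) * f x - ?e x * f x - (\<Sum>i\<in>UNIV. of_real (h $ i) * (?e x * (- \<i> * (of_real (x $ i) * f x)))))
        \<le> cmod (f x) * (1 + norm x) ^ 2 * (norm h)\<^sup>2" by (simp only: mult.assoc)
  qed
  also have "\<dots> = moment f 2 * (norm h)\<^sup>2"
    unfolding moment_def by (rule integral_mult_left_zero)
  finally show "cmod (fourier f (\<xi> + h) - fourier f \<xi> - (\<Sum>i\<in>UNIV. of_real (h $ i) * fourier (\<lambda>x. - \<i> * (of_real (x $ i) * f x)) \<xi>))
    \<le> moment f 2 * (norm h)\<^sup>2" .
qed

lemma partial_deriv_fourier:
  assumes "f \<in> schwartz"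
  shows "partial_deriv i (fourier f) = fourier (\<lambda>x. - \<i> * (of_real (x $ i) * f x))"
  by (rule ext) (rule partial_deriv_eq_coeff[OF has_derivative_fourier[OF assms]])

text \<open>Both sides of the differentiated identity \<open>\<integral> e\<^bsup>-ix\<xi>\<^esup> f(x + h) dx = e\<^bsup>ih\<xi>\<^esup> \<integral> e\<^bsup>-ix\<xi>\<^esup> f(x) dx\<close>
  at \<open>h = 0\<close>; this replaces integration by parts.\<close>

lemma fourier_partial_deriv:
  fixes f :: "real^'n::finite \<Rightarrow> complex"
  assumes "f \<in> schwartz"
  shows "fourier (partial_deriv i f) \<xi> = \<i> * of_real (\<xi> $ i) * fourier f \<xi>"
proof -
  let ?M = "2 * CARD('n)"
  let ?e = "\<lambda>x. exp (- \<i> * of_real (x \<bullet> \<xi>)) :: complex"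
  let ?F = "\<lambda>h. exp (\<i> * of_real (h \<bullet> \<xi>)) * fourier f \<xi>"
  obtain B where B: "B \<ge> 0" "\<And>y h. cmod (f (y + h) - taylor_sum 2 f y h) \<le> B * (norm h)\<^sup>2 * (1 + norm h) ^ ?M / (1 + norm y) ^ ?M"
    using schwartz_taylor_remainder[OF assms, of 2 ?M] by auto
  define C where "C = (\<integral>x. 1 / (1 + norm x) ^ ?M \<partial>(lborel :: (real^'n) measure))"
  have "(?F has_derivative (\<lambda>h. \<Sum>i\<in>UNIV. of_real (h $ i) * fourier (partial_deriv i f) \<xi>)) (at 0)"
  proof (rule has_derivative_if_quadratic_error)
    fix h :: "real^'n" assume h: "norm h \<le> 1"
    have I: "integrable lborel (\<lambda>x. ?e x * f (x + h))" for h
      using schwartz_affine[OF assms, of 1 h] by (intro integrable_fourier integrable_rapid schwartz_rapid) simp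
    have J: "integrable lborel (\<lambda>x. ?e x * partial_deriv i f x)" for i
      by (intro integrable_fourier integrable_rapid schwartz_rapid schwartz_partial_deriv assms)
    have "?F (0 + h) - ?F 0 - (\<Sum>i\<in>UNIV. of_real (h $ i) * fourier (partial_deriv i f) \<xi>)
       = (\<integral>x. ?e x * f (x + h) - ?e x * f x - (\<Sum>i\<in>UNIV. of_real (h $ i) * (?e x * partial_deriv i f x)) \<partial>lborel)"
      using fourier_translation[OF schwartz_measurable[OF assms], of h \<xi>] I[of h] I[of 0] J
      by (simp add: fourier_def)
    also have "\<dots> = (\<integral>x. ?e x * (f (x + h) - taylor_sum 2 f x h) \<partial>lborel)"
      by (intro Bochner_Integration.integral_cong refl)
        (simp add: taylor_sum_2 algebra_simps sum_distrib_left)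
    also have "cmod \<dots> \<le> (\<integral>x. B * (norm h)\<^sup>2 * 2 ^ ?M * (1 / (1 + norm x) ^ ?M) \<partial>(lborel :: (real^'n) measure))"
    proof (rule cmod_integral_le)
      show "integrable lborel (\<lambda>x::real^'n. B * (norm h)\<^sup>2 * 2 ^ ?M * (1 / (1 + norm x) ^ ?M))"
        by (intro integrable_mult_right integrable_inverse_power_norm)
      fix x
      have "cmod (?e x * (f (x + h) - taylor_sum 2 f x h)) \<le> B * (norm h)\<^sup>2 * (1 + norm h) ^ ?M / (1 + norm x) ^ ?M"
        using B(2)[of x h] by (simp add: norm_mult)
      also have "\<dots> \<le> B * (norm h)\<^sup>2 * 2 ^ ?M / (1 + norm x) ^ ?M"
        using h B(1) by (intro divide_right_mono mult_left_mono power_mono) auto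
      finally show "cmod (?e x * (f (x + h) - taylor_sum 2 f x h)) \<le> B * (norm h)\<^sup>2 * 2 ^ ?M * (1 / (1 + norm x) ^ ?M)" by simp
    qed
    also have "\<dots> = (B * 2 ^ ?M * C) * (norm h)\<^sup>2"
      unfolding C_def integral_mult_right_zero by simp
    finally show "cmod (?F (0 + h) - ?F 0 - (\<Sum>i\<in>UNIV. of_real (h $ i) * fourier (partial_deriv i f) \<xi>)) \<le> (B * 2 ^ ?M * C) * (norm h)\<^sup>2" .
  qed
  then have "partial_deriv i ?F 0 = fourier (partial_deriv i f) \<xi>" by (rule partial_deriv_eq_coeff)
  moreover have "(?F has_derivative (\<lambda>h. \<i> * of_real (h \<bullet> \<xi>) * fourier f \<xi>)) (at 0)"
  proof -
    have "((\<lambda>h. \<i> * complex_of_real (h \<bullet> \<xi>)) has_derivative (\<lambda>h. \<i> * of_real (h \<bullet> \<xi>))) (at (0::real^'n))"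
      by (intro bounded_linear_imp_has_derivative bounded_linear_compose[OF bounded_linear_mult_right]
          bounded_linear_compose[OF bounded_linear_of_real] bounded_linear_inner_left)
    from has_derivative_mult_left[OF has_derivative_compose[OF this DERIV_exp[unfolded has_field_derivative_def]], of "fourier f \<xi>"]
    show ?thesis by simp
  qed
  from partial_deriv_eq_apply[OF this, of i] have "partial_deriv i ?F 0 = \<i> * of_real (\<xi> $ i) * fourier f \<xi>"
    by (simp add: inner_axis' )
  ultimately show ?thesis by simp
qed

text \<open>Each power of the weight is traded for one derivative: |\<xi>| times the transform of f
  is at most the sum of the transforms of the d_i f in absolute value. Hence the induction with f
  arbitrary.\<close>

lemma fourier_decay:
  fixes f :: "real^'n::finite \<Rightarrow> complex"
  assumes "f \<in> schwartz"
  shows "\<exists>B. \<forall>\<xi>. (1 + norm \<xi>) ^ m * cmod (fourier f \<xi>) \<le> B"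
  using assms
proof (induction m arbitrary: f)
  case 0
  then show ?case using cmod_fourier_le by auto
next
  case (Suc m)
  obtain B where B: "\<And>\<xi>. (1 + norm \<xi>) ^ m * cmod (fourier f \<xi>) \<le> B" using Suc by blast
  have "\<exists>C. \<forall>i \<xi>. (1 + norm \<xi>) ^ m * cmod (fourier (partial_deriv i f) \<xi>) \<le> C i"
    using Suc.IH[OF schwartz_partial_deriv[OF Suc.prems]] by (intro choice allI) auto
  then obtain C where C: "\<And>i \<xi>. (1 + norm \<xi>) ^ m * cmod (fourier (partial_deriv i f) \<xi>) \<le> C i" by blast
  have "(1 + norm \<xi>) ^ Suc m * cmod (fourier f \<xi>) \<le> B + (\<Sum>i\<in>UNIV. C i)" for \<xi>
  proof -
    have "norm \<xi> * cmod (fourier f \<xi>) \<le> (\<Sum>i\<in>UNIV. \<bar>\<xi> $ i\<bar>) * cmod (fourier f \<xi>)"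
      by (intro mult_right_mono norm_le_l1_cart) auto
    also have "\<dots> = (\<Sum>i\<in>UNIV. cmod (fourier (partial_deriv i f) \<xi>))"
      by (simp add: fourier_partial_deriv[OF Suc.prems] norm_mult sum_distrib_right)
    finally have "(1 + norm \<xi>) ^ m * (norm \<xi> * cmod (fourier f \<xi>)) \<le> (1 + norm \<xi>) ^ m * (\<Sum>i\<in>UNIV. cmod (fourier (partial_deriv i f) \<xi>))"
      by (intro mult_left_mono) auto
    also have "\<dots> \<le> (\<Sum>i\<in>UNIV. C i)" unfolding sum_distrib_left by (intro sum_mono C)
    finally show ?thesis using B[of \<xi>] by (simp add: algebra_simps)
  qed
  then show ?case by blast
qed

lemma schwartz_fourier:
  assumes "f \<in> schwartz"
  shows "fourier f \<in> schwartz"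
proof -
  have "fourier f \<in> fourier ` schwartz" using assms by blast
  then show ?thesis
  proof (induct rule: schwartz_coinduct)
    case (differentiable g x)
    then show ?case using has_derivative_fourier unfolding differentiable_def by blast
  next
    case (decay g m)
    then show ?case using fourier_decay by blast
  next
    case (partial_deriv g i)
    then obtain f where f: "g = fourier f" "f \<in> schwartz" by blast
    show ?case
      unfolding f(1) partial_deriv_fourier[OF f(2)]
      by (intro imageI schwartz_cmult' schwartz_times_component f(2))
  qed
qed

subsection \<open>Fourier inversion\<close>

text \<open>The function exp(-|x|^2 / 2), as a product over coordinates so that its integrals reduce
  to one dimension.\<close>

definition gaussian :: "real^'n::finite \<Rightarrow> complex" where
  "gaussian x = (\<Prod>i\<in>UNIV. of_real (exp (- (x $ i)\<^sup>2 / 2)))"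

text \<open>Read off from the characteristic function of the standard normal distribution, evaluated
  at -r to match the sign in \<open>fourier\<close>.\<close>

lemma gaussian_1dim:
  shows gaussian_1dim_integrable: "integrable lborel (\<lambda>t. complex_of_real (exp (- t\<^sup>2 / 2)))"
    and gaussian_1dim_fourier: "(\<integral>t. exp (- \<i> * of_real (t * r)) * of_real (exp (- t\<^sup>2 / 2)) \<partial>lborel)
      = of_real (sqrt (2 * pi) * exp (- r\<^sup>2 / 2))"
    and gaussian_1dim_integral: "(\<integral>t. complex_of_real (exp (- t\<^sup>2 / 2)) \<partial>lborel) = of_real (sqrt (2 * pi))"
proof -
  have "integrable lborel std_normal_density"
    using integrable_normal_moment[of 1 0 0] by simp
  then have "integrable lborel (\<lambda>t. sqrt (2 * pi) * std_normal_density t)" by (rule integrable_mult_right)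
  then show 1: "integrable lborel (\<lambda>t. complex_of_real (exp (- t\<^sup>2 / 2)))"
    by (simp add: std_normal_density_def)
  have F: "(\<integral>t. exp (- \<i> * of_real (t * r)) * of_real (exp (- t\<^sup>2 / 2)) \<partial>lborel)
      = of_real (sqrt (2 * pi) * exp (- r\<^sup>2 / 2))" for r
  proof -
    have "char std_normal_distribution (- r) = complex_of_real (exp (- r\<^sup>2 / 2))"
      by (simp add: char_std_normal_distribution)
    then have "complex_of_real (exp (- r\<^sup>2 / 2)) = (\<integral>t. std_normal_density t *\<^sub>R exp (\<i> * of_real (- r * t)) \<partial>lborel)"
      unfolding char_def by (subst (asm) integral_density) auto
    also have "\<dots> = (\<integral>t. of_real (1 / sqrt (2 * pi)) * (exp (- \<i> * of_real (t * r)) * of_real (exp (- t\<^sup>2 / 2))) \<partial>lborel)"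
      by (intro Bochner_Integration.integral_cong refl) (simp add: std_normal_density_def scaleR_conv_of_real mult_ac)
    also have "\<dots> = of_real (1 / sqrt (2 * pi)) * (\<integral>t. exp (- \<i> * of_real (t * r)) * of_real (exp (- t\<^sup>2 / 2)) \<partial>lborel)"
      by (rule integral_mult_right_zero)
    finally show ?thesis by (simp add: field_simps)
  qed
  show "(\<integral>t. exp (- \<i> * of_real (t * r)) * of_real (exp (- t\<^sup>2 / 2)) \<partial>lborel)
      = of_real (sqrt (2 * pi) * exp (- r\<^sup>2 / 2))" by (rule F)
  show "(\<integral>t. complex_of_real (exp (- t\<^sup>2 / 2)) \<partial>lborel) = of_real (sqrt (2 * pi))"
    using F[of 0] by simp
qed

lemma gaussian_continuous_on: "continuous_on S gaussian"
  unfolding gaussian_def by (intro continuous_intros) auto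

lemma gaussian_measurable [measurable]: "gaussian \<in> borel_measurable borel"
  by (intro borel_measurable_continuous_onI gaussian_continuous_on)

lemma gaussian_0 [simp]: "gaussian 0 = 1"
  by (simp add: gaussian_def)

lemma cmod_gaussian_le: "cmod (gaussian x) \<le> 1"
  unfolding gaussian_def prod_norm[symmetric] by (intro prod_le_1) auto

lemma gaussian_integrable: "integrable lborel gaussian"
  unfolding gaussian_def
  using integrable_prod_components[of "\<lambda>_ t. complex_of_real (exp (- t\<^sup>2 / 2))", OF gaussian_1dim_integrable] by simp

lemma fourier_gaussian:
  "fourier gaussian (\<xi> :: real^'n::finite) = of_real (sqrt (2 * pi) ^ CARD('n)) * gaussian \<xi>"
proof -
  have int: "integrable lborel (\<lambda>t. exp (- \<i> * of_real (t * r)) * complex_of_real (exp (- t\<^sup>2 / 2)))" for r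
  proof (rule Bochner_Integration.integrable_bound[OF gaussian_1dim_integrable])
    have "continuous_on UNIV (\<lambda>t. exp (- \<i> * of_real (t * r)) * complex_of_real (exp (- t\<^sup>2 / 2)))"
      by (intro continuous_intros) auto
    then show "(\<lambda>t. exp (- \<i> * of_real (t * r)) * complex_of_real (exp (- t\<^sup>2 / 2))) \<in> borel_measurable lborel"
      by (simp add: borel_measurable_continuous_onI)
  qed (auto simp: norm_mult simp del: of_real_mult)
  have "fourier gaussian \<xi> = (\<integral>x. (\<Prod>i\<in>UNIV. exp (- \<i> * of_real (x $ i * \<xi> $ i)) * complex_of_real (exp (- (x $ i)\<^sup>2 / 2))) \<partial>lborel)"
    unfolding fourier_def gaussian_def
    by (intro Bochner_Integration.integral_cong refl)
      (simp add: prod.distrib exp_sum[symmetric] inner_vec_def sum_distrib_left sum_negf)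
  also have "\<dots> = (\<Prod>i\<in>UNIV. of_real (sqrt (2 * pi) * exp (- (\<xi> $ i)\<^sup>2 / 2)))"
    using integral_prod_components[of "\<lambda>i t. exp (- \<i> * of_real (t * \<xi> $ i)) * complex_of_real (exp (- t\<^sup>2 / 2))", OF int]
    by (simp only: gaussian_1dim_fourier)
  finally show ?thesis by (simp add: gaussian_def prod.distrib)
qed

lemma integral_fourier_gaussian: "(\<integral>x. fourier gaussian x \<partial>(lborel :: (real^'n::finite) measure)) = of_real ((2 * pi) ^ CARD('n))"
proof -
  have "(\<integral>x. gaussian x \<partial>(lborel :: (real^'n) measure)) = of_real (sqrt (2 * pi) ^ CARD('n))"
    unfolding gaussian_def
    using integral_prod_components[of "\<lambda>(_::'n) t. complex_of_real (exp (- t\<^sup>2 / 2))", OF gaussian_1dim_integrable]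
    by (simp only: gaussian_1dim_integral) simp
  moreover have "sqrt (2 * pi) ^ CARD('n) * sqrt (2 * pi) ^ CARD('n) = (2 * pi) ^ CARD('n)"
    unfolding power_mult_distrib[symmetric] by simp
  ultimately show ?thesis
    unfolding fourier_gaussian by (simp only: integral_mult_right_zero of_real_mult[symmetric])
qed

text \<open>Inversion at the origin. The multiplication formula and a rescaling turn the integral of
  the transform of g times gaussian(\<epsilon> \<xi>) into the integral of g(\<epsilon> x) against
  the transform of the Gaussian. As \<epsilon> tends to 0, dominated convergence on both sides
  leaves g(0) times the integral of that transform.\<close>

lemma integral_fourier:
  fixes g :: "real^'n::finite \<Rightarrow> complex"
  assumes "g \<in> schwartz"
  shows "(\<integral>\<xi>. fourier g \<xi> \<partial>lborel) = of_real ((2 * pi) ^ CARD('n)) * g 0"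
proof -
  define \<epsilon> where "\<epsilon> k = 1 / real (Suc k)" for k
  have \<epsilon>: "\<epsilon> \<longlonglongrightarrow> 0" "\<epsilon> k > 0" for k
    using LIMSEQ_Suc[OF lim_1_over_n[where 'a = real]] by (simp_all only: \<epsilon>_def[abs_def]) simp
  have eq: "(\<integral>\<xi>. fourier g \<xi> * gaussian (\<epsilon> k *\<^sub>R \<xi>) \<partial>lborel) = (\<integral>x. g (\<epsilon> k *\<^sub>R x) * fourier gaussian x \<partial>lborel)" for k
  proof -
    have \<epsilon>k: "\<epsilon> k \<noteq> 0" using \<epsilon>(2)[of k] by simp
    have "integrable lborel (\<lambda>\<xi>. gaussian (\<epsilon> k *\<^sub>R \<xi> + 0 :: real^'n))"
      using gaussian_integrable by (subst integrable_affine_iff[OF \<epsilon>k]) auto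
    then have "(\<integral>\<xi>. fourier g \<xi> * gaussian (\<epsilon> k *\<^sub>R \<xi>) \<partial>lborel) = (\<integral>x. g x * fourier (\<lambda>\<xi>. gaussian (\<epsilon> k *\<^sub>R \<xi> + 0)) x \<partial>lborel)"
      using assms by (subst fourier_multiplication_formula[symmetric]) (auto intro!: integrable_rapid schwartz_rapid)
    also have "\<dots> = (\<integral>x. of_real (1 / \<bar>\<epsilon> k\<bar> ^ CARD('n)) * (g x * fourier gaussian ((1 / \<epsilon> k) *\<^sub>R x)) \<partial>lborel)"
      by (subst fourier_affine[OF gaussian_measurable \<epsilon>k]) (simp add: mult_ac)
    also have "\<dots> = (1 / \<bar>\<epsilon> k\<bar> ^ CARD('n)) *\<^sub>R (\<integral>x. g x * fourier gaussian ((1 / \<epsilon> k) *\<^sub>R x) \<partial>lborel)"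
      unfolding integral_mult_right_zero scaleR_conv_of_real ..
    also have "\<dots> = (\<integral>x. g (\<epsilon> k *\<^sub>R x) * fourier gaussian ((1 / \<epsilon> k) *\<^sub>R (\<epsilon> k *\<^sub>R x)) \<partial>lborel)"
    proof -
      have [measurable]: "g \<in> borel_measurable borel" by (rule schwartz_measurable[OF assms])
      have "(\<lambda>x. g x * fourier gaussian ((1 / \<epsilon> k) *\<^sub>R x)) \<in> borel_measurable borel"
        unfolding fourier_gaussian by measurable
      from integral_affine[OF \<epsilon>k this, of 0] show ?thesis by simp
    qed
    finally show ?thesis using \<epsilon>k by simp
  qed
  have fin: "integrable lborel (fourier g)" "integrable lborel g"
    by (intro integrable_rapid schwartz_rapid schwartz_fourier assms)+
  have [measurable]: "g \<in> borel_measurable borel" "fourier g \<in> borel_measurable borel" using fin by auto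
  have small: "(\<lambda>k. \<epsilon> k *\<^sub>R x) \<longlonglongrightarrow> 0" for x :: "real^'n"
    using tendsto_scaleR[OF \<epsilon>(1) tendsto_const, of x] by simp
  have gt: "(\<lambda>k. gaussian (\<epsilon> k *\<^sub>R \<xi>)) \<longlonglongrightarrow> gaussian (0 :: real^'n)" for \<xi> :: "real^'n"
    using gaussian_continuous_on[of "UNIV :: (real^'n) set"]
    by (intro isCont_tendsto_compose[OF _ small]) (simp add: continuous_on_eq_continuous_at)
  have "(\<lambda>k. \<integral>\<xi>. fourier g \<xi> * gaussian (\<epsilon> k *\<^sub>R \<xi>) \<partial>lborel) \<longlonglongrightarrow> (\<integral>\<xi>. fourier g \<xi> * gaussian (0 :: real^'n) \<partial>lborel)"
  proof (rule integral_dominated_convergence)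
    show "integrable lborel (\<lambda>\<xi>. cmod (fourier g \<xi>))" using fin by simp
    show "AE \<xi> in lborel. (\<lambda>k. fourier g \<xi> * gaussian (\<epsilon> k *\<^sub>R \<xi>)) \<longlonglongrightarrow> fourier g \<xi> * gaussian (0 :: real^'n)"
      by (intro AE_I2 tendsto_mult tendsto_const gt)
    show "AE \<xi> in lborel. norm (fourier g \<xi> * gaussian (\<epsilon> k *\<^sub>R \<xi>)) \<le> cmod (fourier g \<xi>)" for k
      unfolding norm_mult by (intro AE_I2 mult_right_le_one_le cmod_gaussian_le) auto
  qed measurable
  moreover have "(\<lambda>k. \<integral>x. g (\<epsilon> k *\<^sub>R x) * fourier gaussian x \<partial>lborel) \<longlonglongrightarrow> (\<integral>x. g 0 * fourier gaussian x \<partial>(lborel :: (real^'n) measure))"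
  proof -
    obtain B where B: "\<And>x. cmod (g x) \<le> B" using schwartz_bounded[OF assms] by metis
    have fg: "integrable lborel (fourier gaussian :: real^'n \<Rightarrow> complex)"
      unfolding fourier_gaussian by (intro integrable_mult_right gaussian_integrable)
    then have [measurable]: "(fourier gaussian :: real^'n \<Rightarrow> complex) \<in> borel_measurable borel" by auto
    show ?thesis
    proof (rule integral_dominated_convergence)
      show "integrable lborel (\<lambda>x::real^'n. B * cmod (fourier gaussian x))" using fg by simp
      show "AE x in lborel. (\<lambda>k. g (\<epsilon> k *\<^sub>R x) * fourier gaussian x) \<longlonglongrightarrow> g 0 * fourier gaussian x"
        by (intro AE_I2 tendsto_mult tendsto_const continuous_on_tendsto_compose[OF schwartz_continuous_on[OF assms, of UNIV] small]) auto
      show "AE x in lborel. norm (g (\<epsilon> k *\<^sub>R x) * fourier gaussian x) \<le> B * cmod (fourier gaussian x)" for k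
        unfolding norm_mult by (intro AE_I2 mult_right_mono B) auto
    qed measurable
  qed
  ultimately have "(\<integral>\<xi>. fourier g \<xi> * gaussian (0 :: real^'n) \<partial>lborel) = (\<integral>x. g 0 * fourier gaussian x \<partial>(lborel :: (real^'n) measure))"
    unfolding eq by (rule LIMSEQ_unique)
  then show ?thesis by (simp add: integral_fourier_gaussian mult.commute)
qed

text \<open>A translation moves the point x to the origin, where \<open>integral_fourier\<close>
  applies.\<close>

theorem fourier_inversion:
  fixes g :: "real^'n::finite \<Rightarrow> complex"
  assumes "g \<in> schwartz"
  shows "fourier (fourier g) (- x) = of_real ((2 * pi) ^ CARD('n)) * g x"
proof -
  have "(\<lambda>y. g (y + x)) \<in> schwartz" using schwartz_affine[OF assms, of 1 x] by simp
  from integral_fourier[OF this] show ?thesis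
    by (simp add: fourier_translation[OF schwartz_measurable[OF assms]] fourier_def[of "fourier g"] inner_commute)
qed

corollary fourier_inj:
  fixes f g :: "real^'n::finite \<Rightarrow> complex"
  assumes "f \<in> schwartz" "g \<in> schwartz" "\<And>\<xi>. fourier f \<xi> = fourier g \<xi>"
  shows "f = g"
proof
  fix x
  have "fourier f = fourier g" using assms(3) by blast
  then show "f x = g x"
    using fourier_inversion[OF assms(1), of x] fourier_inversion[OF assms(2), of x] by simp
qed

corollary fourier_surj:
  fixes G :: "real^'n::finite \<Rightarrow> complex"
  assumes "G \<in> schwartz"
  obtains g where "g \<in> schwartz" "fourier g = G"
proof
  let ?c = "of_real ((2 * pi) ^ CARD('n)) :: complex"
  let ?g = "\<lambda>x. (1 / ?c) * fourier G ((-1) *\<^sub>R x + 0)"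
  show "?g \<in> schwartz"
    by (intro schwartz_cmult' schwartz_affine schwartz_fourier assms) simp
  show "fourier ?g = G"
  proof
    fix \<xi>
    have "fourier (\<lambda>x. fourier G ((-1) *\<^sub>R x + 0)) \<xi> = fourier (fourier G) (- \<xi>)"
      using fourier_affine[OF schwartz_measurable[OF schwartz_fourier[OF assms]], of "-1" 0 \<xi>] by simp
    then show "fourier ?g \<xi> = G \<xi>"
      unfolding fourier_cmult by (simp only: fourier_inversion[OF assms]) simp
  qed
qed

section \<open>Poisson summation for band-limited functions\<close>

definition ivec :: "int^'n::finite \<Rightarrow> real^'n" where
  "ivec k = (\<chi> i. of_int (k $ i))"

lemma ivec_nth [simp]: "ivec k $ i = of_int (k $ i)"
  by (simp add: ivec_def)

text \<open>Half-open, so that integer translates tile the space, and centred at 0, where the kernel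
  below has its peak.\<close>

definition unit_cube :: "(real^'n::finite) set" where
  "unit_cube = {x. \<forall>i. x $ i \<in> {-1/2..<1/2}}"

lemma indicator_unit_cube: "indicator unit_cube x = (\<Prod>i\<in>UNIV. indicator {-1/2..<1/2} (x $ i) :: real)"
  by (auto simp: indicator_def unit_cube_def)

lemma unit_cube_measurable [measurable]: "(unit_cube :: (real^'n::finite) set) \<in> sets borel"
proof -
  have "unit_cube = {x \<in> space (borel :: (real^'n) measure). \<forall>i. x $ i \<in> {-1/2..<(1/2::real)}}" by (auto simp: unit_cube_def)
  also have "\<dots> \<in> sets borel" by measurable
  finally show ?thesis .
qed

lemma norm_unit_cube_le:
  assumes "x \<in> unit_cube"
  shows "norm (x :: real^'n::finite) \<le> real CARD('n)"
proof -
  have "\<bar>x $ i\<bar> \<le> 1" for i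
  proof -
    have "x $ i \<in> {-1/2..<1/2}" using assms by (simp add: unit_cube_def)
    then show ?thesis by auto
  qed
  then have "(\<Sum>i\<in>UNIV. \<bar>x $ i\<bar>) \<le> (\<Sum>i\<in>(UNIV::'n set). 1)" by (intro sum_mono)
  with norm_le_l1_cart[of x] show ?thesis by simp
qed

definition int_cube :: "int^'n::finite \<Rightarrow> (real^'n) set" where
  "int_cube k = {x. x - ivec k \<in> unit_cube}"

lemma int_cube_measurable [measurable]: "int_cube k \<in> sets borel"
proof -
  have "int_cube k = (\<lambda>x. x - ivec k) -` unit_cube \<inter> space borel" by (auto simp: int_cube_def)
  also have "\<dots> \<in> sets borel" by (intro measurable_sets[where A = borel]) measurable
  finally show ?thesis .
qed

lemma int_cube_iff: "x \<in> int_cube k \<longleftrightarrow> k = (\<chi> i. \<lfloor>x $ i + 1/2\<rfloor>)"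
proof -
  have "x $ i - of_int (k $ i) \<in> {-1/2..<1/2} \<longleftrightarrow> k $ i = \<lfloor>x $ i + 1/2\<rfloor>" for i
    by (auto simp: floor_eq_iff eq_commute[of "k $ i"])
  then show ?thesis by (auto simp: int_cube_def unit_cube_def vec_eq_iff)
qed

lemma integral_int_cube:
  fixes f :: "real^'n::finite \<Rightarrow> 'b::{banach,second_countable_topology}"
  assumes "f \<in> borel_measurable borel"
  shows "(\<integral>x. indicator (int_cube k) x *\<^sub>R f x \<partial>lborel) = (\<integral>x. indicator unit_cube x *\<^sub>R f (x + ivec k) \<partial>lborel)"
proof -
  have [measurable]: "f \<in> borel_measurable borel" by fact
  have "(\<integral>x. indicator (int_cube k) (x + ivec k) *\<^sub>R f (x + ivec k) \<partial>lborel) = (\<integral>x. indicator (int_cube k) x *\<^sub>R f x \<partial>lborel)"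
    by (rule integral_translation[where f = "\<lambda>x. indicator (int_cube k) x *\<^sub>R f x"]) measurable
  then show ?thesis by (simp add: int_cube_def indicator_def)
qed

lemma finite_to_nat_less: "finite {k :: 'a::countable. to_nat k < L}"
  using finite_vimageI[OF finite_lessThan[of L], of "to_nat :: 'a \<Rightarrow> nat"] by (simp add: vimage_def lessThan_def)

text \<open>An enumeration exhausts a countable index set along finite sets. An unordered sum
  already known to converge can thus be evaluated as a sequential limit, for which dominated
  convergence is available.\<close>

lemma filterlim_to_nat_less:
  "filterlim (\<lambda>L. {k :: 'a::countable. to_nat k < L}) (finite_subsets_at_top UNIV) sequentially"
  unfolding filterlim_finite_subsets_at_top
proof (intro allI impI)
  fix X :: "'a set" assume X: "finite X \<and> X \<subseteq> UNIV"
  show "\<forall>\<^sub>F L in sequentially. finite {k :: 'a. to_nat k < L} \<and> X \<subseteq> {k. to_nat k < L} \<and> {k :: 'a. to_nat k < L} \<subseteq> UNIV"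
  proof (rule eventually_sequentiallyI[of "Suc (Max (to_nat ` X))"])
    fix L assume "Suc (Max (to_nat ` X)) \<le> L"
    moreover have "to_nat k \<le> Max (to_nat ` X)" if "k \<in> X" for k
      using X that by (intro Max_ge) auto
    ultimately have "X \<subseteq> {k. to_nat k < L}" by (auto simp: Suc_le_eq intro: le_less_trans)
    then show "finite {k :: 'a. to_nat k < L} \<and> X \<subseteq> {k. to_nat k < L} \<and> {k :: 'a. to_nat k < L} \<subseteq> UNIV"
      by (simp add: finite_to_nat_less)
  qed
qed

text \<open>Absolute summability comes from comparing finite partial sums with the integral of the
  norm of f; the value is then found along an enumeration of the cubes by dominated
  convergence.\<close>

lemma has_sum_integral_cubes:
  fixes f :: "real^'n::finite \<Rightarrow> 'b::{banach,second_countable_topology}"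
  assumes "integrable lborel f"
  shows "((\<lambda>k. \<integral>x. indicator unit_cube x *\<^sub>R f (x + ivec k) \<partial>lborel) has_sum (\<integral>x. f x \<partial>lborel)) UNIV"
    and "(\<lambda>k. norm (\<integral>x. indicator unit_cube x *\<^sub>R f (x + ivec k) \<partial>lborel)) summable_on UNIV"
proof -
  have [measurable]: "f \<in> borel_measurable borel" using assms by auto
  let ?a = "\<lambda>k. \<integral>x. indicator (int_cube k) x *\<^sub>R f x \<partial>lborel"
  have eq: "?a = (\<lambda>k. \<integral>x. indicator unit_cube x *\<^sub>R f (x + ivec k) \<partial>lborel)"
    by (rule ext) (rule integral_int_cube, measurable)
  have int: "integrable lborel (\<lambda>x. indicator (int_cube k) x *\<^sub>R f x)" for k
    by (rule integrable_mult_indicator[OF _ assms]) simp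
  have one: "(\<Sum>k\<in>A. indicator (int_cube k) x *\<^sub>R f x) = (if (\<chi> i. \<lfloor>x $ i + 1/2\<rfloor>) \<in> A then f x else 0)" if "finite A" for A and x :: "real^'n"
  proof -
    have "(\<Sum>k\<in>A. indicator (int_cube k) x *\<^sub>R f x) = (\<Sum>k\<in>A. if k = (\<chi> i. \<lfloor>x $ i + 1/2\<rfloor>) then f x else 0)"
      by (intro sum.cong refl) (auto simp: indicator_def int_cube_iff)
    then show ?thesis using that by simp
  qed
  have abs: "(\<lambda>k. norm (?a k)) summable_on UNIV"
  proof (rule nonneg_bdd_above_summable_on)
    show "bdd_above (sum (\<lambda>k. norm (?a k)) ` {F. F \<subseteq> UNIV \<and> finite F})"
    proof (rule bdd_aboveI2)
      fix A :: "(int^'n) set" assume "A \<in> {F. F \<subseteq> UNIV \<and> finite F}"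
      then have A: "finite A" by simp
      have "(\<Sum>k\<in>A. norm (?a k)) \<le> (\<Sum>k\<in>A. \<integral>x. norm (indicator (int_cube k) x *\<^sub>R f x) \<partial>lborel)"
        by (intro sum_mono integral_norm_bound)
      also have "\<dots> = (\<integral>x. (\<Sum>k\<in>A. norm (indicator (int_cube k) x *\<^sub>R f x)) \<partial>lborel)"
        by (subst Bochner_Integration.integral_sum) (rule integrable_norm[OF int], rule refl)
      also have "\<dots> \<le> (\<integral>x. norm (f x) \<partial>lborel)"
      proof (rule integral_mono)
        show "integrable lborel (\<lambda>x. \<Sum>k\<in>A. norm (indicator (int_cube k) x *\<^sub>R f x))"
          by (intro Bochner_Integration.integrable_sum integrable_norm int)
        fix x
        have "(\<Sum>k\<in>A. norm (indicator (int_cube k) x *\<^sub>R f x)) = (\<Sum>k\<in>A. if k = (\<chi> i. \<lfloor>x $ i + 1/2\<rfloor>) then norm (f x) else 0)"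
          by (intro sum.cong refl) (auto simp: indicator_def int_cube_iff)
        also have "\<dots> \<le> norm (f x)" using A by simp
        finally show "(\<Sum>k\<in>A. norm (indicator (int_cube k) x *\<^sub>R f x)) \<le> norm (f x)" .
      qed (use assms in auto)
      finally show "(\<Sum>k\<in>A. norm (?a k)) \<le> (\<integral>x. norm (f x) \<partial>lborel)" .
    qed
  qed auto
  have L1: "(\<lambda>L. \<Sum>k | to_nat k < L. ?a k) \<longlonglongrightarrow> (\<integral>x. f x \<partial>lborel)"
  proof -
    have "(\<Sum>k | to_nat k < L. ?a k) = (\<integral>x. (if to_nat (\<chi> i. \<lfloor>x $ i + 1/2\<rfloor>) < L then f x else 0) \<partial>lborel)" for L
      by (subst Bochner_Integration.integral_sum[symmetric]) (use int one[OF finite_to_nat_less] in auto)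
    moreover have "(\<lambda>L. \<integral>x. (if to_nat (\<chi> i. \<lfloor>x $ i + 1/2\<rfloor>) < L then f x else 0) \<partial>lborel) \<longlonglongrightarrow> (\<integral>x. f x \<partial>lborel)"
    proof (rule integral_dominated_convergence)
      show "integrable lborel (\<lambda>x. norm (f x))" using assms by simp
      show "(\<lambda>x. if to_nat (\<chi> i. \<lfloor>x $ i + 1/2\<rfloor>) < L then f x else 0) \<in> borel_measurable lborel" for L
      proof -
        have "(\<lambda>x. if to_nat (\<chi> i. \<lfloor>x $ i + 1/2\<rfloor>) < L then f x else 0) = (\<lambda>x. \<Sum>k | to_nat k < L. indicator (int_cube k) x *\<^sub>R f x)"
          by (rule ext) (simp add: one[OF finite_to_nat_less])
        then show ?thesis by simp
      qed
      show "AE x in lborel. (\<lambda>L. if to_nat (\<chi> i. \<lfloor>x $ i + 1/2\<rfloor>) < L then f x else 0) \<longlonglongrightarrow> f x"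
      proof (rule AE_I2)
        fix x :: "real^'n"
        have "\<forall>\<^sub>F L in sequentially. (if to_nat (\<chi> i. \<lfloor>x $ i + 1/2\<rfloor>) < L then f x else 0) = f x"
          by (rule eventually_sequentiallyI[of "Suc (to_nat (\<chi> i. \<lfloor>x $ i + 1/2\<rfloor>))"]) auto
        then show "(\<lambda>L. if to_nat (\<chi> i. \<lfloor>x $ i + 1/2\<rfloor>) < L then f x else 0) \<longlonglongrightarrow> f x"
          by (rule tendsto_eventually)
      qed
    qed auto
    ultimately show ?thesis by simp
  qed
  have hs: "(?a has_sum infsum ?a UNIV) UNIV"
    by (rule has_sum_infsum[OF abs_summable_summable[OF abs]])
  then have "(sum ?a \<longlongrightarrow> infsum ?a UNIV) (finite_subsets_at_top UNIV)"
    by (simp only: has_sum_def)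
  from filterlim_compose[OF this filterlim_to_nat_less]
  have L2: "(\<lambda>L. \<Sum>k | to_nat k < L. ?a k) \<longlonglongrightarrow> infsum ?a UNIV" .
  have "(?a has_sum (\<integral>x. f x \<partial>lborel)) UNIV"
    using hs unfolding LIMSEQ_unique[OF L2 L1] .
  then show "((\<lambda>k. \<integral>x. indicator unit_cube x *\<^sub>R f (x + ivec k) \<partial>lborel) has_sum (\<integral>x. f x \<partial>lborel)) UNIV"
    by (simp only: eq)
  show "(\<lambda>k. norm (\<integral>x. indicator unit_cube x *\<^sub>R f (x + ivec k) \<partial>lborel)) summable_on UNIV"
    using abs by (simp only: fun_cong[OF eq])
qed

subsection \<open>The kernel \<open>\<Prod>\<^sub>i cos\<^bsup>2M\<^esup>(\<pi> x\<^sub>i)\<close>\<close>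

text \<open>All frequencies of this kernel lie in the dual lattice, so integrating \<open>F\<close> against it only sees
  its mean \<open>cbin M\<^sup>n\<close> when \<open>fourier F\<close> vanishes at the nonzero dual lattice points, while the
  normalized kernel concentrates at the integer points: the mass of \<open>sin\<^sup>2(\<pi>t) cos\<^bsup>2M\<^esup>(\<pi>t)\<close> over a
  period is \<open>cbin M - cbin (M + 1) = cbin (M + 1) / (2M + 1)\<close>.\<close>

definition cbin :: "nat \<Rightarrow> real" where
  "cbin M = real ((2 * M) choose M) / 4 ^ M"

lemma cbin_pos: "cbin M > 0"
  by (simp add: cbin_def)

text \<open>The recursion that the integrals of the even powers of cos(pi t) over a period also
  satisfy; this identifies the two in \<open>integral_cos_power\<close>. It follows from two
  absorption identities for binomial coefficients.\<close>

lemma cbin_Suc: "cbin (Suc M) * (2 * real M + 2) = cbin M * (2 * real M + 1)"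
proof -
  have "2 * Suc M = Suc (2 * M + 1)" by simp
  then have 1: "Suc M * ((2 * Suc M) choose Suc M) = (2 * Suc M) * ((2 * M + 1) choose M)"
    using Suc_times_binomial[of M "2 * M + 1"] by (simp only:)
  have 2: "Suc M * ((2 * M + 1) choose M) = (2 * M + 1) * ((2 * M) choose M)"
  proof -
    have "2 * M + 1 - M = Suc M" "2 * M + 1 - 1 = 2 * M" by auto
    with binomial_absorb_comp[of "2 * M + 1" M] show ?thesis by (simp only:)
  qed
  have "(real M + 1) * ((real M + 1) * real ((2 * Suc M) choose Suc M)) = (real M + 1) * (2 * (2 * real M + 1) * real ((2 * M) choose M))"
    using arg_cong[OF 1, of real] arg_cong[OF 2, of real] by (simp only: of_nat_mult of_nat_Suc of_nat_add) (simp add: algebra_simps)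
  then have "(real M + 1) * real ((2 * Suc M) choose Suc M) = 2 * (2 * real M + 1) * real ((2 * M) choose M)"
    by (simp only: mult_cancel_left) auto
  then have "2 * ((real M + 1) * real ((2 * Suc M) choose Suc M)) / (4 * 4 ^ M) = 2 * (2 * (2 * real M + 1) * real ((2 * M) choose M)) / (4 * 4 ^ M)"
    by (simp only:)
  moreover have "cbin (Suc M) * (2 * real M + 2) = 2 * ((real M + 1) * real ((2 * Suc M) choose Suc M)) / (4 * 4 ^ M)"
  proof -
    have "X / (4 * 4 ^ M) * (2 * real M + 2) = 2 * ((real M + 1) * X) / (4 * 4 ^ M)" for X :: real
      by (simp add: field_simps)
    then show ?thesis unfolding cbin_def power_Suc .
  qed
  moreover have "cbin M * (2 * real M + 1) = 2 * (2 * (2 * real M + 1) * real ((2 * M) choose M)) / (4 * 4 ^ M)"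
    unfolding cbin_def by (simp add: field_simps)
  ultimately show ?thesis by (simp only:)
qed

text \<open>All frequencies are integer multiples of 2 pi, and the constant term j = M has
  coefficient \<open>cbin M\<close>.\<close>

lemma cos_power_expansion:
  "complex_of_real (cos (pi * t) ^ (2 * M)) =
    (\<Sum>j\<le>2 * M. of_real (real ((2 * M) choose j) / 4 ^ M) * exp (\<i> * of_real (2 * pi * (real j - real M) * t)))"
proof -
  let ?z = "exp (\<i> * of_real (pi * t))" and ?w = "exp (- (\<i> * of_real (pi * t)))"
  have "complex_of_real (cos (pi * t)) = (?z + ?w) / 2"
    by (simp add: cos_exp_eq flip: cos_of_real)
  then have "complex_of_real (cos (pi * t) ^ (2 * M)) = ((?z + ?w) / 2) ^ (2 * M)"
    by (simp only: of_real_power)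
  also have "\<dots> = (?z + ?w) ^ (2 * M) / 4 ^ M"
    by (simp add: power_divide power_mult)
  also have "\<dots> = (\<Sum>j\<le>2 * M. of_nat ((2 * M) choose j) * ?z ^ j * ?w ^ (2 * M - j)) / 4 ^ M"
    by (simp add: binomial_ring)
  also have "\<dots> = (\<Sum>j\<le>2 * M. of_real (real ((2 * M) choose j) / 4 ^ M) * exp (\<i> * of_real (2 * pi * (real j - real M) * t)))"
    unfolding sum_divide_distrib
  proof (intro sum.cong refl)
    fix j assume "j \<in> {..2 * M}"
    then have "j \<le> 2 * M" by simp
    have "?z ^ j * ?w ^ (2 * M - j) = exp (of_nat j * (\<i> * of_real (pi * t)) + of_nat (2 * M - j) * - (\<i> * of_real (pi * t)))"
      by (simp only: exp_add exp_of_nat_mult)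
    also have "of_nat j * (\<i> * of_real (pi * t)) + of_nat (2 * M - j) * - (\<i> * of_real (pi * t)) = \<i> * of_real (2 * pi * (real j - real M) * t)"
      using \<open>j \<le> 2 * M\<close> by (simp add: of_nat_diff algebra_simps)
    finally show "of_nat ((2 * M) choose j) * ?z ^ j * ?w ^ (2 * M - j) / 4 ^ M
       = of_real (real ((2 * M) choose j) / 4 ^ M) * exp (\<i> * of_real (2 * pi * (real j - real M) * t))"
      by (simp add: mult.assoc)
  qed
  finally show ?thesis .
qed

definition cker :: "nat \<Rightarrow> real^'n::finite \<Rightarrow> real" where
  "cker M x = (\<Prod>i\<in>UNIV. cos (pi * x $ i) ^ (2 * M))"

lemma cker_nonneg: "0 \<le> cker M x"
  unfolding cker_def by (intro prod_nonneg) auto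

lemma cker_le_1: "cker M x \<le> 1"
  unfolding cker_def by (intro prod_le_1) (auto simp: power_mult intro!: power_le_one abs_square_le_1[THEN iffD2])

lemma cker_continuous_on: "continuous_on S (cker M)"
  unfolding cker_def by (intro continuous_intros) 

lemma cker_measurable [measurable]: "cker M \<in> borel_measurable borel"
  by (intro borel_measurable_continuous_onI cker_continuous_on)

lemma cker_periodic: "cker M (x + ivec k) = cker M x"
proof -
  have "cos (pi * (x $ i + of_int (k $ i))) ^ (2 * M) = cos (pi * x $ i) ^ (2 * M)" for i
  proof -
    have "cos (pi * (x $ i + of_int (k $ i))) = cos (pi * x $ i) * cos (pi * of_int (k $ i))"
      by (simp add: distrib_left cos_add sin_npi_int)
    moreover have "(cos (pi * of_int (k $ i)))\<^sup>2 = 1"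
      using sin_cos_squared_add[of "pi * of_int (k $ i)"] sin_npi_int[of "k $ i"] by simp
    ultimately show ?thesis by (simp add: power_mult power_mult_distrib)
  qed
  then show ?thesis by (simp add: cker_def)
qed

lemma integral_times_cker:
  fixes F :: "real^'n::finite \<Rightarrow> complex"
  assumes "integrable lborel F" "\<And>j. j \<noteq> 0 \<Longrightarrow> fourier F ((2 * pi) *\<^sub>R ivec j) = 0"
  shows "(\<integral>x. F x * of_real (cker M x) \<partial>lborel) = of_real (cbin M ^ CARD('n)) * (\<integral>x. F x \<partial>lborel)"
proof -
  define c where "c j = complex_of_real (real ((2 * M) choose j) / 4 ^ M)" for j
  define A where "A = (UNIV :: 'n set) \<rightarrow>\<^sub>E {..2 * M}"
  \<comment> \<open>The expansion has phases with g - M while \<open>fourier\<close> carries a minus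
    sign, hence M - g. The zero frequency belongs to the constant function g = M only.\<close>
  define J where "J g = (\<chi> i. int M - int (g i))" for g :: "'n \<Rightarrow> nat"
  have finA: "finite A" unfolding A_def by (intro finite_PiE) auto
  have exp_eq: "F x * of_real (cker M x) = (\<Sum>g\<in>A. (\<Prod>i\<in>UNIV. c (g i)) * (exp (- \<i> * of_real (x \<bullet> ((2 * pi) *\<^sub>R ivec (J g)))) * F x))" for x
  proof -
    have "complex_of_real (cker M x) = (\<Prod>i\<in>UNIV. \<Sum>j\<le>2 * M. c j * exp (\<i> * of_real (2 * pi * (real j - real M) * x $ i)))"
      unfolding cker_def c_def of_real_prod cos_power_expansion ..
    also have "\<dots> = (\<Sum>g\<in>A. \<Prod>i\<in>UNIV. c (g i) * exp (\<i> * of_real (2 * pi * (real (g i) - real M) * x $ i)))"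
      unfolding A_def by (rule prod_sum_PiE) auto
    also have "\<dots> = (\<Sum>g\<in>A. (\<Prod>i\<in>UNIV. c (g i)) * exp (- \<i> * of_real (x \<bullet> ((2 * pi) *\<^sub>R ivec (J g)))))"
    proof (intro sum.cong refl)
      fix g
      have "(\<Prod>i\<in>UNIV. exp (\<i> * of_real (2 * pi * (real (g i) - real M) * x $ i))) = exp (\<Sum>i\<in>UNIV. \<i> * of_real (2 * pi * (real (g i) - real M) * x $ i))"
        by (simp add: exp_sum)
      also have "(\<Sum>i\<in>UNIV. \<i> * of_real (2 * pi * (real (g i) - real M) * x $ i)) = - \<i> * of_real (x \<bullet> ((2 * pi) *\<^sub>R ivec (J g)))"
        unfolding inner_vec_def of_real_sum sum_distrib_left
        by (intro sum.cong refl) (simp add: J_def algebra_simps)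
      finally show "(\<Prod>i\<in>UNIV. c (g i) * exp (\<i> * of_real (2 * pi * (real (g i) - real M) * x $ i)))
        = (\<Prod>i\<in>UNIV. c (g i)) * exp (- \<i> * of_real (x \<bullet> ((2 * pi) *\<^sub>R ivec (J g))))"
        by (simp only: prod.distrib)
    qed
    finally show ?thesis by (simp only: sum_distrib_left sum_distrib_right mult_ac)
  qed
  have "(\<integral>x. F x * of_real (cker M x) \<partial>lborel) = (\<Sum>g\<in>A. (\<Prod>i\<in>UNIV. c (g i)) * fourier F ((2 * pi) *\<^sub>R ivec (J g)))"
    unfolding exp_eq fourier_def
    by (subst Bochner_Integration.integral_sum) (intro integrable_mult_right integrable_fourier assms, simp)
  also have "\<dots> = (\<Sum>g\<in>A. if g = (\<lambda>_. M) then (\<Prod>i\<in>UNIV. c (g i)) * fourier F 0 else 0)"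
  proof (intro sum.cong refl)
    fix g :: "'n \<Rightarrow> nat"
    have "J g = 0 \<longleftrightarrow> g = (\<lambda>_. M)" by (auto simp: J_def vec_eq_iff fun_eq_iff)
    moreover have "ivec (0 :: int^'n) = 0" by (simp add: vec_eq_iff)
    ultimately show "(\<Prod>i\<in>UNIV. c (g i)) * fourier F ((2 * pi) *\<^sub>R ivec (J g)) = (if g = (\<lambda>_. M) then (\<Prod>i\<in>UNIV. c (g i)) * fourier F 0 else 0)"
      using assms(2)[of "J g"] by auto
  qed
  also have "\<dots> = (\<Prod>i\<in>(UNIV::'n set). c M) * fourier F 0"
  proof -
    have "(\<lambda>_. M) \<in> A" by (simp add: A_def PiE_iff)
    then show ?thesis using finA by simp
  qed
  finally show ?thesis by (simp add: c_def cbin_def fourier_def)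
qed

lemma
  shows integrable_cos_power: "integrable lborel (\<lambda>t. indicator {-1/2..<1/2} t * cos (pi * t) ^ (2 * M))"
    and integral_cos_power: "(\<integral>t. indicator {-1/2..<1/2} t * cos (pi * t) ^ (2 * M) \<partial>lborel) = cbin M"
proof -
  have meas: "(\<lambda>t. cos (pi * t) ^ m) \<in> borel_measurable borel" for m
    by (intro borel_measurable_continuous_onI continuous_intros)
  have bnd: "norm (indicator {-1/2..<1/2} t * cos (pi * t) ^ m) \<le> norm (indicator {-1/2..<1/2::real} t :: real)" for t m
    by (auto simp: indicator_def power_abs power_le_one abs_cos_le_one)
  have int: "integrable lborel (\<lambda>t. indicator {-1/2..<1/2} t * cos (pi * t) ^ m)" for m
    by (rule Bochner_Integration.integrable_bound[where f = "indicator {-1/2..<1/2::real} :: real \<Rightarrow> real"])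
      (use meas bnd in \<open>auto intro!: integrable_real_indicator\<close>)
  show "integrable lborel (\<lambda>t. indicator {-1/2..<1/2} t * cos (pi * t) ^ (2 * M))" by (rule int)
  have ico: "(\<integral>t. indicator {-1/2..<1/2} t * f t \<partial>lborel) = (\<integral>t. f t * indicator {-1/2..1/2} t \<partial>lborel)"
    if "f \<in> borel_measurable borel" for f :: "real \<Rightarrow> real"
  proof (rule integral_cong_AE)
    have "AE t in lborel. t \<noteq> (1/2 :: real)" by (rule AE_lborel_singleton)
    then show "AE t in lborel. indicator {-1/2..<1/2} t * f t = f t * indicator {-1/2..1/2} t"
      by eventually_elim (auto simp: indicator_def)
  qed (use that in auto)
  show "(\<integral>t. indicator {-1/2..<1/2} t * cos (pi * t) ^ (2 * M) \<partial>lborel) = cbin M"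
  proof (induction M)
    case 0
    then show ?case by (simp add: cbin_def measure_def)
  next
    case (Suc M)
    let ?f = "\<lambda>t. pi * ((2 * real M + 2) * cos (pi * t) ^ (2 * Suc M) - (2 * real M + 1) * cos (pi * t) ^ (2 * M))"
    \<comment> \<open>A primitive of \<open>?f\<close> that vanishes at both endpoints, so that
      \<open>?f\<close> has integral zero; this is the recursion of \<open>cbin_Suc\<close> for the
      integrals.\<close>
    let ?G = "\<lambda>t. sin (pi * t) * cos (pi * t) ^ (2 * M + 1)"
    have "(\<integral>t. ?f t * indicator {-1/2..1/2} t \<partial>lborel) = ?G (1/2) - ?G (-1/2)"
    proof (rule integral_FTC_Icc_real)
      fix t :: real
      have "(sin (pi * t))\<^sup>2 = 1 - (cos (pi * t))\<^sup>2" by (simp add: sin_squared_eq)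
      then have s: "sin (pi * t) * sin (pi * t) = 1 - cos (pi * t) * cos (pi * t)" by (simp add: power2_eq_square)
      have "((\<lambda>t. sin (pi * t)) has_real_derivative cos (pi * t) * pi) (at t)"
        "((\<lambda>t. cos (pi * t)) has_real_derivative - sin (pi * t) * pi) (at t)"
        by (auto intro!: derivative_eq_intros)
      from DERIV_mult[OF this(1) DERIV_power[OF this(2), of "2 * M + 1"]]
      have "(?G has_real_derivative (pi * cos (pi * t) * cos (pi * t) ^ (2 * M + 1)
          + sin (pi * t) * ((2 * real M + 1) * cos (pi * t) ^ (2 * M) * (- sin (pi * t) * pi)))) (at t)"
        by (simp add: mult_ac add.commute)
      also have "pi * cos (pi * t) * cos (pi * t) ^ (2 * M + 1) + sin (pi * t) * ((2 * real M + 1) * cos (pi * t) ^ (2 * M) * (- sin (pi * t) * pi))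
         = pi * (cos (pi * t) * cos (pi * t) * cos (pi * t) ^ (2 * M) - (2 * real M + 1) * cos (pi * t) ^ (2 * M) * (sin (pi * t) * sin (pi * t)))"
        by (simp add: algebra_simps)
      also have "\<dots> = ?f t" unfolding s by (simp add: algebra_simps)
      finally show "(?G has_real_derivative ?f t) (at t)" .
      show "isCont ?f t" by (intro continuous_intros)
    qed simp
    also have "\<dots> = 0"
      by (simp add: cos_minus[of "pi / 2", simplified])
    finally have "0 = (\<integral>t. indicator {-1/2..<1/2} t * ?f t \<partial>lborel)"
      by (subst ico) (auto intro!: borel_measurable_continuous_onI continuous_intros)
    also have "\<dots> = (\<integral>t. (pi * (2 * real M + 2)) * (indicator {-1/2..<1/2} t * cos (pi * t) ^ (2 * Suc M))
        - (pi * (2 * real M + 1)) * (indicator {-1/2..<1/2} t * cos (pi * t) ^ (2 * M)) \<partial>lborel)"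
      by (intro Bochner_Integration.integral_cong refl) (simp only: algebra_simps)
    also have "\<dots> = (pi * (2 * real M + 2)) * (\<integral>t. indicator {-1/2..<1/2} t * cos (pi * t) ^ (2 * Suc M) \<partial>lborel)
        - (pi * (2 * real M + 1)) * (\<integral>t. indicator {-1/2..<1/2} t * cos (pi * t) ^ (2 * M) \<partial>lborel)"
      by (subst Bochner_Integration.integral_diff, intro integrable_mult_right int, intro integrable_mult_right int)
        (simp only: integral_mult_right_zero)
    finally have "pi * ((2 * real M + 2) * (\<integral>t. indicator {-1/2..<1/2} t * cos (pi * t) ^ (2 * Suc M) \<partial>lborel))
        = pi * (cbin (Suc M) * (2 * real M + 2))"
      unfolding Suc.IH cbin_Suc by (simp add: algebra_simps)
    then have "(2 * real M + 2) * (\<integral>t. indicator {-1/2..<1/2} t * cos (pi * t) ^ (2 * Suc M) \<partial>lborel) = (2 * real M + 2) * cbin (Suc M)"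
      by (simp only: mult_cancel_left mult.commute[of "cbin _"]) auto
    moreover have "2 * real M + 2 \<noteq> 0" by simp
    ultimately show ?case by (simp only: mult_cancel_left) blast
  qed
qed

text \<open>This is |t| <= |tan(pi t)| multiplied by the cosine. The endpoint t = -1/2, a pole of
  the tangent, is treated apart; there the cosine vanishes.\<close>

lemma square_cos_le_sin:
  assumes "t \<in> {-1/2..<1/2}"
  shows "(t * cos (pi * t))\<^sup>2 \<le> 1 - (cos (pi * t))\<^sup>2"
proof (cases "\<bar>t\<bar> = 1/2")
  case True
  then have "t = - 1/2" using assms by auto
  then show ?thesis by (simp add: cos_minus[of "pi / 2", simplified])
next
  case False
  with assms have "\<bar>t\<bar> < 1/2" by auto
  then have a: "\<bar>pi * t\<bar> < pi / 2" by (simp add: abs_mult)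
  have c: "cos (pi * t) > 0" using a by (intro cos_gt_zero_pi) linarith+
  have "\<bar>t\<bar> \<le> \<bar>pi * t\<bar>" using pi_gt3 by (simp add: abs_mult mult_le_cancel_right1)
  also have "\<dots> \<le> \<bar>tan (pi * t)\<bar>" by (rule abs_tan_ge[OF a])
  finally have "\<bar>t\<bar> * cos (pi * t) \<le> \<bar>sin (pi * t)\<bar>"
    using c by (simp add: tan_def abs_mult abs_divide field_simps)
  then have "(t * cos (pi * t))\<^sup>2 \<le> (sin (pi * t))\<^sup>2"
    using c by (intro abs_le_square_iff[THEN iffD1]) (simp add: abs_mult)
  then show ?thesis by (simp add: sin_squared_eq)
qed

lemma
  shows integrable_square_cos_power: "integrable lborel (\<lambda>t. indicator {-1/2..<1/2} t * (t\<^sup>2 * cos (pi * t) ^ (2 * Suc M)))"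
    and integral_square_cos_power: "(\<integral>t. indicator {-1/2..<1/2} t * (t\<^sup>2 * cos (pi * t) ^ (2 * Suc M)) \<partial>lborel) \<le> cbin (Suc M) / (2 * real M + 1)"
proof -
  let ?i = "indicator {-1/2..<1/2::real} :: real \<Rightarrow> real"
  have le: "?i t * (t\<^sup>2 * cos (pi * t) ^ (2 * Suc M)) \<le> ?i t * cos (pi * t) ^ (2 * M) - ?i t * cos (pi * t) ^ (2 * Suc M)" for t
  proof (cases "t \<in> {-1/2..<1/2}")
    case True
    have "t\<^sup>2 * cos (pi * t) ^ (2 * Suc M) = cos (pi * t) ^ (2 * M) * (t * cos (pi * t))\<^sup>2"
      by (simp add: power2_eq_square algebra_simps)
    also have "\<dots> \<le> cos (pi * t) ^ (2 * M) * (1 - (cos (pi * t))\<^sup>2)"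
      by (intro mult_left_mono square_cos_le_sin True) (simp add: power_mult)
    finally show ?thesis using True by (simp add: algebra_simps power2_eq_square)
  qed (auto simp: indicator_def)
  have int: "integrable lborel (\<lambda>t. ?i t * cos (pi * t) ^ (2 * M) - ?i t * cos (pi * t) ^ (2 * Suc M))"
    by (intro Bochner_Integration.integrable_diff integrable_cos_power)
  show I: "integrable lborel (\<lambda>t. ?i t * (t\<^sup>2 * cos (pi * t) ^ (2 * Suc M)))"
  proof (rule Bochner_Integration.integrable_bound[OF int])
    have "(\<lambda>t::real. t\<^sup>2 * cos (pi * t) ^ (2 * Suc M)) \<in> borel_measurable borel"
      by (intro borel_measurable_continuous_onI continuous_intros)
    then show "(\<lambda>t. ?i t * (t\<^sup>2 * cos (pi * t) ^ (2 * Suc M))) \<in> borel_measurable lborel"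
      by simp
    have "0 \<le> ?i t * (t\<^sup>2 * cos (pi * t) ^ (2 * Suc M))" for t
      by (intro mult_nonneg_nonneg zero_le_even_power) auto
    then show "AE t in lborel. norm (?i t * (t\<^sup>2 * cos (pi * t) ^ (2 * Suc M))) \<le> norm (?i t * cos (pi * t) ^ (2 * M) - ?i t * cos (pi * t) ^ (2 * Suc M))"
      unfolding real_norm_def
      by (intro AE_I2) (simp only: abs_of_nonneg, rule order_trans[OF le abs_ge_self])
  qed
  have "(\<integral>t. ?i t * (t\<^sup>2 * cos (pi * t) ^ (2 * Suc M)) \<partial>lborel) \<le> (\<integral>t. ?i t * cos (pi * t) ^ (2 * M) - ?i t * cos (pi * t) ^ (2 * Suc M) \<partial>lborel)"
    by (intro integral_mono I int le)
  also have "\<dots> = cbin M - cbin (Suc M)"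
    by (subst Bochner_Integration.integral_diff, rule integrable_cos_power, rule integrable_cos_power)
      (simp only: integral_cos_power)
  also have "\<dots> = cbin (Suc M) / (2 * real M + 1)"
    using cbin_Suc[of M] by (simp add: field_simps)
  finally show "(\<integral>t. ?i t * (t\<^sup>2 * cos (pi * t) ^ (2 * Suc M)) \<partial>lborel) \<le> cbin (Suc M) / (2 * real M + 1)" .
qed

lemma
  shows integrable_cker: "integrable lborel (\<lambda>x::real^'n::finite. indicator unit_cube x * cker M x)"
    and integral_cker: "(\<integral>x. indicator unit_cube x * cker M x \<partial>(lborel :: (real^'n) measure)) = cbin M ^ CARD('n)"
proof -
  have eq: "indicator unit_cube x * cker M x = (\<Prod>i\<in>UNIV. indicator {-1/2..<1/2} (x $ i) * cos (pi * x $ i) ^ (2 * M))" for x :: "real^'n"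
    by (simp add: indicator_unit_cube cker_def prod.distrib)
  show "integrable lborel (\<lambda>x::real^'n::finite. indicator unit_cube x * cker M x)"
    unfolding eq by (rule integrable_prod_components[of "\<lambda>_ t. indicator {-1/2..<1/2} t * cos (pi * t) ^ (2 * M)", OF integrable_cos_power])
  show "(\<integral>x. indicator unit_cube x * cker M x \<partial>(lborel :: (real^'n) measure)) = cbin M ^ CARD('n)"
    unfolding eq
    by (subst integral_prod_components[of "\<lambda>_ t. indicator {-1/2..<1/2} t * cos (pi * t) ^ (2 * M)", OF integrable_cos_power])
      (simp only: integral_cos_power prod_constant)
qed

lemma
  shows integrable_square_cker: "integrable lborel (\<lambda>x::real^'n::finite. indicator unit_cube x * ((norm x)\<^sup>2 * cker (Suc M) x))"
    and integral_square_cker: "(\<integral>x. indicator unit_cube x * ((norm x)\<^sup>2 * cker (Suc M) x) \<partial>(lborel :: (real^'n) measure))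
      \<le> real CARD('n) * cbin (Suc M) ^ CARD('n) / (2 * real M + 1)"
proof -
  \<comment> \<open>Factors of the i-th summand of |x|^2 times the kernel: only the coordinate j = i
    carries a square, so exactly one factor gains 1 / (2M + 1).\<close>
  define h where "h i j t = indicator {-1/2..<1/2::real} t * ((if j = i then t\<^sup>2 else 1) * cos (pi * t) ^ (2 * Suc M))" for i j :: 'n and t :: real
  have hint: "integrable lborel (h i j)" for i j
    unfolding h_def using integrable_square_cos_power[of M] integrable_cos_power[of "Suc M"] by (cases "j = i") auto
  have eq: "indicator unit_cube x * ((norm x)\<^sup>2 * cker (Suc M) x) = (\<Sum>i\<in>UNIV. \<Prod>j\<in>UNIV. h i j (x $ j))" for x :: "real^'n"
  proof -
    have n: "(norm x)\<^sup>2 = (\<Sum>i\<in>UNIV. (x $ i)\<^sup>2)"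
      unfolding power2_norm_eq_inner inner_vec_def by (simp add: power2_eq_square)
    have "(\<Prod>j\<in>UNIV. h i j (x $ j)) = indicator unit_cube x * ((x $ i)\<^sup>2 * cker (Suc M) x)" for i
      unfolding h_def prod.distrib indicator_unit_cube cker_def by simp
    then show ?thesis by (simp add: n sum_distrib_left sum_distrib_right)
  qed
  show "integrable lborel (\<lambda>x::real^'n::finite. indicator unit_cube x * ((norm x)\<^sup>2 * cker (Suc M) x))"
    unfolding eq by (intro Bochner_Integration.integrable_sum integrable_prod_components hint)
  have "(\<integral>x. indicator unit_cube x * ((norm x)\<^sup>2 * cker (Suc M) x) \<partial>(lborel :: (real^'n) measure)) = (\<Sum>i\<in>(UNIV::'n set). \<Prod>j\<in>(UNIV::'n set). \<integral>t. h i j t \<partial>lborel)"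
    unfolding eq by (subst Bochner_Integration.integral_sum) (intro integrable_prod_components hint, simp add: integral_prod_components hint)
  also have "\<dots> \<le> (\<Sum>i\<in>(UNIV::'n set). cbin (Suc M) ^ CARD('n) / (2 * real M + 1))"
  proof (rule sum_mono)
    fix i :: 'n
    have "(\<Prod>j\<in>(UNIV::'n set). \<integral>t. h i j t \<partial>lborel) \<le> (\<Prod>j\<in>(UNIV::'n set). cbin (Suc M) * (if j = i then 1 / (2 * real M + 1) else 1))"
    proof (rule prod_mono)
      fix j :: 'n
      have "0 \<le> (\<integral>t. h i j t \<partial>lborel)"
        unfolding h_def by (intro Bochner_Integration.integral_nonneg mult_nonneg_nonneg zero_le_even_power) auto
      moreover have "(\<integral>t. h i j t \<partial>lborel) \<le> cbin (Suc M) * (if j = i then 1 / (2 * real M + 1) else 1)"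
        using integral_square_cos_power[of M] integral_cos_power[of "Suc M"] by (simp add: h_def)
      ultimately show "0 \<le> (\<integral>t. h i j t \<partial>lborel) \<and> (\<integral>t. h i j t \<partial>lborel) \<le> cbin (Suc M) * (if j = i then 1 / (2 * real M + 1) else 1)" ..
    qed
    also have "\<dots> = cbin (Suc M) ^ CARD('n) / (2 * real M + 1)"
      by (simp add: prod.distrib)
    finally show "(\<Prod>j\<in>(UNIV::'n set). \<integral>t. h i j t \<partial>lborel) \<le> cbin (Suc M) ^ CARD('n) / (2 * real M + 1)" .
  qed
  finally show "(\<integral>x. indicator unit_cube x * ((norm x)\<^sup>2 * cker (Suc M) x) \<partial>(lborel :: (real^'n) measure))
      \<le> real CARD('n) * cbin (Suc M) ^ CARD('n) / (2 * real M + 1)" by simp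
qed

subsection \<open>Poisson summation and sampling\<close>

lemma has_sum_diff:
  fixes f g :: "'a \<Rightarrow> 'b::real_normed_vector"
  assumes "(f has_sum a) A" "(g has_sum b) A"
  shows "((\<lambda>x. f x - g x) has_sum a - b) A"
  using has_sum_add[OF assms(1), of "\<lambda>x. - g x" "- b"] assms(2) by (simp add: has_sum_uminus)

lemma norm_has_sum_le:
  fixes f :: "'a \<Rightarrow> 'b::real_normed_vector"
  assumes "(f has_sum s) A" "(b has_sum t) A" "\<And>x. norm (f x) \<le> b x"
  shows "norm s \<le> t"
proof (rule tendsto_le)
  show "(sum b \<longlongrightarrow> t) (finite_subsets_at_top A)" using assms(2) by (simp only: has_sum_def)
  show "((\<lambda>F. norm (sum f F)) \<longlongrightarrow> norm s) (finite_subsets_at_top A)"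
    using assms(1) by (intro tendsto_norm) (simp only: has_sum_def)
  show "\<forall>\<^sub>F F in finite_subsets_at_top A. norm (sum f F) \<le> sum b F"
    by (intro always_eventually allI order_trans[OF norm_sum] sum_mono assms(3))
qed simp

text \<open>Comparison of the lattice sum with an integral: on the unit cube around k the weight
  changes by at most the factor (1 + n)^(2n).\<close>

lemma summable_inverse_power_ivec:
  "(\<lambda>k::int^'n::finite. 1 / (1 + norm (ivec k)) ^ (2 * CARD('n))) summable_on UNIV"
proof -
  let ?M = "2 * CARD('n)"
  let ?w = "\<lambda>x::real^'n. 1 / (1 + norm x) ^ ?M"
  let ?K = "(1 + real CARD('n)) ^ ?M"
  let ?I = "\<lambda>k. \<integral>x. indicator unit_cube x *\<^sub>R ?w (x + ivec k) \<partial>lborel"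
  have s: "(\<lambda>k. norm (?I k)) summable_on UNIV"
    by (rule has_sum_integral_cubes(2)[OF integrable_inverse_power_norm])
  have "1 / (1 + norm (ivec k)) ^ ?M \<le> ?K * norm (?I k)" for k :: "int^'n"
  proof -
    have i1: "integrable lborel (\<lambda>x::real^'n. indicator unit_cube x * cker 0 x)" by (rule integrable_cker)
    have i2: "integrable lborel (\<lambda>x::real^'n. indicator unit_cube x *\<^sub>R (?K * ?w (x + ivec k)))"
    proof (rule integrable_mult_indicator)
      show "integrable lborel (\<lambda>x::real^'n. ?K * ?w (x + ivec k))"
        using integrable_affine_iff[of 1 ?w "ivec k"] integrable_inverse_power_norm[where 'n = 'n]
        by (intro integrable_mult_right) auto
    qed simp
    \<comment> \<open>\<open>cker 0\<close> is the constant 1; it makes the volume of the cube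
      available through \<open>integral_cker\<close>.\<close>
    have "(\<integral>x. indicator unit_cube x * cker 0 x * ?w (ivec k) \<partial>(lborel :: (real^'n) measure)) \<le> (\<integral>x. indicator unit_cube x *\<^sub>R (?K * ?w (x + ivec k)) \<partial>lborel)"
    proof (rule integral_mono[OF integrable_mult_left[OF i1] i2])
      fix x :: "real^'n"
      show "indicator unit_cube x * cker 0 x * ?w (ivec k) \<le> indicator unit_cube x *\<^sub>R (?K * ?w (x + ivec k))"
      proof (cases "x \<in> unit_cube")
        case True
        have "(1 + norm (x + ivec k)) ^ ?M \<le> (1 + norm x) ^ ?M * (1 + norm (ivec k)) ^ ?M"
          by (rule one_add_norm_power_add_le)
        also have "\<dots> \<le> ?K * (1 + norm (ivec k)) ^ ?M"
          using norm_unit_cube_le[OF True] by (intro mult_right_mono power_mono) auto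
        finally show ?thesis using True by (simp add: cker_def divide_simps)
      qed simp
    qed
    also have "\<dots> = ?K * ?I k"
      by (simp only: real_scaleR_def mult.left_commute[of _ ?K] integral_mult_right_zero)
    finally have "?w (ivec k) \<le> ?K * ?I k"
      by (simp only: integral_mult_left_zero integral_cker) (simp add: cbin_def)
    also have "\<dots> \<le> ?K * norm (?I k)" by (intro mult_left_mono) auto
    finally show ?thesis .
  qed
  then show ?thesis
    by (intro summable_on_comparison_test[OF summable_on_cmult_right[OF s, of ?K]]) auto
qed

text \<open>Integrate F against the periodic kernel \<open>cker (Suc M)\<close>, with b its mean. In
  total this gives b times the integral of F, since the nonzero frequencies are annihilated; cube by
  cube it gives b F(k), up to the Lipschitz bound times the first absolute moment of the kernel.
  That moment is b times O(1 / sqrt M), so dividing by b and letting M grow proves the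
  identity.\<close>

theorem poisson_summation_bandlimited:
  fixes F :: "real^'n::finite \<Rightarrow> complex"
  assumes meas: "F \<in> borel_measurable borel"
    and decay: "\<And>x. cmod (F x) \<le> B / (1 + norm x) ^ (2 * CARD('n))"
    and lip: "\<And>k h. h \<in> unit_cube \<Longrightarrow> cmod (F (h + ivec k) - F (ivec k)) \<le> B * norm h / (1 + norm (ivec k)) ^ (2 * CARD('n))"
    and zero: "\<And>j. j \<noteq> 0 \<Longrightarrow> fourier F ((2 * pi) *\<^sub>R ivec j) = 0"
  shows "((\<lambda>k. F (ivec k)) has_sum (\<integral>x. F x \<partial>lborel)) UNIV"
proof -
  let ?w = "\<lambda>k::int^'n. 1 / (1 + norm (ivec k)) ^ (2 * CARD('n))"
  have int: "integrable lborel F" by (rule integrable_of_decay[OF meas decay])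
  have B: "B \<ge> 0" using order_trans[OF norm_ge_zero decay[of 0]] by simp
  have abs: "(\<lambda>k. cmod (F (ivec k))) summable_on UNIV"
    by (rule summable_on_comparison_test[OF summable_on_cmult_right[OF summable_inverse_power_ivec, of B]])
      (use decay in auto)
  have sum: "((\<lambda>k. F (ivec k)) has_sum (\<Sum>\<^sub>\<infinity>k. F (ivec k))) UNIV"
    by (rule has_sum_infsum[OF abs_summable_summable[OF abs]])
  define S where "S = (\<Sum>\<^sub>\<infinity>k. ?w k)"
  have bound: "cmod ((\<Sum>\<^sub>\<infinity>k. F (ivec k)) - (\<integral>x. F x \<partial>lborel)) \<le> B * S * (1 + real CARD('n)) * (1 / sqrt (real (Suc M)))" for M
  proof -
    define b where "b = cbin (Suc M) ^ CARD('n)"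
    have b: "b > 0" by (simp add: b_def cbin_pos)
    \<comment> \<open>Balances the two terms of |x| <= \<delta> + |x|^2 / \<delta>, the second
      moment of the kernel being at most n b / (M + 1).\<close>
    define \<delta> where "\<delta> = 1 / sqrt (real (Suc M))"
    have \<delta>: "\<delta> > 0" "\<delta>\<^sup>2 = 1 / real (Suc M)" by (simp_all add: \<delta>_def power_divide)
    let ?W = "\<lambda>x::real^'n. indicator unit_cube x * cker (Suc M) x"
    \<comment> \<open>First absolute moment of the kernel over the unit cube; the name hides the
      derivative \<open>D\<close> in this block.\<close>
    define D where "D = (\<integral>x. ?W x * norm x \<partial>(lborel :: (real^'n) measure))"
    have intW: "integrable lborel ?W" by (rule integrable_cker)
    have WN: "?W x * norm x \<le> \<delta> * ?W x + (1 / \<delta>) * (indicator unit_cube x * ((norm x)\<^sup>2 * cker (Suc M) x))" for x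
    proof -
      have "\<delta> * norm x \<le> \<delta>\<^sup>2 + (norm x)\<^sup>2"
      proof -
        have "0 \<le> (\<delta> - norm x)\<^sup>2" "0 \<le> \<delta>\<^sup>2" "0 \<le> (norm x)\<^sup>2" by auto
        then show ?thesis unfolding power2_diff by linarith
      qed
      then have "norm x \<le> \<delta> + (1 / \<delta>) * (norm x)\<^sup>2"
        using \<delta>(1) by (simp add: field_simps power2_eq_square)
      then have "?W x * norm x \<le> ?W x * (\<delta> + (1 / \<delta>) * (norm x)\<^sup>2)"
        by (intro mult_left_mono) (auto simp: cker_nonneg)
      then show ?thesis by (simp add: algebra_simps)
    qed
    have intWN: "integrable lborel (\<lambda>x. ?W x * norm x)"
    proof (rule Bochner_Integration.integrable_bound)
      show "integrable lborel (\<lambda>x::real^'n. \<delta> * ?W x + (1 / \<delta>) * (indicator unit_cube x * ((norm x)\<^sup>2 * cker (Suc M) x)))"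
        by (intro Bochner_Integration.integrable_add integrable_mult_right integrable_cker integrable_square_cker)
      show "AE x in lborel. norm (?W x * norm x) \<le> norm (\<delta> * ?W x + (1 / \<delta>) * (indicator unit_cube x * ((norm x)\<^sup>2 * cker (Suc M) x)))"
      proof (rule AE_I2)
        fix x :: "real^'n"
        have "0 \<le> ?W x * norm x" by (simp add: cker_nonneg)
        then have e: "norm (?W x * norm x) = ?W x * norm x" by (simp only: real_norm_def abs_of_nonneg)
        show "norm (?W x * norm x) \<le> norm (\<delta> * ?W x + (1 / \<delta>) * (indicator unit_cube x * ((norm x)\<^sup>2 * cker (Suc M) x)))"
          unfolding e by (subst real_norm_def) (rule order_trans[OF WN abs_ge_self])
      qed
    qed measurable
    have "D \<le> (\<integral>x. \<delta> * ?W x + (1 / \<delta>) * (indicator unit_cube x * ((norm x)\<^sup>2 * cker (Suc M) x)) \<partial>(lborel :: (real^'n) measure))"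
      unfolding D_def
      by (intro integral_mono intWN WN Bochner_Integration.integrable_add integrable_mult_right integrable_cker integrable_square_cker)
    also have "\<dots> = \<delta> * b + (1 / \<delta>) * (\<integral>x. indicator unit_cube x * ((norm x)\<^sup>2 * cker (Suc M) x) \<partial>(lborel :: (real^'n) measure))"
      by (subst Bochner_Integration.integral_add, intro integrable_mult_right integrable_cker, intro integrable_mult_right integrable_square_cker)
        (simp only: integral_mult_right_zero integral_cker b_def)
    also have "\<dots> \<le> \<delta> * b + (1 / \<delta>) * (real CARD('n) * b * \<delta>\<^sup>2)"
    proof -
      have "(\<integral>x. indicator unit_cube x * ((norm x)\<^sup>2 * cker (Suc M) x) \<partial>(lborel :: (real^'n) measure)) \<le> real CARD('n) * b / (2 * real M + 1)"
        unfolding b_def by (rule integral_square_cker)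
      also have "\<dots> \<le> real CARD('n) * b / real (Suc M)"
        using b by (intro divide_left_mono) auto
      finally show ?thesis using \<delta> by (intro add_left_mono mult_left_mono) auto
    qed
    also have "\<dots> = b * ((1 + real CARD('n)) * \<delta>)"
      using \<delta>(1) by (simp add: power2_eq_square algebra_simps)
    finally have D: "D \<le> b * ((1 + real CARD('n)) * \<delta>)" .
    have D0: "0 \<le> D" unfolding D_def by (intro Bochner_Integration.integral_nonneg) (auto simp: cker_nonneg)
    let ?G = "\<lambda>x. F x * of_real (cker (Suc M) x)"
    have intG: "integrable lborel ?G"
    proof (rule Bochner_Integration.integrable_bound[OF int])
      show "AE x in lborel. norm (?G x) \<le> norm (F x)"
        by (intro AE_I2) (simp add: norm_mult abs_of_nonneg[OF cker_nonneg] mult_right_le_one_le[OF _ cker_nonneg cker_le_1])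
      have [measurable]: "F \<in> borel_measurable borel" by (rule meas)
      show "?G \<in> borel_measurable lborel" by measurable
    qed
    let ?a = "\<lambda>k. \<integral>x. indicator unit_cube x *\<^sub>R ?G (x + ivec k) \<partial>lborel"
    have hs: "(?a has_sum (\<integral>x. ?G x \<partial>lborel)) UNIV"
      by (rule has_sum_integral_cubes(1)[OF intG])
    have n1: "cmod (of_real b * F (ivec k) - ?a k) \<le> B * D * ?w k" for k
    proof -
      have i1: "integrable lborel (\<lambda>x. indicator unit_cube x *\<^sub>R ?G (x + ivec k))"
        using integrable_affine_iff[of 1 ?G "ivec k"] intG
        by (intro integrable_mult_indicator) auto
      have i2: "integrable lborel (\<lambda>x. complex_of_real (?W x) * F (ivec k))"
        by (intro integrable_mult_left integrable_of_real intW)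
      have "of_real b * F (ivec k) - ?a k = (\<integral>x. complex_of_real (?W x) * F (ivec k) \<partial>lborel) - ?a k"
        unfolding b_def by (simp only: integral_mult_left_zero integral_complex_of_real integral_cker)
      also have "\<dots> = (\<integral>x. complex_of_real (?W x) * F (ivec k) - indicator unit_cube x *\<^sub>R ?G (x + ivec k) \<partial>lborel)"
        by (rule Bochner_Integration.integral_diff[OF i2 i1, symmetric])
      also have "cmod \<dots> \<le> (\<integral>x. (B * ?w k) * (?W x * norm x) \<partial>lborel)"
      proof (rule cmod_integral_le)
        show "integrable lborel (\<lambda>x. (B * ?w k) * (?W x * norm x))"
          by (intro integrable_mult_right intWN)
        fix x
        show "cmod (complex_of_real (?W x) * F (ivec k) - indicator unit_cube x *\<^sub>R ?G (x + ivec k)) \<le> (B * ?w k) * (?W x * norm x)"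
        proof (cases "x \<in> unit_cube")
          case True
          have "complex_of_real (?W x) * F (ivec k) - indicator unit_cube x *\<^sub>R ?G (x + ivec k)
             = of_real (cker (Suc M) x) * (F (ivec k) - F (x + ivec k))"
            using True by (simp add: cker_periodic algebra_simps)
          also have "cmod \<dots> = cker (Suc M) x * cmod (F (x + ivec k) - F (ivec k))"
            by (simp add: norm_mult cker_nonneg norm_minus_commute)
          also have "\<dots> \<le> cker (Suc M) x * (B * norm x / (1 + norm (ivec k)) ^ (2 * CARD('n)))"
            by (intro mult_left_mono lip True cker_nonneg)
          finally show ?thesis using True by (simp add: mult_ac)
        qed simp
      qed
      also have "\<dots> = B * D * ?w k"
        unfolding integral_mult_right_zero D_def[symmetric] by (simp only: mult_ac)
      finally show ?thesis .
    qed
    have n2: "((\<lambda>k. of_real b * F (ivec k) - ?a k) has_sum of_real b * (\<Sum>\<^sub>\<infinity>k. F (ivec k)) - (\<integral>x. ?G x \<partial>lborel)) UNIV"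
      by (intro has_sum_diff has_sum_cmult_right sum hs)
    have n3: "((\<lambda>k. B * D * ?w k) has_sum B * D * S) UNIV"
      unfolding S_def by (intro has_sum_cmult_right has_sum_infsum summable_inverse_power_ivec)
    have "cmod (of_real b * (\<Sum>\<^sub>\<infinity>k. F (ivec k)) - (\<integral>x. ?G x \<partial>lborel)) \<le> B * D * S"
      by (rule norm_has_sum_le[OF n2 n3 n1])
    also have "(\<integral>x. ?G x \<partial>lborel) = of_real b * (\<integral>x. F x \<partial>lborel)"
      unfolding b_def by (rule integral_times_cker[OF int zero])
    finally have "b * cmod ((\<Sum>\<^sub>\<infinity>k. F (ivec k)) - (\<integral>x. F x \<partial>lborel)) \<le> B * D * S"
      using b by (simp add: right_diff_distrib[symmetric] norm_mult)
    also have "\<dots> \<le> B * (b * ((1 + real CARD('n)) * \<delta>)) * S"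
      using B D by (intro mult_right_mono mult_left_mono) (auto simp: S_def intro!: infsum_nonneg)
    also have "\<dots> = b * (B * S * (1 + real CARD('n)) * \<delta>)" by (simp only: mult_ac)
    finally show ?thesis using b by (simp only: mult_le_cancel_left_pos \<delta>_def)
  qed
  have "(\<lambda>M. B * S * (1 + real CARD('n)) * (1 / sqrt (real (Suc M)))) \<longlonglongrightarrow> B * S * (1 + real CARD('n)) * 0"
  proof (intro tendsto_mult tendsto_const)
    have "filterlim (\<lambda>M. sqrt (real (Suc M))) at_top sequentially"
      by (intro filterlim_compose[OF sqrt_at_top] filterlim_compose[OF filterlim_real_sequentially filterlim_Suc])
    then show "(\<lambda>M. 1 / sqrt (real (Suc M))) \<longlonglongrightarrow> 0"
      using tendsto_inverse_0_at_top by (simp add: inverse_eq_divide)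
  qed
  then have "cmod ((\<Sum>\<^sub>\<infinity>k. F (ivec k)) - (\<integral>x. F x \<partial>lborel)) \<le> 0"
    using bound by (intro LIMSEQ_le_const) auto
  then show ?thesis using sum by simp
qed

lemma norm_ivec_ge_1:
  assumes "j \<noteq> 0"
  shows "1 \<le> norm (ivec j)"
proof -
  obtain i where "j $ i \<noteq> 0" using assms by (auto simp: vec_eq_iff)
  then have "1 \<le> \<bar>ivec j $ i\<bar>" by simp
  then show ?thesis using component_le_norm_cart[of "ivec j" i] by linarith
qed

text \<open>Poisson summation for F(y) = G(y) \<theta>(x - y). Its transform at a nonzero dual
  lattice point \<eta> is the value at x of an average of \<theta> against G times a character. The
  transform of this average at \<xi> is the product of those of \<theta> at \<xi> and of G at \<xi>
  + \<eta>; as |\<eta>| >= 2 pi, one of the two points has norm at least pi. So the average vanishes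
  identically, by injectivity of the transform.\<close>

theorem sampling:
  fixes G \<theta> :: "real^'n::finite \<Rightarrow> complex"
  assumes "G \<in> schwartz" "\<theta> \<in> schwartz"
    and supp: "\<And>\<xi>. pi \<le> norm \<xi> \<Longrightarrow> fourier G \<xi> = 0" "\<And>\<xi>. pi \<le> norm \<xi> \<Longrightarrow> fourier \<theta> \<xi> = 0"
  shows "((\<lambda>k. G (ivec k) * \<theta> (x - ivec k)) has_sum smear G \<theta> (-1) x) UNIV"
proof -
  let ?M = "2 * CARD('n)"
  let ?n = "real CARD('n)"
  define F where "F y = G y * \<theta> (x - y)" for y
  have [measurable]: "G \<in> borel_measurable borel" "\<theta> \<in> borel_measurable borel"
    using assms by (auto intro: schwartz_measurable)
  have meas: "F \<in> borel_measurable borel" unfolding F_def by measurable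
  obtain g where g: "g \<ge> 0" "\<And>y. cmod (G y) \<le> g / (1 + norm y) ^ ?M"
    using schwartz_decay0[OF assms(1)] by blast
  obtain t where t: "t \<ge> 0" "\<And>y. cmod (\<theta> y) \<le> t" using schwartz_bounded[OF assms(2)] by blast
  obtain g' where g': "g' \<ge> 0" "\<And>y h. cmod (G (y + h) - G y) \<le> g' * norm h * (1 + norm h) ^ ?M / (1 + norm y) ^ ?M"
    using schwartz_taylor_remainder[OF assms(1), of "Suc 0" ?M] by (auto simp: taylor_sum_1)
  obtain t' where t': "t' \<ge> 0" "\<And>y h. cmod (\<theta> (y + h) - \<theta> y) \<le> t' * norm h"
    using schwartz_taylor_remainder[OF assms(2), of "Suc 0" 0] by (auto simp: taylor_sum_1)
  define K where "K = (1 + ?n) ^ ?M"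
  have K: "K \<ge> 0" by (simp add: K_def)
  \<comment> \<open>One constant for both hypotheses: g t is the decay of F, and the other two terms
    come from varying \<theta> and then G across a unit cube.\<close>
  define B where "B = g * t + K * g * t' + g' * K * t"
  have "((\<lambda>k. F (ivec k)) has_sum (\<integral>y. F y \<partial>lborel)) UNIV"
  proof (rule poisson_summation_bandlimited[OF meas])
    show "cmod (F y) \<le> B / (1 + norm y) ^ ?M" for y
    proof -
      have "cmod (F y) \<le> g / (1 + norm y) ^ ?M * t"
        unfolding F_def norm_mult using g t by (intro mult_mono) auto
      also have "\<dots> \<le> B / (1 + norm y) ^ ?M"
        unfolding times_divide_eq_left B_def using g t g' t' K
        by (intro divide_right_mono) (auto intro!: add_nonneg_nonneg)
      finally show ?thesis .
    qed
    show "cmod (F (h + ivec k) - F (ivec k)) \<le> B * norm h / (1 + norm (ivec k)) ^ ?M" if "h \<in> unit_cube" for k h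
    proof -
      let ?k = "ivec k"
      let ?W = "(1 + norm ?k) ^ ?M"
      have hn: "(1 + norm h) ^ ?M \<le> K"
        unfolding K_def using norm_unit_cube_le[OF that] by (intro power_mono) auto
      have "?W \<le> (1 + norm (h + ?k)) ^ ?M * (1 + norm (- h)) ^ ?M"
        using one_add_norm_power_add_le[of "h + ?k" "- h" ?M] by simp
      also have "\<dots> \<le> (1 + norm (h + ?k)) ^ ?M * K" using hn by (intro mult_left_mono) auto
      finally have "g * ?W \<le> g * ((1 + norm (h + ?k)) ^ ?M * K)" using g(1) by (intro mult_left_mono) auto
      then have "g / (1 + norm (h + ?k)) ^ ?M \<le> K * g / ?W" by (simp add: divide_simps mult_ac)
      then have 1: "cmod (G (h + ?k)) \<le> K * g / ?W" using g(2)[of "h + ?k"] by linarith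
      have 2: "cmod (\<theta> (x - ?k - h) - \<theta> (x - ?k)) \<le> t' * norm h"
        using t'(2)[of "x - ?k" "- h"] by simp
      have "cmod (G (?k + h) - G ?k) \<le> g' * norm h * (1 + norm h) ^ ?M / ?W" by (rule g'(2))
      also have "\<dots> \<le> g' * norm h * K / ?W"
        using g'(1) hn by (intro divide_right_mono mult_left_mono) auto
      finally have 3: "cmod (G (?k + h) - G ?k) \<le> g' * norm h * K / ?W" .
      have "F (h + ?k) - F ?k = G (h + ?k) * (\<theta> (x - ?k - h) - \<theta> (x - ?k)) + (G (?k + h) - G ?k) * \<theta> (x - ?k)"
        by (simp add: F_def algebra_simps)
      also have "cmod \<dots> \<le> K * g / ?W * (t' * norm h) + g' * norm h * K / ?W * t"
        by (rule order_trans[OF norm_triangle_ineq], unfold norm_mult, intro add_mono mult_mono 1 2 3 t)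
          (use g g' t K in auto)
      also have "\<dots> = (K * g * t' + g' * K * t) * norm h / ?W"
        by (simp add: add_divide_distrib algebra_simps)
      also have "\<dots> \<le> B * norm h / ?W"
        unfolding B_def using g t by (intro divide_right_mono mult_right_mono) auto
      finally show ?thesis .
    qed
    show "fourier F ((2 * pi) *\<^sub>R ivec j) = 0" if "j \<noteq> 0" for j
    proof -
      let ?\<eta> = "(2 * pi) *\<^sub>R ivec j"
      let ?u = "\<lambda>y. exp (- \<i> * of_real (y \<bullet> ?\<eta>)) * G y"
      have u: "rapid ?u" by (rule rapid_mult_bounded[OF schwartz_rapid[OF assms(1)], where K = 1]) auto
      have fG: "fourier ?u \<zeta> = fourier G (\<zeta> + ?\<eta>)" for \<zeta>
        unfolding fourier_def by (intro Bochner_Integration.integral_cong refl)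
          (simp add: exp_add[symmetric] inner_add_right algebra_simps)
      have fu: "fourier (smear ?u \<theta> (-1)) \<xi> = fourier \<theta> \<xi> * fourier G (\<xi> + ?\<eta>)" for \<xi>
        unfolding fourier_smear[OF u assms(2)] fG by simp
      have "fourier \<theta> \<xi> * fourier G (\<xi> + ?\<eta>) = 0" for \<xi>
      proof (cases "pi \<le> norm \<xi>")
        case False
        have "2 * pi \<le> norm ?\<eta>" using norm_ivec_ge_1[OF that] by simp
        also have "\<dots> \<le> norm (\<xi> + ?\<eta>) + norm \<xi>"
          using norm_triangle_ineq[of "\<xi> + ?\<eta>" "- \<xi>"] by simp
        finally have "pi \<le> norm (\<xi> + ?\<eta>)" using False by linarith
        then show ?thesis using supp by simp
      qed (use supp in simp)
      then have "smear ?u \<theta> (-1) = (\<lambda>x. 0)"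
        using fu by (intro fourier_inj schwartz_smear u assms schwartz_zero) (simp add: fourier_def)
      then have "smear ?u \<theta> (-1) x = 0" by simp
      then show ?thesis by (simp add: smear_def fourier_def F_def mult.assoc)
    qed
  qed
  then show ?thesis by (simp add: F_def smear_def)
qed

section \<open>Tempered distributions\<close>

lemma antidual_add: "u \<in> antidual V \<Longrightarrow> \<phi> \<in> V \<Longrightarrow> \<theta> \<in> V \<Longrightarrow> u (\<lambda>x. \<phi> x + \<theta> x) = u \<phi> + u \<theta>"
  by (simp add: antidual_def)

lemma antidual_cmult: "u \<in> antidual V \<Longrightarrow> \<phi> \<in> V \<Longrightarrow> u (\<lambda>x. a * \<phi> x) = cnj a * u \<phi>"
  by (simp add: antidual_def)

lemma antidual_diff:
  assumes "f \<in> tempered" "\<phi> \<in> schwartz" "\<theta> \<in> schwartz"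
  shows "f (\<lambda>x. \<phi> x - \<theta> x) = f \<phi> - f \<theta>"
  using antidual_add[OF assms(1,2) schwartz_cmult'[OF assms(3), of "-1"]] antidual_cmult[OF assms(1,3), of "-1"]
  by simp

lemma antidual_sum:
  assumes "f \<in> tempered" "finite A" "\<And>k. k \<in> A \<Longrightarrow> u k \<in> schwartz"
  shows "f (\<lambda>x. \<Sum>k\<in>A. u k x) = (\<Sum>k\<in>A. f (u k))"
  using assms(2,3)
proof (induction A rule: finite_induct)
  case empty
  show ?case using antidual_cmult[OF assms(1) schwartz_zero, of 0] by simp
next
  case (insert k A)
  then show ?case
    by (simp add: antidual_add[OF assms(1)] schwartz_sum')
qed

lemma tempered_bound:
  assumes "f \<in> tempered"
  obtains d c where "c \<ge> 0" "\<And>\<omega>. \<omega> \<in> schwartz \<Longrightarrow> cmod (f \<omega>) \<le> c * schwartz_norm d \<omega>"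
proof -
  obtain d c where *: "\<And>\<omega>. \<omega> \<in> schwartz \<Longrightarrow> cmod (f \<omega>) \<le> c * schwartz_norm d \<omega>"
    using assms unfolding antidual_def by blast
  have "cmod (f \<omega>) \<le> max 0 c * schwartz_norm d \<omega>" if "\<omega> \<in> schwartz" for \<omega>
    using *[OF that] mult_right_mono[of c "max 0 c" "schwartz_norm d \<omega>"] schwartz_norm_nonneg[OF that, of d] by linarith
  then show thesis using that[of "max 0 c" d] by simp
qed

lemma temperedI:
  assumes "\<And>\<phi> \<theta>. \<phi> \<in> schwartz \<Longrightarrow> \<theta> \<in> schwartz \<Longrightarrow> u (\<lambda>x. \<phi> x + \<theta> x) = u \<phi> + u \<theta>"
    and "\<And>a \<phi>. \<phi> \<in> schwartz \<Longrightarrow> u (\<lambda>x. a * \<phi> x) = cnj a * u \<phi>"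
    and "\<And>\<phi>. \<phi> \<in> schwartz \<Longrightarrow> cmod (u \<phi>) \<le> c * schwartz_norm d \<phi>"
  shows "restrict u schwartz \<in> tempered"
  unfolding antidual_def mem_Collect_eq
proof (intro conjI ballI allI exI)
  fix \<phi> \<theta> :: "real^'a \<Rightarrow> complex" and a
  assume "\<phi> \<in> schwartz"
  then show "restrict u schwartz (\<lambda>x. a * \<phi> x) = cnj a * restrict u schwartz \<phi>"
    using assms(2) by (simp add: schwartz_cmult')
  show "cmod (restrict u schwartz \<phi>) \<le> c * schwartz_norm d \<phi>"
    using assms(3) \<open>\<phi> \<in> schwartz\<close> by simp
  assume "\<theta> \<in> schwartz"
  with \<open>\<phi> \<in> schwartz\<close> show "restrict u schwartz (\<lambda>x. \<phi> x + \<theta> x) = restrict u schwartz \<phi> + restrict u schwartz \<theta>"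
    using assms(1) by (simp add: schwartz_add')
qed simp

lemma schwartz_norm_mono:
  fixes f :: "real^'a::finite \<Rightarrow> complex"
  assumes "f \<in> schwartz" "d \<le> e"
  shows "schwartz_norm d f \<le> schwartz_norm e f"
proof (rule schwartz_norm_le[OF assms(1)])
  fix "is" :: "'a list" and x :: "real^'a"
  assume l: "length is \<le> d"
  have "(1 + norm x) ^ d * cmod (D is f x) \<le> (1 + norm x) ^ e * cmod (D is f x)"
    by (intro mult_right_mono one_add_norm_power_mono assms) auto
  also have "\<dots> \<le> schwartz_norm e f" using l assms by (intro schwartz_norm_bound) auto
  finally show "(1 + norm x) ^ d * cmod (D is f x) \<le> schwartz_norm e f" .
qed

lemma tempered_diff:
  assumes "f \<in> tempered" "g \<in> tempered"
  shows "(\<lambda>\<omega>\<in>schwartz. f \<omega> - g \<omega>) \<in> tempered"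
proof -
  obtain c d where f: "c \<ge> 0" "\<And>\<omega>. \<omega> \<in> schwartz \<Longrightarrow> cmod (f \<omega>) \<le> c * schwartz_norm d \<omega>"
    by (rule tempered_bound[OF assms(1)]) blast
  obtain c' d' where g: "c' \<ge> 0" "\<And>\<omega>. \<omega> \<in> schwartz \<Longrightarrow> cmod (g \<omega>) \<le> c' * schwartz_norm d' \<omega>"
    by (rule tempered_bound[OF assms(2)]) blast
  show ?thesis
  proof (rule temperedI[where d = "max d d'" and c = "c + c'"])
    fix \<phi> :: "real^'a \<Rightarrow> complex" assume \<phi>: "\<phi> \<in> schwartz"
    have "c * schwartz_norm d \<phi> \<le> c * schwartz_norm (max d d') \<phi>" "c' * schwartz_norm d' \<phi> \<le> c' * schwartz_norm (max d d') \<phi>"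
      using f(1) g(1) by (intro mult_left_mono schwartz_norm_mono \<phi>; simp)+
    then show "cmod (f \<phi> - g \<phi>) \<le> (c + c') * schwartz_norm (max d d') \<phi>"
      using f(2)[OF \<phi>] g(2)[OF \<phi>] norm_triangle_ineq4[of "f \<phi>" "g \<phi>"] unfolding distrib_right by linarith
  qed (auto simp: antidual_add[OF assms(1)] antidual_add[OF assms(2)] antidual_cmult[OF assms(1)] antidual_cmult[OF assms(2)] right_diff_distrib)
qed

lemma smear_add:
  assumes "rapid u" "v \<in> schwartz" "w \<in> schwartz"
  shows "smear u (\<lambda>x. v x + w x) s = (\<lambda>y. smear u v s y + smear u w s y)"
  unfolding smear_def distrib_left using integrable_smear[OF assms(1,2)] integrable_smear[OF assms(1,3)] by simp

lemma smear_cmult: "smear u (\<lambda>x. a * w x) s = (\<lambda>y. a * smear u w s y)"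
  unfolding smear_def by (simp add: mult.left_commute)

lemma tempered_smear:
  assumes "f \<in> tempered" "rapid u"
  shows "(\<lambda>\<omega>\<in>schwartz. f (smear u \<omega> s)) \<in> tempered"
proof -
  obtain c d where f: "c \<ge> 0" "\<And>\<omega>. \<omega> \<in> schwartz \<Longrightarrow> cmod (f \<omega>) \<le> c * schwartz_norm d \<omega>"
    by (rule tempered_bound[OF assms(1)]) blast
  show ?thesis
  proof (rule temperedI)
    fix \<phi> :: "real^'a \<Rightarrow> complex" assume \<phi>: "\<phi> \<in> schwartz"
    have "cmod (f (smear u \<phi> s)) \<le> c * schwartz_norm d (smear u \<phi> s)"
      by (intro f schwartz_smear assms \<phi>)
    also have "\<dots> \<le> c * (moment u d * (1 + \<bar>s\<bar>) ^ d * schwartz_norm d \<phi>)"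
      by (intro mult_left_mono schwartz_norm_smear_le assms \<phi> f)
    finally show "cmod (f (smear u \<phi> s)) \<le> (c * moment u d * (1 + \<bar>s\<bar>) ^ d) * schwartz_norm d \<phi>"
      by (simp only: mult.assoc)
  qed (simp_all add: smear_add assms smear_cmult antidual_add[OF assms(1)] antidual_cmult[OF assms(1)] schwartz_smear)
qed

lemma finite_lists_le: "finite {is :: 'n::finite list. length is \<le> d}"
  using finite_lists_length_le[of "UNIV :: 'n set" d] by simp

lemma schwartz_norm_le_sum:
  fixes f :: "real^'n::finite \<Rightarrow> complex"
  assumes "f \<in> schwartz" "\<And>is. C is \<ge> 0" "r \<ge> 0"
    "\<And>is x. length is \<le> d \<Longrightarrow> (1 + norm x) ^ d * cmod (D is f x) \<le> C is * r"
  shows "schwartz_norm d f \<le> (\<Sum>is | length is \<le> d. C is) * r"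
proof (rule schwartz_norm_le[OF assms(1)])
  fix "is" :: "'n list" and x :: "real^'n"
  assume l: "length is \<le> d"
  then have "C is \<le> (\<Sum>is | length is \<le> d. C is)"
    by (intro member_le_sum finite_lists_le assms) auto
  then have "C is * r \<le> (\<Sum>is | length is \<le> d. C is) * r" using assms(3) by (rule mult_right_mono)
  with assms(4)[OF l, of x] show "(1 + norm x) ^ d * cmod (D is f x) \<le> (\<Sum>is | length is \<le> d. C is) * r" by linarith
qed

text \<open>As u has integral one, \<omega>(y) can be taken under the integral, and a first-order
  Taylor remainder gives a rate linear in s; the weights in z are collected in a moment of order d +
  1.\<close>

lemma schwartz_norm_smear_minus_le:
  fixes u \<omega> :: "real^'n::finite \<Rightarrow> complex"
  assumes "rapid u" "(\<integral>z. u z \<partial>lborel) = 1" "\<omega> \<in> schwartz"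
  obtains C where "\<And>s. 0 \<le> s \<Longrightarrow> s \<le> 1 \<Longrightarrow> schwartz_norm d (\<lambda>x. smear u \<omega> s x - \<omega> x) \<le> C * s"
proof -
  have "\<exists>B\<ge>0. \<forall>y h. cmod (D is \<omega> (y + h) - D is \<omega> y) \<le> B * norm h * (1 + norm h) ^ d / (1 + norm y) ^ d" for "is"
    using schwartz_taylor_remainder[OF schwartz_D[OF assms(3), of "is"], of "Suc 0" d] unfolding taylor_sum_1 power_Suc power_0 mult_1_right by metis
  then obtain B where B: "\<And>is. B is \<ge> 0"
    "\<And>is y h. cmod (D is \<omega> (y + h) - D is \<omega> y) \<le> B is * norm h * (1 + norm h) ^ d / (1 + norm y) ^ d"
    by metis
  show thesis
  proof (rule that)
    fix s :: real assume s: "0 \<le> s" "s \<le> 1"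
    show "schwartz_norm d (\<lambda>x. smear u \<omega> s x - \<omega> x) \<le> (\<Sum>is | length is \<le> d. moment u (Suc d) * B is) * s"
    proof (rule schwartz_norm_le_sum)
      show "(\<lambda>x. smear u \<omega> s x - \<omega> x) \<in> schwartz"
        by (intro schwartz_diff' schwartz_smear assms)
      show "0 \<le> moment u (Suc d) * B is" for "is" by (intro mult_nonneg_nonneg moment_nonneg B)
      fix "is" :: "'n list" and y
      have "D is (\<lambda>x. smear u \<omega> s x - \<omega> x) y = smear u (D is \<omega>) s y - D is \<omega> y"
        by (simp add: D_diff[OF schwartz_smear[OF assms(1,3)] assms(3)] D_smear[OF assms(1,3)])
      also have "\<dots> = (\<integral>z. u z * D is \<omega> (y + s *\<^sub>R z) \<partial>lborel) - (\<integral>z. u z * D is \<omega> y \<partial>lborel)"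
        by (simp add: smear_def assms(2))
      also have "\<dots> = (\<integral>z. u z * D is \<omega> (y + s *\<^sub>R z) - u z * D is \<omega> y \<partial>lborel)"
        by (rule Bochner_Integration.integral_diff[symmetric])
          (intro integrable_smear assms schwartz_D integrable_mult_left integrable_rapid)+
      also have "cmod \<dots> \<le> (\<integral>z. cmod (u z) * (1 + norm z) ^ Suc d * (B is * s / (1 + norm y) ^ d) \<partial>lborel)"
      proof (rule cmod_integral_le)
        show "integrable lborel (\<lambda>z. cmod (u z) * (1 + norm z) ^ Suc d * (B is * s / (1 + norm y) ^ d))"
          by (intro integrable_mult_left integrable_rapid_weight assms)
        fix z
        have "cmod (D is \<omega> (y + s *\<^sub>R z) - D is \<omega> y) \<le> B is * norm (s *\<^sub>R z) * (1 + norm (s *\<^sub>R z)) ^ d / (1 + norm y) ^ d" by (rule B)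
        also have "\<dots> \<le> B is * (s * (1 + norm z)) * (1 + norm z) ^ d / (1 + norm y) ^ d"
          using s B(1)[of "is"]
          by (intro divide_right_mono mult_mono mult_left_mono power_mono)
            (auto intro: mult_left_le_one_le mult_left_mono)
        finally have "cmod (u z) * cmod (D is \<omega> (y + s *\<^sub>R z) - D is \<omega> y) \<le> cmod (u z) * (B is * (s * (1 + norm z)) * (1 + norm z) ^ d / (1 + norm y) ^ d)"
          by (intro mult_left_mono) auto
        then show "cmod (u z * D is \<omega> (y + s *\<^sub>R z) - u z * D is \<omega> y) \<le> cmod (u z) * (1 + norm z) ^ Suc d * (B is * s / (1 + norm y) ^ d)"
          by (simp add: right_diff_distrib[symmetric] norm_mult mult_ac)
      qed
      also have "\<dots> = moment u (Suc d) * (B is * s / (1 + norm y) ^ d)"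
        unfolding moment_def by (rule integral_mult_left_zero)
      finally show "(1 + norm y) ^ d * cmod (D is (\<lambda>x. smear u \<omega> s x - \<omega> x) y) \<le> moment u (Suc d) * B is * s"
        by (simp add: pos_le_divide_eq mult_ac)
    qed (use s in auto)
  qed
qed

text \<open>The limit E is given in advance and identified by pointwise convergence of all
  derivatives. At each point the error of a finite partial sum is the sum over the complementary
  indices, which the tail of the summable majorant b dominates uniformly; hence the seminorm of the
  error is dominated as well.\<close>

lemma tempered_has_sum:
  fixes u :: "'i \<Rightarrow> real^'n::finite \<Rightarrow> complex"
  assumes f: "f \<in> tempered" and u: "\<And>k. u k \<in> schwartz" and E: "E \<in> schwartz"
    and pw: "\<And>is x. ((\<lambda>k. D is (u k) x) has_sum D is E x) UNIV"
    and sm: "\<And>d. \<exists>b. b summable_on UNIV \<and> (\<forall>k. schwartz_norm d (u k) \<le> b k)"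
  shows "((\<lambda>k. f (u k)) has_sum f E) UNIV"
proof -
  obtain c d where c: "c \<ge> 0" "\<And>\<omega>. \<omega> \<in> schwartz \<Longrightarrow> cmod (f \<omega>) \<le> c * schwartz_norm d \<omega>"
    by (rule tempered_bound[OF f]) blast
  obtain b where b: "b summable_on UNIV" "\<And>k. schwartz_norm d (u k) \<le> b k" using sm by blast
  have bh: "(b has_sum infsum b UNIV) UNIV" using b(1) by (rule has_sum_infsum)
  have bnd: "cmod ((\<Sum>k\<in>A. f (u k)) - f E) \<le> c * (infsum b UNIV - sum b A)" if A: "finite A" for A
  proof -
    let ?v = "\<lambda>x. (\<Sum>k\<in>A. u k x) - E x"
    have v: "?v \<in> schwartz" by (intro schwartz_diff' schwartz_sum' A u E)
    have "(\<Sum>k\<in>A. f (u k)) - f E = f ?v"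
      by (subst antidual_diff[OF f schwartz_sum'[OF A u] E]) (simp add: antidual_sum[OF f A u])
    also have "cmod \<dots> \<le> c * schwartz_norm d ?v" by (rule c(2)[OF v])
    also have "\<dots> \<le> c * (infsum b UNIV - sum b A)"
    proof (intro mult_left_mono schwartz_norm_le v c(1))
      fix "is" :: "'n list" and x :: "real^'n" assume l: "length is \<le> d"
      let ?w = "(1 + norm x) ^ d"
      have "D is ?v x = (\<Sum>k\<in>A. D is (u k) x) - D is E x"
        by (subst D_diff[OF schwartz_sum'[OF A u] E]) (simp add: D_sum[OF A u])
      also have "cmod \<dots> = cmod (D is E x - (\<Sum>k\<in>A. D is (u k) x))" by (rule norm_minus_commute)
      also have "?w * \<dots> \<le> infsum b UNIV - sum b A"
      proof -
        have wn: "cmod (of_real ?w) = ?w" by (simp only: norm_of_real abs_of_nonneg[OF one_add_norm_power_pos(2)])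
        have "((\<lambda>k. D is (u k) x) has_sum (D is E x - (\<Sum>k\<in>A. D is (u k) x))) (UNIV - A)"
          by (intro has_sum_Diff pw has_sum_finite A) auto
        then have "((\<lambda>k. of_real ?w * D is (u k) x) has_sum of_real ?w * (D is E x - (\<Sum>k\<in>A. D is (u k) x))) (UNIV - A)"
          by (rule has_sum_cmult_right)
        moreover have "(b has_sum (infsum b UNIV - sum b A)) (UNIV - A)"
          by (intro has_sum_Diff bh has_sum_finite A) auto
        moreover have "cmod (of_real ?w * D is (u k) x) \<le> b k" for k
        proof -
          have "cmod (of_real ?w * D is (u k) x) = ?w * cmod (D is (u k) x)" by (simp only: norm_mult wn)
          also have "\<dots> \<le> schwartz_norm d (u k)" by (intro schwartz_norm_bound u l)
          finally show ?thesis using b(2)[of k] by linarith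
        qed
        ultimately have "cmod (of_real ?w * (D is E x - (\<Sum>k\<in>A. D is (u k) x))) \<le> infsum b UNIV - sum b A"
          by (rule norm_has_sum_le)
        then show ?thesis by (simp only: norm_mult wn)
      qed
      finally show "?w * cmod (D is ?v x) \<le> infsum b UNIV - sum b A" .
    qed
    finally show ?thesis .
  qed
  have "(sum b \<longlongrightarrow> infsum b UNIV) (finite_subsets_at_top UNIV)" using bh by (simp only: has_sum_def)
  then have "((\<lambda>A. c * (infsum b UNIV - sum b A)) \<longlongrightarrow> c * (infsum b UNIV - infsum b UNIV)) (finite_subsets_at_top UNIV)"
    by (intro tendsto_intros)
  then have lim: "((\<lambda>A. c * (infsum b UNIV - sum b A)) \<longlongrightarrow> 0) (finite_subsets_at_top UNIV)" by simp
  have "((\<lambda>A. (\<Sum>k\<in>A. f (u k)) - f E) \<longlongrightarrow> 0) (finite_subsets_at_top UNIV)"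
    by (rule Lim_null_comparison[OF _ lim])
      (use bnd in \<open>auto intro!: eventually_finite_subsets_at_top_weakI\<close>)
  then show ?thesis unfolding has_sum_def by (rule LIM_zero_cancel)
qed

section \<open>The low-frequency function\<close>

lemma partial_deriv_local:
  fixes f g :: "real^'n::finite \<Rightarrow> complex"
  assumes "open U" "x \<in> U" "\<And>y. y \<in> U \<Longrightarrow> g y = f y" "f differentiable (at x)"
  shows "g differentiable (at x)" "partial_deriv i g x = partial_deriv i f x"
proof -
  obtain f' where f': "(f has_derivative f') (at x)" using assms(4) by (auto simp: differentiable_def)
  have "(g has_derivative f') (at x)"
    by (rule has_derivative_transform_within_open[OF f' assms(1,2)]) (simp add: assms(3))
  then show "g differentiable (at x)" "partial_deriv i g x = partial_deriv i f x"
    using partial_deriv_eq_apply[OF f'] partial_deriv_eq_apply by (auto simp: differentiable_def)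
qed

lemma smooth_differentiable: "smooth g \<Longrightarrow> g differentiable (at x)"
  unfolding smooth_def by (metis foldr_Nil id_apply)

lemma smooth_partial_deriv: "smooth g \<Longrightarrow> smooth (partial_deriv i g)"
  using smooth_D[of g "[i]"] by simp

lemma smooth_const_minus_schwartz:
  fixes w :: "real^'n::finite \<Rightarrow> complex"
  assumes "w \<in> schwartz"
  shows "smooth (\<lambda>x. c - w x)"
  unfolding smooth_def
proof (intro allI)
  fix "is" :: "'n list" and x :: "real^'n"
  have d: "((\<lambda>x. c - w x) has_derivative (\<lambda>h. \<Sum>i\<in>UNIV. of_real (h $ i) * (- 1 * partial_deriv i w x))) (at x)" for x
    using has_derivative_diff[OF has_derivative_const[of c] schwartz_has_derivative[OF assms, of x]]
    by (simp add: sum_negf)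
  have pd: "partial_deriv i (\<lambda>x. c - w x) = (\<lambda>x. - 1 * partial_deriv i w x)" for i
    by (rule ext) (rule partial_deriv_eq_coeff[OF d])
  show "D is (\<lambda>x. c - w x) differentiable (at x)"
  proof (cases "is" rule: rev_cases)
    case Nil
    then show ?thesis using d by (auto simp: differentiable_def)
  next
    case (snoc js i)
    have "(\<lambda>x. - 1 * partial_deriv i w x) \<in> schwartz"
      by (intro schwartz_cmult' schwartz_partial_deriv assms)
    from schwartz_differentiable[OF schwartz_D[OF this]] show ?thesis
      unfolding snoc foldr_append by (simp only: foldr.simps comp_apply pd id_apply)
  qed
qed

text \<open>As r < R, the ball of radius R and the exterior of radius r are open and cover the
  space. On one of them h is a smooth function, on the other it is zero, and both properties pass to
  derivatives.\<close>

lemma schwartz_of_compact_support: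
  fixes h g :: "real^'n::finite \<Rightarrow> complex"
  assumes "r < R" "smooth g" "\<And>\<xi>. norm \<xi> < R \<Longrightarrow> h \<xi> = g \<xi>" "\<And>\<xi>. r < norm \<xi> \<Longrightarrow> h \<xi> = 0"
  shows "h \<in> schwartz"
proof -
  let ?X = "{h. \<exists>g. smooth g \<and> (\<forall>\<xi>::real^'n. norm \<xi> < R \<longrightarrow> h \<xi> = g \<xi>) \<and> (\<forall>\<xi>. r < norm \<xi> \<longrightarrow> h \<xi> = 0)}"
  have o1: "open {\<xi>::real^'n. norm \<xi> < R}" by (intro open_Collect_less continuous_intros)
  have o2: "open {\<xi>::real^'n. r < norm \<xi>}" by (intro open_Collect_less continuous_intros)
  have z: "partial_deriv i (\<lambda>x. 0) x = 0" for i and x :: "real^'n" by (simp add: partial_deriv_def)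
  have "h \<in> ?X" using assms by blast
  then show ?thesis
  proof (induct rule: schwartz_coinduct)
    case (differentiable h x)
    then obtain g where g: "smooth g" "\<And>\<xi>. norm \<xi> < R \<Longrightarrow> h \<xi> = g \<xi>" "\<And>\<xi>. r < norm \<xi> \<Longrightarrow> h \<xi> = 0" by blast
    show ?case
    proof (cases "norm x < R")
      case True
      show ?thesis
        by (rule partial_deriv_local[OF o1, where f = g]) (use True g smooth_differentiable in auto)
    next
      case False
      show ?thesis
        by (rule partial_deriv_local[OF o2, where f = "\<lambda>x. 0"]) (use False g assms(1) in auto)
    qed
  next
    case (decay h m)
    then obtain g where g: "smooth g" "\<And>\<xi>. norm \<xi> < R \<Longrightarrow> h \<xi> = g \<xi>" "\<And>\<xi>. r < norm \<xi> \<Longrightarrow> h \<xi> = 0" by blast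
    have cont: "continuous_on (cball 0 r) (\<lambda>x. (1 + norm x) ^ m *\<^sub>R g x)"
      by (intro continuous_intros continuous_at_imp_continuous_on ballI differentiable_imp_continuous_within smooth_differentiable g)
    have "bounded ((\<lambda>x. (1 + norm x) ^ m *\<^sub>R g x) ` cball 0 r)"
      by (intro compact_imp_bounded compact_continuous_image cont compact_cball)
    then have "\<exists>B. \<forall>y\<in>(\<lambda>x. (1 + norm x) ^ m *\<^sub>R g x) ` cball 0 r. norm y \<le> B" by (simp only: bounded_iff)
    then obtain B where B': "\<forall>y\<in>(\<lambda>x. (1 + norm x) ^ m *\<^sub>R g x) ` cball 0 r. norm y \<le> B" ..
    have B: "(1 + norm x) ^ m * cmod (g x) \<le> B" if "norm x \<le> r" for x
    proof -
      have "x \<in> cball 0 r" using that by simp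
      from bspec[OF B' imageI[OF this]] show ?thesis by simp
    qed
    have "(1 + norm x) ^ m * cmod (h x) \<le> max B 0" for x
    proof (cases "norm x \<le> r")
      case True
      then show ?thesis using B[OF True] g(2)[of x] assms(1) by auto
    next
      case False
      then show ?thesis using g(3)[of x] by simp
    qed
    then show ?case by blast
  next
    case (partial_deriv h i)
    then obtain g where g: "smooth g" "\<And>\<xi>. norm \<xi> < R \<Longrightarrow> h \<xi> = g \<xi>" "\<And>\<xi>. r < norm \<xi> \<Longrightarrow> h \<xi> = 0" by blast
    have "partial_deriv i h \<xi> = partial_deriv i g \<xi>" if "norm \<xi> < R" for \<xi>
      by (rule partial_deriv_local[OF o1, where f = g]) (use that g smooth_differentiable in auto)
    moreover have "partial_deriv i h \<xi> = 0" if "r < norm \<xi>" for \<xi>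
    proof -
      have "partial_deriv i h \<xi> = partial_deriv i (\<lambda>x. 0) \<xi>"
        by (rule partial_deriv_local[OF o2, where f = "\<lambda>x. 0"]) (use that g in auto)
      then show ?thesis by (simp only: z)
    qed
    ultimately show ?case using smooth_partial_deriv[OF g(1), of i] by blast
  qed
qed

text \<open>Supports are recorded pointwise. K0 > 0 is the source of the vanishing moments and of
  the local finiteness of the dyadic sum, L0 < pi the condition under which \<open>sampling\<close>
  applies.\<close>

locale frame_pair =
  fixes \<phi> \<psi> :: "real^'n::finite \<Rightarrow> complex" and K0 L0 :: real
  assumes K0: "0 < K0" and L0: "0 < L0" "L0 < pi"
    and \<phi>: "\<phi> \<in> schwartz" and \<psi>: "\<psi> \<in> schwartz"
    and \<phi>_supp: "\<And>\<xi>. fourier \<phi> \<xi> \<noteq> 0 \<Longrightarrow> K0 \<le> norm \<xi> \<and> norm \<xi> \<le> L0"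
    and \<psi>_supp: "\<And>\<xi>. fourier \<psi> \<xi> \<noteq> 0 \<Longrightarrow> K0 \<le> norm \<xi> \<and> norm \<xi> \<le> L0"
    and resolution: "\<And>\<xi>. \<xi> \<noteq> 0 \<Longrightarrow>
      ((\<lambda>\<nu>::int. cnj (fourier \<phi> (2 powi (-\<nu>) *\<^sub>R \<xi>)) * fourier \<psi> (2 powi (-\<nu>) *\<^sub>R \<xi>)) has_sum 1) UNIV"
begin

definition \<theta> :: "real^'n \<Rightarrow> complex" where
  "\<theta> \<xi> = cnj (fourier \<phi> \<xi>) * fourier \<psi> \<xi>"

text \<open>\<open>low\<close> is the transform of \<open>\<Phi>\<close>; its inverse transform exists only once it is known to be a
  Schwartz function.\<close>

definition low :: "real^'n \<Rightarrow> complex" where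
  "low \<xi> = 1 - (\<Sum>\<nu>. \<theta> ((1/2) ^ \<nu> *\<^sub>R \<xi>))"

lemma \<theta>_supp: "\<theta> \<xi> \<noteq> 0 \<Longrightarrow> K0 \<le> norm \<xi> \<and> norm \<xi> \<le> L0"
  using \<phi>_supp unfolding \<theta>_def by auto

lemma \<theta>_schwartz: "\<theta> \<in> schwartz"
proof -
  have r: "rapid (\<lambda>x. cnj (\<phi> x))" by (intro schwartz_rapid schwartz_cnj' \<phi>)
  have "\<theta> = fourier (smear (\<lambda>x. cnj (\<phi> x)) \<psi> 1)"
    by (rule ext) (simp add: \<theta>_def fourier_smear[OF r \<psi>] fourier_cnj)
  then show ?thesis by (simp add: schwartz_fourier schwartz_smear[OF r \<psi>])
qed

lemma \<theta>_small: "norm \<xi> < 2 ^ V * K0 \<Longrightarrow> V \<le> \<nu> \<Longrightarrow> \<theta> ((1/2) ^ \<nu> *\<^sub>R \<xi>) = 0"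
proof (rule ccontr)
  assume *: "norm \<xi> < 2 ^ V * K0" "V \<le> \<nu>" "\<theta> ((1/2) ^ \<nu> *\<^sub>R \<xi>) \<noteq> 0"
  then have "K0 \<le> norm ((1/2) ^ \<nu> *\<^sub>R \<xi>)" using \<theta>_supp by blast
  then have "2 ^ \<nu> * K0 \<le> norm \<xi>" by (simp add: power_one_over field_simps)
  moreover have "2 ^ V * K0 \<le> 2 ^ \<nu> * K0" using *(2) K0 by (intro mult_right_mono power_increasing) auto
  ultimately show False using *(1) by linarith
qed

lemma low_sum: "norm \<xi> < 2 ^ V * K0 \<Longrightarrow> (\<lambda>\<nu>. \<theta> ((1/2) ^ \<nu> *\<^sub>R \<xi>)) sums (\<Sum>\<nu><V. \<theta> ((1/2) ^ \<nu> *\<^sub>R \<xi>))"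
  using \<theta>_small by (intro sums_finite) auto

lemma ex_V: "\<exists>V. x < 2 ^ V * K0"
proof -
  obtain V where "x / K0 < 2 ^ V" using real_arch_pow[of 2 "x / K0"] by auto
  then show ?thesis using K0 by (auto simp: pos_divide_less_eq)
qed

lemma low_eq: "norm \<xi> < 2 ^ V * K0 \<Longrightarrow> low \<xi> = 1 - (\<Sum>\<nu><V. \<theta> ((1/2) ^ \<nu> *\<^sub>R \<xi>))"
  unfolding low_def using sums_unique[OF low_sum] by simp

lemma low_0: "low 0 = 1"
  using low_eq[of 0 0] K0 by simp

lemma low_double: "low \<xi> - low (2 *\<^sub>R \<xi>) = \<theta> (2 *\<^sub>R \<xi>)"
proof -
  obtain V where "norm \<xi> < 2 ^ V * K0" using ex_V by blast
  then have 1: "low \<xi> = 1 - (\<Sum>\<nu><V. \<theta> ((1/2) ^ \<nu> *\<^sub>R \<xi>))" and 2: "norm (2 *\<^sub>R \<xi>) < 2 ^ Suc V * K0"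
    by (auto simp: low_eq)
  show ?thesis unfolding 1 low_eq[OF 2] by (subst sum.lessThan_Suc_shift) simp
qed

text \<open>For |\<xi>| > L0 / 2 the terms with \<nu> < 0 sit at points of norm above L0 and vanish,
  so the terms with \<nu> >= 0 carry the whole sum 1.\<close>

lemma low_outside:
  assumes "L0 / 2 < norm \<xi>"
  shows "low \<xi> = 0"
proof -
  have "\<xi> \<noteq> 0" using assms L0 by auto
  have z: "\<theta> (2 powi (-\<nu>) *\<^sub>R \<xi>) = 0" if "\<nu> < 0" for \<nu> :: int
  proof (rule ccontr)
    assume "\<theta> (2 powi (-\<nu>) *\<^sub>R \<xi>) \<noteq> 0"
    then have "norm (2 powi (-\<nu>) *\<^sub>R \<xi>) \<le> L0" using \<theta>_supp by blast
    moreover have "2 powi (1::int) \<le> (2::real) powi (-\<nu>)"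
      using that by (intro power_int_increasing) auto
    then have "2 * norm \<xi> \<le> 2 powi (-\<nu>) * norm \<xi>" by (intro mult_right_mono) auto
    ultimately show False using assms by simp
  qed
  have "((\<lambda>\<nu>::int. \<theta> (2 powi (-\<nu>) *\<^sub>R \<xi>)) has_sum 1) UNIV"
    using resolution[OF \<open>\<xi> \<noteq> 0\<close>] by (simp add: \<theta>_def)
  then have "((\<lambda>\<nu>::int. \<theta> (2 powi (-\<nu>) *\<^sub>R \<xi>)) has_sum 1) (range int)"
    by (rule has_sum_cong_neutral[THEN iffD1, rotated 3])
      (use z in \<open>auto simp: image_iff; metis nonneg_int_cases not_le\<close>)+
  then have "((\<lambda>\<nu>::nat. \<theta> ((1/2) ^ \<nu> *\<^sub>R \<xi>)) has_sum 1) UNIV"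
    by (subst (asm) has_sum_reindex) (auto simp: inj_on_def comp_def power_int_minus power_one_over inverse_eq_divide)
  then have "(\<lambda>\<nu>::nat. \<theta> ((1/2) ^ \<nu> *\<^sub>R \<xi>)) sums 1" by (rule has_sum_imp_sums)
  then show ?thesis unfolding low_def by (simp add: sums_unique[symmetric])
qed

text \<open>Inside the ball of radius 2^V K0 the function is 1 minus finitely many dilates of
  \<theta>, and beyond radius L0 / 2 it is zero; V is taken so large that the two regions
  overlap.\<close>

lemma low_schwartz: "low \<in> schwartz"
proof -
  obtain V where V: "L0 < 2 ^ V * K0" using ex_V by blast
  have "(\<lambda>\<xi>. \<Sum>\<nu><V. \<theta> ((1/2) ^ \<nu> *\<^sub>R \<xi>)) \<in> schwartz"
    using schwartz_affine[OF \<theta>_schwartz, of _ 0] by (intro schwartz_sum') auto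
  then have "smooth (\<lambda>\<xi>. 1 - (\<Sum>\<nu><V. \<theta> ((1/2) ^ \<nu> *\<^sub>R \<xi>)))" by (rule smooth_const_minus_schwartz)
  then show ?thesis
    by (rule schwartz_of_compact_support[where r = "L0 / 2" and R = "2 ^ V * K0", rotated])
      (use V L0 in \<open>auto simp: low_eq low_outside\<close>)
qed

text \<open>\<open>Phi\<close> is a definite description: existence is the surjectivity of the
  transform on Schwartz functions, uniqueness its injectivity.\<close>

lemma Phi_schwartz: "Phi \<phi> \<psi> \<in> schwartz" and fourier_Phi: "fourier (Phi \<phi> \<psi>) = low"
proof -
  obtain g where g: "g \<in> schwartz" "fourier g = low" by (rule fourier_surj[OF low_schwartz])
  have "\<exists>!\<Phi>. \<Phi> \<in> schwartz \<and> (\<forall>\<xi>. fourier \<Phi> \<xi> = low \<xi>)"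
  proof (rule ex1I[of _ g])
    fix \<Phi> assume "\<Phi> \<in> schwartz \<and> (\<forall>\<xi>. fourier \<Phi> \<xi> = low \<xi>)"
    then show "\<Phi> = g" using g by (intro fourier_inj) auto
  qed (use g in auto)
  from theI'[OF this] have "Phi \<phi> \<psi> \<in> schwartz \<and> (\<forall>\<xi>. fourier (Phi \<phi> \<psi>) \<xi> = low \<xi>)"
    unfolding Phi_def low_def \<theta>_def by simp
  then show "Phi \<phi> \<psi> \<in> schwartz" "fourier (Phi \<phi> \<psi>) = low" by auto
qed

text \<open>The conjugate arises because the average stands in the antilinear argument of f: f of an
  average with \<open>cPhi\<close> is the pairing of \<omega> with the convolution of f and a dilate
  of \<open>Phi\<close>.\<close>

definition cPhi :: "real^'n \<Rightarrow> complex" where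
  "cPhi x = cnj (Phi \<phi> \<psi> x)"

lemma cPhi_schwartz: "cPhi \<in> schwartz"
  unfolding cPhi_def[abs_def] by (intro schwartz_cnj' Phi_schwartz)

lemma cPhi_rapid: "rapid cPhi"
  by (intro schwartz_rapid cPhi_schwartz)

lemma fourier_cPhi: "fourier cPhi \<xi> = cnj (low (- \<xi>))"
  unfolding cPhi_def[abs_def] by (simp add: fourier_cnj fourier_Phi)

lemma integral_cPhi: "(\<integral>x. cPhi x \<partial>lborel) = 1"
  using fourier_cPhi[of 0] by (simp add: fourier_def low_0)

lemma fourier_smear_cPhi: "\<omega> \<in> schwartz \<Longrightarrow> fourier (smear cPhi \<omega> s) \<xi> = fourier \<omega> \<xi> * cnj (low (s *\<^sub>R \<xi>))"
  by (simp add: fourier_smear[OF cPhi_rapid] fourier_cPhi)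

section \<open>One dyadic level\<close>

text \<open>For \<open>a = 2\<^sup>\<nu>\<close> and \<open>Q = Q\<^sub>\<nu>\<^sub>k\<close> one has \<open>coef a \<omega> k = a\<^sup>n \<integral> \<omega>(x) cnj (\<psi>(ax - k)) dx\<close>, so that
  \<open>coef a \<omega> k \<cdot> \<phi>(ax - k) = \<langle>\<omega>, \<psi>\<^sub>Q\<rangle> \<phi>\<^sub>Q(x)\<close>: the factor \<open>a\<^sup>n\<close> collects both normalizations.
  \<open>level a \<omega>\<close> is the sum of these over \<open>k\<close>, with the sum replaced by an integral.\<close>

definition coef :: "real \<Rightarrow> (real^'n \<Rightarrow> complex) \<Rightarrow> real^'n \<Rightarrow> complex" where
  "coef a \<omega> = smear (\<lambda>x. cnj (\<psi> x)) (\<lambda>y. \<omega> ((1 / a) *\<^sub>R y)) 1"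

lemma c\<psi>_rapid: "rapid (\<lambda>x. cnj (\<psi> x))"
  by (intro schwartz_rapid schwartz_cnj' \<psi>)

lemma dilate_schwartz: "\<omega> \<in> schwartz \<Longrightarrow> a \<noteq> 0 \<Longrightarrow> (\<lambda>y. \<omega> (a *\<^sub>R y)) \<in> schwartz"
  using schwartz_affine[of \<omega> a 0] by simp

lemma coef_schwartz: "\<omega> \<in> schwartz \<Longrightarrow> a > 0 \<Longrightarrow> coef a \<omega> \<in> schwartz"
  unfolding coef_def by (intro schwartz_smear c\<psi>_rapid dilate_schwartz) auto

lemma fourier_coef:
  assumes "\<omega> \<in> schwartz" "a > 0"
  shows "fourier (coef a \<omega>) \<xi> = of_real (a ^ CARD('n)) * fourier \<omega> (a *\<^sub>R \<xi>) * cnj (fourier \<psi> \<xi>)"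
proof -
  have "fourier (coef a \<omega>) \<xi> = fourier (\<lambda>y. \<omega> ((1 / a) *\<^sub>R y)) \<xi> * cnj (fourier \<psi> \<xi>)"
    unfolding coef_def using assms by (subst fourier_smear[OF c\<psi>_rapid dilate_schwartz]) (auto simp: fourier_cnj)
  also have "fourier (\<lambda>y. \<omega> ((1 / a) *\<^sub>R y)) \<xi> = of_real (a ^ CARD('n)) * fourier \<omega> (a *\<^sub>R \<xi>)"
    using fourier_affine[OF schwartz_measurable[OF assms(1)], of "1 / a" 0 \<xi>] assms(2) by (simp add: power_divide)
  finally show ?thesis .
qed

definition level :: "real \<Rightarrow> (real^'n \<Rightarrow> complex) \<Rightarrow> real^'n \<Rightarrow> complex" where
  "level a \<omega> x = smear (coef a \<omega>) \<phi> (-1) (a *\<^sub>R x)"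

lemma level_schwartz: "\<omega> \<in> schwartz \<Longrightarrow> a > 0 \<Longrightarrow> level a \<omega> \<in> schwartz"
  unfolding level_def[abs_def] by (intro dilate_schwartz schwartz_smear \<phi> schwartz_rapid coef_schwartz) auto

text \<open>Both sides have the transform of \<omega> times the conjugate of \<theta>(\<xi> / a);
  the difference appears through \<open>low_double\<close> at \<xi> / (2a).\<close>

lemma level_eq:
  assumes "\<omega> \<in> schwartz" "a > 0"
  shows "level a \<omega> = (\<lambda>x. smear cPhi \<omega> (1 / (2 * a)) x - smear cPhi \<omega> (1 / a) x)"
proof (rule fourier_inj)
  show "level a \<omega> \<in> schwartz" by (rule level_schwartz[OF assms])
  show "(\<lambda>x. smear cPhi \<omega> (1 / (2 * a)) x - smear cPhi \<omega> (1 / a) x) \<in> schwartz"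
    by (intro schwartz_diff' schwartz_smear cPhi_rapid assms)
  fix \<xi>
  have r: "rapid (coef a \<omega>)" by (intro schwartz_rapid coef_schwartz assms)
  have "fourier (level a \<omega>) \<xi> = of_real (1 / a ^ CARD('n)) * fourier (smear (coef a \<omega>) \<phi> (-1)) ((1 / a) *\<^sub>R \<xi>)"
    unfolding level_def[abs_def]
    using fourier_affine[OF schwartz_measurable[OF schwartz_smear[OF r \<phi>, of "-1"]], of a 0 \<xi>] assms(2) by simp
  also have "\<dots> = fourier \<omega> \<xi> * cnj (\<theta> ((1 / a) *\<^sub>R \<xi>))"
    using assms by (simp add: fourier_smear[OF r \<phi>] fourier_coef \<theta>_def mult_ac)
  also have "\<theta> ((1 / a) *\<^sub>R \<xi>) = low ((1 / (2 * a)) *\<^sub>R \<xi>) - low ((1 / a) *\<^sub>R \<xi>)"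
    using low_double[of "(1 / (2 * a)) *\<^sub>R \<xi>"] by simp
  also have "fourier \<omega> \<xi> * cnj (low ((1 / (2 * a)) *\<^sub>R \<xi>) - low ((1 / a) *\<^sub>R \<xi>))
      = fourier (\<lambda>x. smear cPhi \<omega> (1 / (2 * a)) x - smear cPhi \<omega> (1 / a) x) \<xi>"
    by (subst fourier_diff) (auto intro!: integrable_rapid schwartz_rapid schwartz_smear cPhi_rapid assms
        simp: fourier_smear_cPhi assms right_diff_distrib)
  finally show "fourier (level a \<omega>) \<xi> = fourier (\<lambda>x. smear cPhi \<omega> (1 / (2 * a)) x - smear cPhi \<omega> (1 / a) x) \<xi>" .
qed

text \<open>Differentiation multiplies the transform by a polynomial and so does not enlarge its
  support; hence \<open>sampling\<close> applies to every derivative of \<phi>.\<close>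

lemma fourier_D_supp: "pi \<le> norm \<xi> \<Longrightarrow> fourier (D is \<phi>) \<xi> = 0"
proof (induction "is")
  case Nil
  then show ?case using \<phi>_supp[of \<xi>] L0 by auto
next
  case (Cons i "is")
  then show ?case using fourier_partial_deriv[OF schwartz_D[OF \<phi>, of "is"], of i \<xi>] by simp
qed

definition translate :: "real \<Rightarrow> int^'n \<Rightarrow> real^'n \<Rightarrow> complex" where
  "translate a k x = \<phi> (a *\<^sub>R x - ivec k)"

lemma translate_schwartz: "a > 0 \<Longrightarrow> translate a k \<in> schwartz"
  using schwartz_affine[OF \<phi>, of a "- ivec k"] by (simp add: translate_def[abs_def])

lemma D_translate: "D is (translate a k) x = of_real (a ^ length is) * D is \<phi> (a *\<^sub>R x - ivec k)"
  using fun_cong[OF D_affine[OF schwartz_smooth[OF \<phi>], of "is" a "- ivec k"], of x] by (simp add: translate_def[abs_def])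

text \<open>\<open>max 1 a\<close> pays for the chain-rule factors, \<open>max 1 (1 / a)\<close> for
  passing from the weight at x to the weight at a x, and the power of 1 + |k| for the
  translation.\<close>

lemma schwartz_norm_translate_le:
  assumes "a > 0"
  shows "schwartz_norm d (translate a k) \<le> (max 1 a * max 1 (1 / a)) ^ d * (1 + norm (ivec k)) ^ d * schwartz_norm d \<phi>"
proof (rule schwartz_norm_le[OF translate_schwartz[OF assms]])
  fix "is" :: "'n list" and x :: "real^'n" assume l: "length is \<le> d"
  have "(1 + norm x) ^ d * cmod (D is (translate a k) x) = (1 + norm x) ^ d * (a ^ length is * cmod (D is \<phi> (a *\<^sub>R x - ivec k)))"
    using assms by (simp add: D_translate norm_mult norm_power)
  also have "\<dots> \<le> (max 1 (1 / a) ^ d * ((1 + norm (a *\<^sub>R x + - ivec k)) ^ d * (1 + norm (- ivec k)) ^ d)) * (max 1 a ^ d * cmod (D is \<phi> (a *\<^sub>R x - ivec k)))"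
  proof (intro mult_mono one_add_norm_affine_power_le)
    have "a ^ length is \<le> max 1 a ^ length is" using assms by (intro power_mono) auto
    also have "\<dots> \<le> max 1 a ^ d" using l by (intro power_increasing) auto
    finally show "a ^ length is \<le> max 1 a ^ d" .
  qed (use assms in auto)
  also have "\<dots> = (max 1 a * max 1 (1 / a)) ^ d * (1 + norm (ivec k)) ^ d * ((1 + norm (a *\<^sub>R x - ivec k)) ^ d * cmod (D is \<phi> (a *\<^sub>R x - ivec k)))"
    by (simp add: power_mult_distrib mult_ac)
  also have "\<dots> \<le> (max 1 a * max 1 (1 / a)) ^ d * (1 + norm (ivec k)) ^ d * schwartz_norm d \<phi>"
    by (intro mult_left_mono schwartz_norm_bound \<phi> l) auto
  finally show "(1 + norm x) ^ d * cmod (D is (translate a k) x) \<le> (max 1 a * max 1 (1 / a)) ^ d * (1 + norm (ivec k)) ^ d * schwartz_norm d \<phi>" .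
qed

lemma schwartz_norm_cmult_le:
  fixes w :: "real^'n \<Rightarrow> complex"
  assumes "w \<in> schwartz"
  shows "schwartz_norm d (\<lambda>x. c * w x) \<le> cmod c * schwartz_norm d w"
proof (rule schwartz_norm_le[OF schwartz_cmult'[OF assms]])
  fix "is" :: "'n list" and x :: "real^'n" assume "length is \<le> d"
  from mult_left_mono[OF schwartz_norm_bound[OF assms this, of x] norm_ge_zero[of c]]
  show "(1 + norm x) ^ d * cmod (D is (\<lambda>x. c * w x) x) \<le> cmod c * schwartz_norm d w"
    by (simp add: D_cmult[OF assms] norm_mult mult_ac)
qed

lemma level_has_sum:
  assumes f: "f \<in> tempered" and \<omega>: "\<omega> \<in> schwartz" and a: "a > 0"
  shows "((\<lambda>k. f (\<lambda>x. coef a \<omega> (ivec k) * translate a k x)) has_sum f (level a \<omega>)) UNIV"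
proof (rule tempered_has_sum[OF f])
  let ?G = "coef a \<omega>"
  have G: "?G \<in> schwartz" by (rule coef_schwartz[OF \<omega> a])
  show "(\<lambda>x. ?G (ivec k) * translate a k x) \<in> schwartz" for k
    by (intro schwartz_cmult' translate_schwartz a)
  show "level a \<omega> \<in> schwartz" by (rule level_schwartz[OF \<omega> a])
  show "((\<lambda>k. D is (\<lambda>x. ?G (ivec k) * translate a k x) x) has_sum D is (level a \<omega>) x) UNIV" for "is" x
  proof -
    have "fourier ?G \<xi> = 0" if "pi \<le> norm \<xi>" for \<xi>
      using \<psi>_supp[of \<xi>] L0 that by (auto simp: fourier_coef[OF \<omega> a])
    then have "((\<lambda>k. ?G (ivec k) * D is \<phi> (a *\<^sub>R x - ivec k)) has_sum smear ?G (D is \<phi>) (-1) (a *\<^sub>R x)) UNIV"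
      by (intro sampling G schwartz_D \<phi> fourier_D_supp)
    then have "((\<lambda>k. of_real (a ^ length is) * (?G (ivec k) * D is \<phi> (a *\<^sub>R x - ivec k))) has_sum
        of_real (a ^ length is) * smear ?G (D is \<phi>) (-1) (a *\<^sub>R x)) UNIV" by (rule has_sum_cmult_right)
    moreover have "D is (level a \<omega>) x = of_real (a ^ length is) * smear ?G (D is \<phi>) (-1) (a *\<^sub>R x)"
      using fun_cong[OF D_affine[OF schwartz_smooth[OF schwartz_smear[OF schwartz_rapid[OF G] \<phi>, of "-1"]], of "is" a 0], of x]
      by (simp add: level_def[abs_def] D_smear[OF schwartz_rapid[OF G] \<phi>])
    moreover have "D is (\<lambda>x. ?G (ivec k) * translate a k x) x = of_real (a ^ length is) * (?G (ivec k) * D is \<phi> (a *\<^sub>R x - ivec k))" for k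
      using fun_cong[OF D_cmult[OF translate_schwartz[OF a, of k], of "is" "?G (ivec k)"], of x]
      by (simp only: D_translate mult.left_commute)
    ultimately show ?thesis by (simp only:)
  qed
  fix d
  let ?M = "2 * CARD('n)"
  let ?A = "(max 1 a * max 1 (1 / a)) ^ d * schwartz_norm d \<phi>"
  \<comment> \<open>The exponent d cancels the growth of the translates in the seminorm of order d,
    and 2 n is left for summability over the lattice.\<close>
  obtain B where B: "B \<ge> 0" "\<And>y. cmod (?G y) \<le> B / (1 + norm y) ^ (?M + d)"
    using schwartz_decay0[OF G] by blast
  have A: "?A \<ge> 0" by (intro mult_nonneg_nonneg schwartz_norm_nonneg \<phi>) auto
  show "\<exists>b. b summable_on UNIV \<and> (\<forall>k. schwartz_norm d (\<lambda>x. ?G (ivec k) * translate a k x) \<le> b k)"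
  proof (intro exI conjI allI)
    show "(\<lambda>k::int^'n. (?A * B) * (1 / (1 + norm (ivec k)) ^ ?M)) summable_on UNIV"
      by (intro summable_on_cmult_right summable_inverse_power_ivec)
    fix k
    have "schwartz_norm d (\<lambda>x. ?G (ivec k) * translate a k x) \<le> cmod (?G (ivec k)) * schwartz_norm d (translate a k)"
      by (intro schwartz_norm_cmult_le translate_schwartz a)
    also have "\<dots> \<le> B / (1 + norm (ivec k)) ^ (?M + d) * ((max 1 a * max 1 (1 / a)) ^ d * (1 + norm (ivec k)) ^ d * schwartz_norm d \<phi>)"
      using B(1) by (intro mult_mono B schwartz_norm_translate_le a schwartz_norm_nonneg translate_schwartz) auto
    also have "\<dots> = (?A * B) * (1 / (1 + norm (ivec k)) ^ ?M)"
      by (simp add: power_add)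
    finally show "schwartz_norm d (\<lambda>x. ?G (ivec k) * translate a k x) \<le> (?A * B) * (1 / (1 + norm (ivec k)) ^ ?M)" .
  qed
qed

text \<open>By \<open>level_eq\<close> the functional is a difference of two averages, and each of
  these is tempered by \<open>tempered_smear\<close>.\<close>

lemma level_tempered:
  assumes "f \<in> tempered" "a > 0"
  shows "(\<lambda>\<omega>\<in>schwartz. f (level a \<omega>)) \<in> tempered"
proof -
  have "(\<lambda>\<omega>\<in>schwartz. f (level a \<omega>)) = (\<lambda>\<omega>\<in>schwartz. (\<lambda>\<omega>\<in>schwartz. f (smear cPhi \<omega> (1 / (2 * a)))) \<omega> - (\<lambda>\<omega>\<in>schwartz. f (smear cPhi \<omega> (1 / a))) \<omega>)"
    using assms by (intro restrict_ext) (simp add: level_eq antidual_diff schwartz_smear cPhi_rapid)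
  also have "\<dots> \<in> tempered"
    by (intro tempered_diff tempered_smear assms cPhi_rapid)
  finally show ?thesis .
qed

lemma level_sums:
  assumes f: "f \<in> tempered" and \<omega>: "\<omega> \<in> schwartz"
  shows "(\<lambda>j. f (level (2 powi (int j - int N)) \<omega>)) sums (f \<omega> - f (smear cPhi \<omega> (2 ^ N)))"
proof -
  \<comment> \<open>The scale 2^N / 2^j is 1 / a for a = 2^(j - N), so the levels are differences of
    consecutive terms. The first term is the low-frequency part, and the limit is f \<omega> because
    \<open>cPhi\<close> has integral 1.\<close>
  define t where "t j = f (smear cPhi \<omega> (2 ^ N / 2 ^ j))" for j
  have lev: "f (level (2 powi (int j - int N)) \<omega>) = t (Suc j) - t j" for j
  proof -
    have a: "(2::real) powi (int j - int N) = 2 ^ j / 2 ^ N" by (simp add: power_int_diff)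
    show ?thesis
      unfolding a by (subst level_eq[OF \<omega>]) (simp_all add: antidual_diff[OF f] schwartz_smear cPhi_rapid \<omega> t_def)
  qed
  obtain c d where c: "c \<ge> 0" "\<And>\<omega>. \<omega> \<in> schwartz \<Longrightarrow> cmod (f \<omega>) \<le> c * schwartz_norm d \<omega>"
    by (rule tempered_bound[OF f]) blast
  obtain C where C: "\<And>s. 0 \<le> s \<Longrightarrow> s \<le> 1 \<Longrightarrow> schwartz_norm d (\<lambda>x. smear cPhi \<omega> s x - \<omega> x) \<le> C * s"
    using schwartz_norm_smear_minus_le[OF cPhi_rapid integral_cPhi \<omega>, of d] by blast
  have "(\<lambda>j. t j - f \<omega>) \<longlonglongrightarrow> 0"
  proof (rule Lim_null_comparison)
    show "\<forall>\<^sub>F j in sequentially. norm (t j - f \<omega>) \<le> c * C * 2 ^ N * (1/2) ^ j"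
    proof (rule eventually_sequentiallyI[of N])
      fix j assume "N \<le> j"
      then have "2 ^ N / 2 ^ j \<le> (1::real)" by (simp add: power_increasing)
      have "t j - f \<omega> = f (\<lambda>x. smear cPhi \<omega> (2 ^ N / 2 ^ j) x - \<omega> x)"
        by (simp add: t_def antidual_diff[OF f] schwartz_smear cPhi_rapid \<omega>)
      also have "cmod \<dots> \<le> c * schwartz_norm d (\<lambda>x. smear cPhi \<omega> (2 ^ N / 2 ^ j) x - \<omega> x)"
        by (intro c schwartz_diff' schwartz_smear cPhi_rapid \<omega>)
      also have "\<dots> \<le> c * (C * (2 ^ N / 2 ^ j))"
        by (intro mult_left_mono C c) (use \<open>2 ^ N / 2 ^ j \<le> (1::real)\<close> in auto)
      finally show "norm (t j - f \<omega>) \<le> c * C * 2 ^ N * (1/2) ^ j" by (simp add: power_one_over)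
    qed
    have "(\<lambda>j. c * C * 2 ^ N * (1/2) ^ j) \<longlonglongrightarrow> c * C * 2 ^ N * (0::real)"
      by (intro tendsto_mult tendsto_const LIMSEQ_realpow_zero) auto
    then show "(\<lambda>j. c * C * 2 ^ N * (1/2) ^ j) \<longlonglongrightarrow> (0::real)" by simp
  qed
  then have "t \<longlonglongrightarrow> f \<omega>" by (rule LIM_zero_cancel)
  from telescope_sums[OF this] show ?thesis by (simp add: lev t_def)
qed

end

section \<open>Taylor polynomials of convolutions\<close>

lemma one_add_norm_neq_0 [simp]: "1 + norm x \<noteq> 0"
  using norm_ge_zero[of x] by linarith

lemma taylor_sum_alt:
  "taylor_sum p g y h = (\<Sum>k<p. \<Sum>is | length is = k. (of_real (lpow h is) / fact k) * D is g y)"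
  by (simp add: taylor_sum_def sum_divide_distrib)

lemma D_D_commute: "g \<in> schwartz \<Longrightarrow> D is (D js g) = D js (D is g)"
  using D_cong_mset[OF schwartz_smooth, of g "is @ js" "js @ is"] by (simp add: union_commute)

text \<open>Common shape of \<open>taylor_sum\<close> and \<open>moment_part\<close> as functions of
  the base point: constant-coefficient operators, which commute with all derivatives.\<close>

lemma
  fixes c :: "nat \<Rightarrow> 'n::finite list \<Rightarrow> complex"
  assumes "g \<in> schwartz"
  shows schwartz_sum_D: "(\<lambda>y. \<Sum>k<p. \<Sum>is | length is = k. c k is * D is g y) \<in> schwartz"
    and D_sum_D: "D js (\<lambda>y. \<Sum>k<p. \<Sum>is | length is = k. c k is * D is g y)
      = (\<lambda>y. \<Sum>k<p. \<Sum>is | length is = k. c k is * D is (D js g) y)"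
proof -
  have 1: "(\<lambda>y. c k is * D is g y) \<in> schwartz" for k "is"
    by (intro schwartz_cmult' schwartz_D assms)
  have 2: "(\<lambda>y. \<Sum>is | length is = k. c k is * D is g y) \<in> schwartz" for k
    by (intro schwartz_sum' finite_lists_length 1)
  show "(\<lambda>y. \<Sum>k<p. \<Sum>is | length is = k. c k is * D is g y) \<in> schwartz"
    by (intro schwartz_sum' finite_lessThan 2)
  show "D js (\<lambda>y. \<Sum>k<p. \<Sum>is | length is = k. c k is * D is g y)
      = (\<lambda>y. \<Sum>k<p. \<Sum>is | length is = k. c k is * D is (D js g) y)"
    by (simp only: D_sum[OF finite_lessThan 2] D_sum[OF finite_lists_length 1] D_cmult[OF schwartz_D[OF assms]]
        D_D_commute[OF assms, of js])
qed

lemma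
  assumes "g \<in> schwartz"
  shows schwartz_taylor_sum: "(\<lambda>y. taylor_sum p g y h) \<in> schwartz"
    and D_taylor_sum: "D js (\<lambda>y. taylor_sum p g y h) = (\<lambda>y. taylor_sum p (D js g) y h)"
  unfolding taylor_sum_alt by (rule schwartz_sum_D[OF assms], rule D_sum_D[OF assms])

definition reflect :: "real^'n::finite \<Rightarrow> (real^'n \<Rightarrow> complex) \<Rightarrow> real^'n \<Rightarrow> complex" where
  "reflect x e y = cnj (e (x - y))"

lemma conv_eq_reflect: "conv G f x = f (reflect x G)"
  by (simp add: conv_def reflect_def[abs_def])

lemma
  assumes "e \<in> schwartz"
  shows schwartz_reflect: "reflect x e \<in> schwartz"
    and D_reflect: "D is (reflect x e) = (\<lambda>y. (-1) ^ length is * reflect x (D is e) y)"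
proof -
  have *: "reflect x e = (\<lambda>y. cnj (e ((-1) *\<^sub>R y + x)))" for e :: "real^'a \<Rightarrow> complex"
    by (simp add: reflect_def[abs_def])
  have a: "(\<lambda>y. e ((-1) *\<^sub>R y + x)) \<in> schwartz" by (rule schwartz_affine[OF assms]) simp
  show "reflect x e \<in> schwartz" unfolding * by (rule schwartz_cnj'[OF a])
  show "D is (reflect x e) = (\<lambda>y. (-1) ^ length is * reflect x (D is e) y)"
    unfolding * D_cnj[OF a] D_affine[OF schwartz_smooth[OF assms]] by simp
qed

text \<open>The error of the linear approximation is f applied to the reflected remainder e of the
  expansion of G up to first order. Each derivative of e is the remainder of the same derivative of
  G, so the seminorm of e is of size |h|^2.\<close>

lemma has_derivative_conv:
  fixes f :: "'n::finite distribution"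
  assumes f: "f \<in> tempered" and G: "G \<in> schwartz"
  shows "(conv G f has_derivative (\<lambda>h. \<Sum>i\<in>UNIV. of_real (h $ i) * conv (partial_deriv i G) f x)) (at x)"
proof -
  obtain c d where c: "c \<ge> 0" "\<And>\<omega>. \<omega> \<in> schwartz \<Longrightarrow> cmod (f \<omega>) \<le> c * schwartz_norm d \<omega>"
    by (rule tempered_bound[OF f]) blast
  have "\<exists>B\<ge>0. \<forall>y h. cmod (D is G (y + h) - taylor_sum 2 (D is G) y h) \<le> B * norm h ^ 2 * (1 + norm h) ^ d / (1 + norm y) ^ d" for "is"
    using schwartz_taylor_remainder[OF schwartz_D[OF G, of "is"], of 2 d] by metis
  then obtain B where B: "\<And>is. B is \<ge> 0"
    "\<And>is y h. cmod (D is G (y + h) - taylor_sum 2 (D is G) y h) \<le> B is * norm h ^ 2 * (1 + norm h) ^ d / (1 + norm y) ^ d"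
    by metis
  \<comment> \<open>2^d bounds (1 + |h|)^d for |h| <= 1, and (1 + |x|)^d moves the weight from x - y
    to y.\<close>
  define C where "C is = B is * 2 ^ d * (1 + norm x) ^ d" for "is"
  show ?thesis
  proof (rule has_derivative_if_quadratic_error)
    fix h :: "real^'n" assume h: "norm h \<le> 1"
    define e where "e v = G (v + h) - taylor_sum 2 G v h" for v
    have Gh: "(\<lambda>v. G (v + h)) \<in> schwartz" using schwartz_affine[OF G, of 1 h] by simp
    have e: "e \<in> schwartz" unfolding e_def[abs_def] by (intro schwartz_diff' Gh schwartz_taylor_sum G)
    have De: "D is e v = D is G (v + h) - taylor_sum 2 (D is G) v h" for "is" v
      using D_affine[OF schwartz_smooth[OF G], of "is" 1 h]
      by (simp add: e_def[abs_def] D_diff[OF Gh schwartz_taylor_sum[OF G]] D_taylor_sum[OF G])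
    have r: "reflect z G' \<in> schwartz" if "G' \<in> schwartz" for z and G' :: "real^'n \<Rightarrow> complex" by (rule schwartz_reflect[OF that])
    have s: "(\<lambda>y. \<Sum>i\<in>UNIV. of_real (h $ i) * reflect x (partial_deriv i G) y) \<in> schwartz"
      by (intro schwartz_sum' schwartz_cmult' r schwartz_partial_deriv G) auto
    have E: "reflect x e = (\<lambda>y. reflect (x + h) G y - (reflect x G y + (\<Sum>i\<in>UNIV. of_real (h $ i) * reflect x (partial_deriv i G) y)))"
      by (rule ext) (simp add: reflect_def e_def taylor_sum_2 algebra_simps)
    have t: "reflect x (partial_deriv i G) \<in> schwartz" for i by (intro r schwartz_partial_deriv G)
    have "f (\<lambda>y. \<Sum>i\<in>UNIV. of_real (h $ i) * reflect x (partial_deriv i G) y) = (\<Sum>i\<in>UNIV. f (\<lambda>y. of_real (h $ i) * reflect x (partial_deriv i G) y))"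
      by (rule antidual_sum[OF f]) (auto intro: schwartz_cmult'[OF t])
    also have "\<dots> = (\<Sum>i\<in>UNIV. of_real (h $ i) * f (reflect x (partial_deriv i G)))"
      by (intro sum.cong refl) (simp only: antidual_cmult[OF f t] complex_cnj_complex_of_real)
    finally have "f (reflect x e) = f (reflect (x + h) G) - (f (reflect x G) + (\<Sum>i\<in>UNIV. of_real (h $ i) * f (reflect x (partial_deriv i G))))"
      unfolding E antidual_diff[OF f r[OF G] schwartz_add'[OF r[OF G] s]] antidual_add[OF f r[OF G] s] by simp
    then have "conv G f (x + h) - conv G f x - (\<Sum>i\<in>UNIV. of_real (h $ i) * conv (partial_deriv i G) f x) = f (reflect x e)"
      by (simp add: conv_eq_reflect)
    also have "cmod \<dots> \<le> c * schwartz_norm d (reflect x e)" by (intro c r e)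
    also have "\<dots> \<le> c * ((\<Sum>is | length is \<le> d. C is) * (norm h)\<^sup>2)"
    proof (intro mult_left_mono c schwartz_norm_le_sum r e)
      show "0 \<le> C is" for "is" using B(1)[of "is"] by (simp add: C_def)
      fix "is" :: "'n list" and y
      have "(1 + norm y) ^ d \<le> (1 + norm (x - y)) ^ d * (1 + norm x) ^ d"
      proof -
        have "norm (y - x + x) = norm y" "norm (y - x) = norm (x - y)" by (auto simp: norm_minus_commute)
        then show ?thesis using one_add_norm_power_add_le[of "y - x" x d] by simp
      qed
      moreover have "cmod (D is (reflect x e) y) \<le> B is * (norm h)\<^sup>2 * 2 ^ d / (1 + norm (x - y)) ^ d"
      proof -
        have "cmod (D is (reflect x e) y) \<le> B is * (norm h)\<^sup>2 * (1 + norm h) ^ d / (1 + norm (x - y)) ^ d"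
        proof -
          have "cmod (D is (reflect x e) y) = cmod (D is e (x - y))"
            by (simp add: D_reflect[OF e] norm_mult norm_power reflect_def)
          then show ?thesis unfolding De using B(2)[of "is" "x - y" h] by simp
        qed
        also have "\<dots> \<le> B is * (norm h)\<^sup>2 * 2 ^ d / (1 + norm (x - y)) ^ d"
          using h B(1)[of "is"] by (intro divide_right_mono mult_left_mono power_mono) auto
        finally show ?thesis .
      qed
      ultimately have "(1 + norm y) ^ d * cmod (D is (reflect x e) y)
        \<le> ((1 + norm (x - y)) ^ d * (1 + norm x) ^ d) * (B is * (norm h)\<^sup>2 * 2 ^ d / (1 + norm (x - y)) ^ d)"
        by (intro mult_mono) auto
      also have "\<dots> = C is * (norm h)\<^sup>2" by (simp add: C_def)
      finally show "(1 + norm y) ^ d * cmod (D is (reflect x e) y) \<le> C is * (norm h)\<^sup>2" .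
    qed auto
    finally show "cmod (conv G f (x + h) - conv G f x - (\<Sum>i\<in>UNIV. of_real (h $ i) * conv (partial_deriv i G) f x))
      \<le> (c * (\<Sum>is | length is \<le> d. C is)) * (norm h)\<^sup>2" by (simp only: mult.assoc)
  qed
qed

lemma
  assumes "f \<in> tempered" "G \<in> schwartz"
  shows D_conv: "D is (conv G f) = conv (D is G) f" and smooth_conv: "smooth (conv G f)"
proof -
  have pd: "partial_deriv i (conv G f) = conv (partial_deriv i G) f" if "G \<in> schwartz" for i G
    using partial_deriv_eq_coeff[OF has_derivative_conv[OF assms(1) that]] by blast
  show D: "D is (conv G f) = conv (D is G) f" for "is"
    by (induction "is") (auto simp: pd schwartz_D assms(2))
  show "smooth (conv G f)"
    unfolding smooth_def D using has_derivative_conv[OF assms(1) schwartz_D[OF assms(2)]]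
    unfolding differentiable_def by blast
qed

text \<open>The lists with counts \<alpha> are the permutations of one multiset, so a multinomial
  coefficient counts them.\<close>

lemma card_count_list_eq:
  fixes \<alpha> :: "'n::finite \<Rightarrow> nat"
  shows "card {is. count_list is = \<alpha>} * mfact \<alpha> = fact (sum \<alpha> UNIV)"
proof -
  obtain js where js: "count_list js = \<alpha>" by (rule ex_count_list_eq)
  have "{is. count_list is = \<alpha>} = permutations_of_multiset (mset js)"
    by (auto simp: permutations_of_multiset_def mset_eq_count_list js)
  moreover have "mfact \<alpha> = (\<Prod>i\<in>set_mset (mset js). fact (count (mset js) i))"
    unfolding mfact_def js[symmetric] count_mset[symmetric]
    by (rule prod.mono_neutral_right) (auto simp: count_mset count_list_0_iff)
  moreover have "size (mset js) = sum \<alpha> UNIV" using sum_count_list_UNIV[of js] js by simp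
  ultimately show ?thesis using card_permutations_of_multiset_aux[of "mset js"] by simp
qed

text \<open>Lists of length k are grouped by their counts; the k! / \<alpha>! lists over each
  \<alpha> turn 1 / k! into 1 / \<alpha>!. For m = -1 both sums are empty, as
  \<open>nat (m + 1)\<close> is 0.\<close>

lemma taylor_poly_eq_taylor_sum:
  fixes g :: "real^'n::finite \<Rightarrow> complex"
  assumes "smooth g"
  shows "taylor_poly m g x = taylor_sum (nat (m + 1)) g 0 x"
proof -
  let ?t = "\<lambda>\<alpha>. mderiv \<alpha> g 0 / of_nat (mfact \<alpha>) * of_real (mpower x \<alpha>)"
  have fin: "finite {\<alpha> :: 'n \<Rightarrow> nat. sum \<alpha> UNIV = k}" for k
    by (rule finite_subset[OF _ finite_multiindices_le[of k]]) auto
  have inner: "(\<Sum>is | length is = k. of_real (lpow x is) * D is g 0) / fact k = (\<Sum>\<alpha> | sum \<alpha> UNIV = k. ?t \<alpha>)" for k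
  proof -
    have im: "count_list ` {is :: 'n list. length is = k} = {\<alpha>. sum \<alpha> UNIV = k}"
    proof (intro equalityI subsetI)
      fix \<alpha> :: "'n \<Rightarrow> nat" assume "\<alpha> \<in> {\<alpha>. sum \<alpha> UNIV = k}"
      moreover obtain js where "count_list js = \<alpha>" by (rule ex_count_list_eq)
      ultimately show "\<alpha> \<in> count_list ` {is. length is = k}"
        using sum_count_list_UNIV[of js] by (intro image_eqI[of _ _ js]) auto
    qed (auto simp: sum_count_list_UNIV)
    have "(\<Sum>is | length is = k. of_real (lpow x is) * D is g 0)
        = (\<Sum>\<alpha> | sum \<alpha> UNIV = k. \<Sum>is | is \<in> {is. length is = k} \<and> count_list is = \<alpha>. of_real (lpow x is) * D is g 0)"
      unfolding im[symmetric] by (rule sum.image_gen[OF finite_lists_length])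
    also have "\<dots> = (\<Sum>\<alpha> | sum \<alpha> UNIV = k. fact k * ?t \<alpha>)"
    proof (intro sum.cong refl)
      fix \<alpha> :: "'n \<Rightarrow> nat" assume \<alpha>: "\<alpha> \<in> {\<alpha>. sum \<alpha> UNIV = k}"
      have set: "{is. is \<in> {is :: 'n list. length is = k} \<and> count_list is = \<alpha>} = {is. count_list is = \<alpha>}"
        using \<alpha> by (auto simp: sum_count_list_UNIV)
      have "(\<Sum>is | is \<in> {is. length is = k} \<and> count_list is = \<alpha>. of_real (lpow x is) * D is g 0)
        = (\<Sum>is | count_list is = \<alpha>. of_real (mpower x \<alpha>) * mderiv \<alpha> g 0)"
        unfolding set by (intro sum.cong refl) (auto simp: mderiv_count_list[OF assms, symmetric] mpower_count_list[symmetric])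
      also have "\<dots> = of_nat (card {is. count_list is = \<alpha>}) * (of_real (mpower x \<alpha>) * mderiv \<alpha> g 0)" by simp
      also have "\<dots> = (of_nat (card {is. count_list is = \<alpha>}) * of_nat (mfact \<alpha>)) * ?t \<alpha>"
      proof -
        have "mfact \<alpha> \<noteq> 0" by (simp add: mfact_def)
        then show ?thesis by (simp add: field_simps)
      qed
      also have "of_nat (card {is. count_list is = \<alpha>}) * of_nat (mfact \<alpha>) = (fact k :: complex)"
        using arg_cong[OF card_count_list_eq[of \<alpha>], of "of_nat :: nat \<Rightarrow> complex"] \<alpha>
        by (simp only: of_nat_mult of_nat_fact mem_Collect_eq)
      finally show "(\<Sum>is | is \<in> {is. length is = k} \<and> count_list is = \<alpha>. of_real (lpow x is) * D is g 0) = fact k * ?t \<alpha>" .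
    qed
    finally have e: "(\<Sum>is | length is = k. of_real (lpow x is) * D is g 0) = fact k * (\<Sum>\<alpha> | sum \<alpha> UNIV = k. ?t \<alpha>)"
      unfolding sum_distrib_left .
    show ?thesis unfolding e by (rule nonzero_mult_div_cancel_left) simp
  qed
  have "taylor_sum (nat (m + 1)) g 0 x = (\<Sum>k<nat (m + 1). \<Sum>\<alpha> | sum \<alpha> UNIV = k. ?t \<alpha>)"
    unfolding taylor_sum_def by (intro sum.cong refl inner)
  also have "\<dots> = (\<Sum>\<alpha>\<in>(\<Union>k\<in>{..<nat (m + 1)}. {\<alpha>. sum \<alpha> UNIV = k}). ?t \<alpha>)"
    by (rule sum.UNION_disjoint[symmetric]) (auto intro: fin)
  also have "(\<Union>k\<in>{..<nat (m + 1)}. {\<alpha> :: 'n \<Rightarrow> nat. sum \<alpha> UNIV = k}) = {\<alpha>. int (sum \<alpha> UNIV) \<le> m}"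
    by (auto simp: zless_nat_eq_int_zless)
  finally show ?thesis by (simp add: taylor_poly_def)
qed

lemma integrable_lpow:
  fixes u :: "real^'n::finite \<Rightarrow> complex"
  assumes "rapid u"
  shows "integrable lborel (\<lambda>z. u z * of_real (lpow z is))"
proof (rule integrable_rapid_mult[OF assms, where K = 1 and m = "length is"])
  have "continuous_on UNIV (\<lambda>z::real^'n. complex_of_real (lpow z is))"
    by (induction "is") (auto intro!: continuous_intros)
  then show "(\<lambda>z::real^'n. complex_of_real (lpow z is)) \<in> borel_measurable borel" by (rule borel_measurable_continuous_onI)
  show "cmod (of_real (lpow z is)) \<le> 1 * (1 + norm z) ^ length is" for z :: "real^'n"
    using abs_lpow_le[of z "is"] power_mono[of "norm z" "1 + norm z" "length is"] by simp
qed

text \<open>The integral of u(z) against the Taylor polynomial of g at y in the increment z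
  (\<open>integral_taylor_sum\<close>), arranged so that only moments of u and derivatives of g
  appear.\<close>

definition moment_part :: "nat \<Rightarrow> (real^'n::finite \<Rightarrow> complex) \<Rightarrow> (real^'n \<Rightarrow> complex) \<Rightarrow> real^'n \<Rightarrow> complex" where
  "moment_part p u g y = (\<Sum>k<p. \<Sum>is | length is = k. ((\<integral>z. u z * of_real (lpow z is) \<partial>lborel) / fact k) * D is g y)"

lemma
  assumes "g \<in> schwartz"
  shows schwartz_moment_part: "moment_part p u g \<in> schwartz"
    and D_moment_part: "D js (moment_part p u g) = moment_part p u (D js g)"
  unfolding moment_part_def[abs_def] by (rule schwartz_sum_D[OF assms], rule D_sum_D[OF assms])

lemma
  fixes u g :: "real^'n::finite \<Rightarrow> complex"
  assumes "rapid u"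
  shows integrable_taylor_sum: "integrable lborel (\<lambda>z. u z * taylor_sum p g y z)"
    and integral_taylor_sum: "(\<integral>z. u z * taylor_sum p g y z \<partial>lborel) = moment_part p u g y"
proof -
  have eq: "u z * taylor_sum p g y z = (\<Sum>k<p. \<Sum>is | length is = k. (D is g y / fact k) * (u z * of_real (lpow z is)))" for z
    by (simp add: taylor_sum_alt sum_distrib_left mult_ac)
  have i: "integrable lborel (\<lambda>z. (D is g y / fact k) * (u z * of_real (lpow z is)))" for "is" and k :: nat
    by (intro integrable_mult_right integrable_lpow assms)
  have i2: "integrable lborel (\<lambda>z. \<Sum>is | length is = k. (D is g y / fact k) * (u z * of_real (lpow z is)))" for k
    by (intro Bochner_Integration.integrable_sum i)
  show "integrable lborel (\<lambda>z. u z * taylor_sum p g y z)"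
    unfolding eq by (intro Bochner_Integration.integrable_sum i)
  have "(\<integral>z. u z * taylor_sum p g y z \<partial>lborel) = (\<Sum>k<p. \<integral>z. (\<Sum>is | length is = k. (D is g y / fact k) * (u z * of_real (lpow z is))) \<partial>lborel)"
    unfolding eq by (rule Bochner_Integration.integral_sum[OF i2])
  also have "\<dots> = (\<Sum>k<p. \<Sum>is | length is = k. (D is g y / fact k) * (\<integral>z. u z * of_real (lpow z is) \<partial>lborel))"
    by (intro sum.cong refl) (simp only: Bochner_Integration.integral_sum[OF i] integral_mult_right_zero)
  finally show "(\<integral>z. u z * taylor_sum p g y z \<partial>lborel) = moment_part p u g y"
    by (simp add: moment_part_def mult_ac)
qed

lemma taylor_sum_scale:
  assumes "w \<in> schwartz"
  shows "taylor_sum p (\<lambda>x. c * w (b *\<^sub>R x)) y z = c * taylor_sum p w (b *\<^sub>R y) (b *\<^sub>R z)"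
proof (cases "b = 0")
  case False
  have "(\<lambda>x. w (b *\<^sub>R x + 0)) \<in> schwartz" by (rule schwartz_affine[OF assms False])
  then have "D is (\<lambda>x. c * w (b *\<^sub>R x)) = (\<lambda>x. c * (of_real (b ^ length is) * D is w (b *\<^sub>R x)))" for "is"
    using D_cmult[of "\<lambda>x. w (b *\<^sub>R x)" "is" c] D_affine[OF schwartz_smooth[OF assms], of "is" b 0] by simp
  then show ?thesis
    by (simp add: taylor_sum_alt lpow_scaleR sum_distrib_left mult_ac)
next
  \<comment> \<open>A dilation by b = 0 gives a constant, to which \<open>schwartz_affine\<close>
    does not apply; on both sides only the empty list survives.\<close>
  case True
  have z: "D is (\<lambda>x. e) = (\<lambda>x. if is = [] then e else 0)" for "is" :: "'a list" and e :: complex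
    by (induction "is") (auto simp: partial_deriv_def fun_eq_iff)
  show ?thesis
  proof (cases p)
    case (Suc q)
    have l: "lpow (0 :: real^'a) is = (if is = [] then 1 else 0)" for "is" by (cases "is") auto
    have "(\<Sum>k<p. \<Sum>is | length is = k. (of_real (lpow z is) / fact k) * (if is = [] then e else 0)) = (\<Sum>k<p. if k = 0 then e else 0)" for e :: complex
      by (intro sum.cong refl) (auto simp: if_distrib sum.If_cases intro!: sum.neutral)
    then have "taylor_sum p (\<lambda>x. c * w (b *\<^sub>R x)) y z = c * w 0"
      by (simp add: taylor_sum_alt True z Suc del: sum.lessThan_Suc)
    moreover have "(\<Sum>k<p. \<Sum>is | length is = k. (of_real (lpow (0 :: real^'a) is) / fact k) * D is w 0) = (\<Sum>k<p. if k = 0 then w 0 else 0)"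
      by (intro sum.cong refl) (auto simp: l intro!: sum.neutral)
    then have "taylor_sum p w (b *\<^sub>R y) (b *\<^sub>R z) = w 0"
      by (simp add: taylor_sum_alt True Suc del: sum.lessThan_Suc)
    ultimately show ?thesis by simp
  qed simp
qed

text \<open>The remainder of order p carries |b z|^p, hence b^p. Its decay is in b y, and 1 + |b y|
  >= b (1 + |y|) turns this into decay in y at the price b^(-d). The chain-rule factors are powers
  of b and at most 1.\<close>

lemma smear_minus_moment_part_norm:
  fixes u g :: "real^'n::finite \<Rightarrow> complex"
  assumes u: "rapid u" and g: "g \<in> schwartz"
  obtains C where "\<And>b. 0 < b \<Longrightarrow> b \<le> 1 \<Longrightarrow>
    schwartz_norm d (\<lambda>y. smear u (\<lambda>x. g (b *\<^sub>R x)) 1 y - moment_part p u (\<lambda>x. g (b *\<^sub>R x)) y) \<le> C * (b ^ p / b ^ d)"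
proof -
  have "\<exists>B\<ge>0. \<forall>y h. cmod (D js g (y + h) - taylor_sum p (D js g) y h) \<le> B * norm h ^ p * (1 + norm h) ^ d / (1 + norm y) ^ d" for js
    using schwartz_taylor_remainder[OF schwartz_D[OF g, of js], of p d] by metis
  then obtain B where B: "\<And>js. B js \<ge> 0"
    "\<And>js y h. cmod (D js g (y + h) - taylor_sum p (D js g) y h) \<le> B js * norm h ^ p * (1 + norm h) ^ d / (1 + norm y) ^ d"
    by metis
  show thesis
  proof (rule that)
    fix b :: real assume b: "0 < b" "b \<le> 1"
    let ?g = "\<lambda>x. g (b *\<^sub>R x)"
    have gS: "?g \<in> schwartz" using schwartz_affine[OF g, of b 0] b by simp
    have Dg: "D js ?g = (\<lambda>x. of_real (b ^ length js) * D js g (b *\<^sub>R x))" for js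
      using D_affine[OF schwartz_smooth[OF g], of js b 0] by simp
    show "schwartz_norm d (\<lambda>y. smear u ?g 1 y - moment_part p u ?g y) \<le> (\<Sum>js | length js \<le> d. moment u (p + d) * B js) * (b ^ p / b ^ d)"
    proof (rule schwartz_norm_le_sum)
      show "(\<lambda>y. smear u ?g 1 y - moment_part p u ?g y) \<in> schwartz"
        by (intro schwartz_diff' schwartz_smear schwartz_moment_part u gS)
      show "0 \<le> moment u (p + d) * B js" for js by (intro mult_nonneg_nonneg moment_nonneg B)
      show "0 \<le> b ^ p / b ^ d" using b by simp
      fix js :: "'n list" and y
      let ?E = "\<lambda>z. D js g (b *\<^sub>R y + b *\<^sub>R z) - taylor_sum p (D js g) (b *\<^sub>R y) (b *\<^sub>R z)"
      have "D js (\<lambda>y. smear u ?g 1 y - moment_part p u ?g y) y = smear u (D js ?g) 1 y - moment_part p u (D js ?g) y"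
        by (simp add: D_diff[OF schwartz_smear[OF u gS] schwartz_moment_part[OF gS]] D_smear[OF u gS] D_moment_part[OF gS])
      also have "\<dots> = (\<integral>z. u z * D js ?g (y + 1 *\<^sub>R z) \<partial>lborel) - (\<integral>z. u z * taylor_sum p (D js ?g) y z \<partial>lborel)"
        unfolding smear_def integral_taylor_sum[OF u] ..
      also have "\<dots> = (\<integral>z. u z * D js ?g (y + 1 *\<^sub>R z) - u z * taylor_sum p (D js ?g) y z \<partial>lborel)"
        by (rule Bochner_Integration.integral_diff[symmetric]) (intro integrable_smear u schwartz_D gS integrable_taylor_sum)+
      also have "\<dots> = (\<integral>z. u z * (of_real (b ^ length js) * ?E z) \<partial>lborel)"
        unfolding Dg taylor_sum_scale[OF schwartz_D[OF g]] by (simp add: right_diff_distrib scaleR_add_right)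
      also have "cmod \<dots> \<le> (\<integral>z. cmod (u z) * (1 + norm z) ^ (p + d) * (B js * b ^ p / (b ^ d * (1 + norm y) ^ d)) \<partial>lborel)"
      proof (rule cmod_integral_le)
        show "integrable lborel (\<lambda>z. cmod (u z) * (1 + norm z) ^ (p + d) * (B js * b ^ p / (b ^ d * (1 + norm y) ^ d)))"
          by (intro integrable_mult_left integrable_rapid_weight u)
        fix z :: "real^'n"
        have bz: "norm (b *\<^sub>R z) \<le> b * (1 + norm z)" "norm (b *\<^sub>R z) \<le> norm z"
          using b by (auto intro: mult_left_le_one_le mult_left_mono)
        have yb: "b * (1 + norm y) \<le> 1 + norm (b *\<^sub>R y)" using b by (simp add: distrib_left)
        have "cmod (?E z) \<le> B js * norm (b *\<^sub>R z) ^ p * (1 + norm (b *\<^sub>R z)) ^ d / (1 + norm (b *\<^sub>R y)) ^ d" by (rule B)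
        also have "\<dots> \<le> B js * (b * (1 + norm z)) ^ p * (1 + norm z) ^ d / (b * (1 + norm y)) ^ d"
          using bz yb b B(1)[of js]
          by (intro frac_le mult_mono mult_left_mono power_mono mult_nonneg_nonneg zero_less_power mult_pos_pos)
            (auto simp: add_pos_nonneg)
        also have "\<dots> = (1 + norm z) ^ (p + d) * (B js * b ^ p / (b ^ d * (1 + norm y) ^ d))"
          by (simp add: power_mult_distrib power_add)
        finally have E: "cmod (?E z) \<le> (1 + norm z) ^ (p + d) * (B js * b ^ p / (b ^ d * (1 + norm y) ^ d))" .
        have "b ^ length js \<le> 1" using b by (intro power_le_one) auto
        then have "b ^ length js * cmod (?E z) \<le> 1 * cmod (?E z)" by (intro mult_right_mono) auto
        then have "cmod (of_real (b ^ length js) * ?E z) \<le> (1 + norm z) ^ (p + d) * (B js * b ^ p / (b ^ d * (1 + norm y) ^ d))"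
          using E b unfolding norm_mult norm_of_real by simp
        then show "cmod (u z * (of_real (b ^ length js) * ?E z)) \<le> cmod (u z) * (1 + norm z) ^ (p + d) * (B js * b ^ p / (b ^ d * (1 + norm y) ^ d))"
          unfolding norm_mult[of "u z"] mult.assoc[of "cmod (u z)"] by (intro mult_left_mono) auto
      qed
      also have "\<dots> = moment u (p + d) * (B js * b ^ p / (b ^ d * (1 + norm y) ^ d))"
        unfolding moment_def by (rule integral_mult_left_zero)
      finally have "(1 + norm y) ^ d * cmod (D js (\<lambda>y. smear u ?g 1 y - moment_part p u ?g y) y)
        \<le> (1 + norm y) ^ d * (moment u (p + d) * (B js * b ^ p / (b ^ d * (1 + norm y) ^ d)))"
        by (intro mult_left_mono) auto
      also have "\<dots> = moment u (p + d) * B js * (b ^ p / b ^ d)" by simp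
      finally show "(1 + norm y) ^ d * cmod (D js (\<lambda>y. smear u ?g 1 y - moment_part p u ?g y) y) \<le> moment u (p + d) * B js * (b ^ p / b ^ d)" .
    qed
  qed
qed

section \<open>The low-frequency part and its Taylor polynomial\<close>

context frame_pair
begin

text \<open>The substitution x = 2^N z transfers the dilation from \<omega> to the kernel, with
  Jacobian 2^(-nN), and replacing x by - x - y transfers the translation. The result averages a
  slowly varying kernel with \<omega>(- z) as weight, which is the form in which Taylor expansion
  pays off.\<close>

lemma
  assumes "\<omega> \<in> schwartz"
  shows smear_cPhi_eq: "smear cPhi \<omega> (2 ^ N) =
    (\<lambda>y. of_real ((1/2) ^ (CARD('n) * N)) * smear (\<lambda>z. \<omega> (- z)) (\<lambda>x. reflect 0 (Phi \<phi> \<psi>) ((1/2) ^ N *\<^sub>R x)) 1 y)"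
proof
  fix y
  let ?b = "(1/2::real) ^ N"
  have [measurable]: "\<omega> \<in> borel_measurable borel" "cPhi \<in> borel_measurable borel"
    by (intro schwartz_measurable assms cPhi_schwartz)+
  let ?F = "\<lambda>z. cPhi z * \<omega> (y + 2 ^ N *\<^sub>R z)"
  let ?H = "\<lambda>x. cPhi (?b *\<^sub>R x) * \<omega> (y + x)"
  have m1: "?F \<in> borel_measurable borel" "?H \<in> borel_measurable borel" by measurable
  have b: "?b \<noteq> 0" by simp
  have "(\<integral>x. ?H x \<partial>lborel) = (\<integral>x. ?F (?b *\<^sub>R x + 0) \<partial>lborel)"
    by (intro Bochner_Integration.integral_cong refl) (simp add: power_one_over)
  also have "\<dots> = (1 / \<bar>?b\<bar> ^ CARD('n)) *\<^sub>R (\<integral>x. ?F x \<partial>lborel)"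
    by (rule integral_affine[OF b m1(1)])
  finally have 1: "smear cPhi \<omega> (2 ^ N) y = of_real (?b ^ CARD('n)) * (\<integral>x. ?H x \<partial>lborel)"
    by (simp add: smear_def scaleR_conv_of_real power_one_over)
  have "(\<integral>x. ?H ((-1) *\<^sub>R x + (- y)) \<partial>lborel) = (1 / \<bar>-1\<bar> ^ CARD('n)) *\<^sub>R (\<integral>x. ?H x \<partial>lborel)"
    by (rule integral_affine[OF _ m1(2)]) simp
  then have 2: "(\<integral>x. ?H x \<partial>lborel) = (\<integral>x. ?H (- x - y) \<partial>lborel)" by simp
  have "?H (- z - y) = \<omega> (- z) * reflect 0 (Phi \<phi> \<psi>) (?b *\<^sub>R (y + 1 *\<^sub>R z))" for z
  proof -
    have "?b *\<^sub>R (- z - y) = 0 - ?b *\<^sub>R (y + 1 *\<^sub>R z)" by (simp add: algebra_simps)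
    then show ?thesis by (simp only: reflect_def cPhi_def) (simp add: mult.commute)
  qed
  then have "(\<integral>x. ?H (- x - y) \<partial>lborel) = smear (\<lambda>z. \<omega> (- z)) (\<lambda>x. reflect 0 (Phi \<phi> \<psi>) (?b *\<^sub>R x)) 1 y"
    unfolding smear_def by (simp only:)
  with 1 2 show "smear cPhi \<omega> (2 ^ N) y =
    of_real ((1/2) ^ (CARD('n) * N)) * smear (\<lambda>z. \<omega> (- z)) (\<lambda>x. reflect 0 (Phi \<phi> \<psi>) ((1/2) ^ N *\<^sub>R x)) 1 y"
    by (simp only: power_mult[symmetric] mult.commute)
qed

lemma flip_rapid: "\<omega> \<in> schwartz \<Longrightarrow> rapid (\<lambda>z. \<omega> (- z))" for \<omega> :: "real^'n \<Rightarrow> complex"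
  using schwartz_affine[of \<omega> "-1" 0] by (intro schwartz_rapid) simp

abbreviation low_kernel :: "nat \<Rightarrow> real^'n \<Rightarrow> complex" where
  "low_kernel N \<equiv> \<lambda>x. reflect 0 (Phi \<phi> \<psi>) ((1/2) ^ N *\<^sub>R x)"

lemma low_kernel_schwartz: "low_kernel N \<in> schwartz"
  by (intro dilate_schwartz schwartz_reflect Phi_schwartz) simp

lemma dilate_Phi_schwartz: "dilate N (Phi \<phi> \<psi>) \<in> schwartz"
  unfolding dilate_def[abs_def] by (intro schwartz_cmult' dilate_schwartz Phi_schwartz) simp

end

lemma ex_smear_minus_moment_part_norm:
  fixes u g :: "real^'n::finite \<Rightarrow> complex"
  assumes "rapid u" "g \<in> schwartz"
  shows "\<exists>C. \<forall>b. 0 < b \<longrightarrow> b \<le> 1 \<longrightarrow>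
    schwartz_norm d (\<lambda>y. smear u (\<lambda>x. g (b *\<^sub>R x)) 1 y - moment_part p u (\<lambda>x. g (b *\<^sub>R x)) y) \<le> C * (b ^ p / b ^ d)"
proof -
  show ?thesis
    by (rule smear_minus_moment_part_norm[OF assms, of d p]) (intro exI allI impI)
qed

context frame_pair
begin

text \<open>Each derivative of the convolution at 0 brings a sign from the reflected kernel, and
  each monomial the same sign from passing to \<omega>(- z); they cancel. The conjugated moments
  enter f without conjugation because f is antilinear.\<close>

lemma pairing_taylor_conv:
  assumes f: "f \<in> tempered" and \<omega>: "\<omega> \<in> schwartz"
  shows "pairing (taylor_poly m (conv (dilate N (Phi \<phi> \<psi>)) f)) \<omega> =
    f (\<lambda>y. of_real ((1/2) ^ (CARD('n) * N)) * moment_part (nat (m + 1)) (\<lambda>z. \<omega> (- z)) (low_kernel N) y)"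
proof -
  let ?p = "nat (m + 1)"
  let ?b = "complex_of_real ((1/2) ^ (CARD('n) * N))"
  let ?G = "dilate N (Phi \<phi> \<psi>)"
  let ?u = "\<lambda>z. \<omega> (- z)"
  let ?I = "\<lambda>is. \<integral>z. ?u z * of_real (lpow z is) \<partial>lborel"
  note G = dilate_Phi_schwartz[of N]
  have c\<omega>: "rapid (\<lambda>x. cnj (\<omega> x))" by (intro schwartz_rapid schwartz_cnj' \<omega>)
  have flip: "(\<integral>x. cnj (\<omega> x) * of_real (lpow x is) \<partial>lborel) = (-1) ^ length is * cnj (?I is)" for "is"
  proof -
    have "integral\<^sup>L lborel (\<lambda>x. cnj (\<omega> x) * of_real (lpow x is)) = (\<integral>x. cnj (\<omega> ((-1) *\<^sub>R x + 0)) * of_real (lpow ((-1) *\<^sub>R x + 0) is) \<partial>lborel)"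
      using integral_affine[of "-1" "\<lambda>x. cnj (\<omega> x) * of_real (lpow x is)" 0] integrable_lpow[OF c\<omega>, of "is"] by auto
    also have "\<dots> = (\<integral>x. (-1) ^ length is * cnj (?u x * of_real (lpow x is)) \<partial>lborel)"
    proof (intro Bochner_Integration.integral_cong refl)
      fix x show "cnj (\<omega> ((-1) *\<^sub>R x + 0)) * of_real (lpow ((-1) *\<^sub>R x + 0) is) = (-1) ^ length is * cnj (?u x * of_real (lpow x is))"
        using lpow_scaleR[of "-1" x "is"] by simp
    qed
    also have "\<dots> = (-1) ^ length is * cnj (?I is)"
      unfolding integral_mult_right_zero Bochner_Integration.integral_cnj ..
    finally show ?thesis .
  qed
  have kern: "reflect 0 ?G = (\<lambda>y. ?b * low_kernel N y)"
    by (rule ext) (simp add: reflect_def dilate_def)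
  have Dc: "D is (conv ?G f) 0 = (-1) ^ length is * f (\<lambda>y. ?b * D is (low_kernel N) y)" for "is"
  proof -
    have "(\<lambda>y. ?b * D is (low_kernel N) y) = (\<lambda>y. (-1) ^ length is * reflect 0 (D is ?G) y)"
      unfolding D_cmult[OF low_kernel_schwartz, symmetric] kern[symmetric] by (rule D_reflect[OF G])
    then have "f (\<lambda>y. ?b * D is (low_kernel N) y) = (-1) ^ length is * f (reflect 0 (D is ?G))"
      by (simp add: antidual_cmult[OF f schwartz_reflect[OF schwartz_D[OF G]]])
    then show ?thesis
      by (simp add: D_conv[OF f G] conv_eq_reflect mult.assoc[symmetric] power_mult_distrib[symmetric])
  qed
  have "pairing (taylor_poly m (conv ?G f)) \<omega> = (\<integral>x. cnj (\<omega> x) * taylor_sum ?p (conv ?G f) 0 x \<partial>lborel)"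
    unfolding pairing_def taylor_poly_eq_taylor_sum[OF smooth_conv[OF f G]] by (simp only: mult.commute)
  also have "\<dots> = (\<Sum>k<?p. \<Sum>is | length is = k. ((-1) ^ length is * cnj (?I is) / fact k) * ((-1) ^ length is * f (\<lambda>y. ?b * D is (low_kernel N) y)))"
    unfolding integral_taylor_sum[OF c\<omega>] moment_part_def flip Dc ..
  also have "\<dots> = (\<Sum>k<?p. \<Sum>is | length is = k. cnj (?I is / fact k) * f (\<lambda>y. ?b * D is (low_kernel N) y))"
  proof (intro sum.cong refl)
    fix k :: nat and "is" :: "'n list"
    have "(-1) ^ length is * (-1) ^ length is = (1::complex)" by (simp add: power_mult_distrib[symmetric])
    then have "((-1) ^ length is * A / F) * ((-1) ^ length is * X) = A / F * X" for A F X :: complex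
      by (metis (no_types, lifting) mult.assoc mult.commute mult_1 times_divide_eq_left)
    then show "((-1) ^ length is * cnj (?I is) / fact k) * ((-1) ^ length is * f (\<lambda>y. ?b * D is (low_kernel N) y))
      = cnj (?I is / fact k) * f (\<lambda>y. ?b * D is (low_kernel N) y)" by simp
  qed
  also have "\<dots> = f (\<lambda>y. \<Sum>k<?p. \<Sum>is | length is = k. (?I is / fact k) * (?b * D is (low_kernel N) y))"
  proof -
    have 1: "(\<lambda>y. ?b * D is (low_kernel N) y) \<in> schwartz" for "is"
      by (intro schwartz_cmult' schwartz_D low_kernel_schwartz)
    have 2: "(\<lambda>y. (?I is / fact k) * (?b * D is (low_kernel N) y)) \<in> schwartz" for k :: nat and "is"
      by (intro schwartz_cmult'[of "\<lambda>y. ?b * D is (low_kernel N) y"] 1)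
    have 3: "(\<lambda>y. \<Sum>is | length is = k. (?I is / fact k) * (?b * D is (low_kernel N) y)) \<in> schwartz" for k
      by (intro schwartz_sum' finite_lists_length 2)
    show ?thesis
      by (simp only: antidual_sum[OF f finite_lessThan 3] antidual_sum[OF f finite_lists_length 2] antidual_cmult[OF f 1])
  qed
  also have "(\<lambda>y. \<Sum>k<?p. \<Sum>is | length is = k. (?I is / fact k) * (?b * D is (low_kernel N) y)) = (\<lambda>y. ?b * moment_part ?p ?u (low_kernel N) y)"
    by (rule ext) (simp only: moment_part_def sum_distrib_left mult.left_commute)
  finally show ?thesis .
qed

lemma low_minus_moment_part_bound:
  assumes \<omega>: "\<omega> \<in> schwartz" and f: "f \<in> tempered"
    and bound: "\<And>\<omega>. \<omega> \<in> schwartz \<Longrightarrow> cmod (f \<omega>) \<le> c * schwartz_norm d \<omega>"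
  obtains C where "\<And>N. cmod (f (smear cPhi \<omega> (2 ^ N))
      - f (\<lambda>y. of_real ((1/2) ^ (CARD('n) * N)) * moment_part p (\<lambda>z. \<omega> (- z)) (low_kernel N) y))
    \<le> C * 2 powr (- (real N * (real CARD('n) + real p - real d)))"
proof -
  note u = flip_rapid[OF \<omega>]
  from ex_smear_minus_moment_part_norm[OF u schwartz_reflect[OF Phi_schwartz, of 0], of d p]
  obtain C where C: "\<forall>b. 0 < b \<longrightarrow> b \<le> 1 \<longrightarrow>
    schwartz_norm d (\<lambda>y. smear (\<lambda>z. \<omega> (- z)) (\<lambda>x. reflect 0 (Phi \<phi> \<psi>) (b *\<^sub>R x)) 1 y
      - moment_part p (\<lambda>z. \<omega> (- z)) (\<lambda>x. reflect 0 (Phi \<phi> \<psi>) (b *\<^sub>R x)) y) \<le> C * (b ^ p / b ^ d)" ..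
  show thesis
  proof (rule that)
    fix N
    let ?B = "(1/2::real) ^ (CARD('n) * N)"
    let ?S = "smear (\<lambda>z. \<omega> (- z)) (low_kernel N) 1"
    let ?T = "moment_part p (\<lambda>z. \<omega> (- z)) (low_kernel N)"
    have S: "?S \<in> schwartz" "?T \<in> schwartz"
      by (intro schwartz_smear u low_kernel_schwartz schwartz_moment_part)+
    have e: "f (smear cPhi \<omega> (2 ^ N)) - f (\<lambda>y. of_real ?B * ?T y) = of_real ?B * f (\<lambda>y. ?S y - ?T y)"
      unfolding antidual_diff[OF f S]
      by (simp only: smear_cPhi_eq[OF \<omega>] antidual_cmult[OF f S(1)] antidual_cmult[OF f S(2)] complex_cnj_complex_of_real right_diff_distrib)
    have "cmod (f (smear cPhi \<omega> (2 ^ N)) - f (\<lambda>y. of_real ?B * ?T y)) = ?B * cmod (f (\<lambda>y. ?S y - ?T y))"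
      unfolding e norm_mult by (simp add: norm_power)
    also have "\<dots> \<le> ?B * (\<bar>c\<bar> * schwartz_norm d (\<lambda>y. ?S y - ?T y))"
    proof (intro mult_left_mono)
      have "(\<lambda>y. ?S y - ?T y) \<in> schwartz" by (intro schwartz_diff' S)
      note b = bound[OF this] and n = schwartz_norm_nonneg[OF this, of d]
      show "cmod (f (\<lambda>y. ?S y - ?T y)) \<le> \<bar>c\<bar> * schwartz_norm d (\<lambda>y. ?S y - ?T y)"
        by (rule order_trans[OF b]) (rule mult_right_mono[OF abs_ge_self n])
    qed simp
    also have "\<dots> \<le> ?B * (\<bar>c\<bar> * (C * (((1/2) ^ N) ^ p / ((1/2) ^ N) ^ d)))"
      by (intro mult_left_mono C[rule_format]) (auto simp: power_le_one)
    also have "\<dots> = (\<bar>c\<bar> * C) * 2 powr (- (real N * (real CARD('n) + real p - real d)))"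
    proof -
      have h: "(1/2::real) ^ k = 2 powr (- real k)" for k
        by (simp only: power_one_over powr_minus powr_realpow[OF zero_less_numeral] inverse_eq_divide)
      have "?B * (((1/2) ^ N) ^ p / ((1/2) ^ N) ^ d) = 2 powr (- (real N * (real CARD('n) + real p - real d)))"
        unfolding power_mult[symmetric] unfolding h powr_diff[symmetric] powr_add[symmetric]
        by (simp add: algebra_simps)
      then show ?thesis by (simp only: mult.assoc mult.left_commute)
    qed
    finally show "cmod (f (smear cPhi \<omega> (2 ^ N)) - f (\<lambda>y. of_real ?B * ?T y))
      \<le> (\<bar>c\<bar> * C) * 2 powr (- (real N * (real CARD('n) + real p - real d)))" .
  qed
qed

end

section \<open>Functions with vanishing moments\<close>

lemma Zspace_schwartz: "\<omega> \<in> Zspace \<Longrightarrow> \<omega> \<in> schwartz"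
  by (simp add: Zspace_def)

lemma Zspace_rapid: "\<omega> \<in> Zspace \<Longrightarrow> rapid \<omega>"
  by (intro schwartz_rapid Zspace_schwartz)

lemma Zspace_iff:
  "\<omega> \<in> Zspace \<longleftrightarrow> \<omega> \<in> schwartz \<and> (\<forall>is. (\<integral>x. \<omega> x * of_real (lpow x is) \<partial>lborel) = 0)"
proof -
  have "(\<forall>\<alpha>. (\<integral>x. of_real (mpower x \<alpha>) * \<omega> x \<partial>lborel) = 0) \<longleftrightarrow> (\<forall>is. (\<integral>x. \<omega> x * of_real (lpow x is) \<partial>lborel) = 0)"
  proof (intro iffI allI)
    fix "is" assume "\<forall>\<alpha>. (\<integral>x. of_real (mpower x \<alpha>) * \<omega> x \<partial>lborel) = 0"
    then have "(\<integral>x. of_real (mpower x (count_list is)) * \<omega> x \<partial>lborel) = 0" by blast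
    then show "(\<integral>x. \<omega> x * of_real (lpow x is) \<partial>lborel) = 0" by (simp only: mpower_count_list mult.commute)
  next
    fix \<alpha> :: "'a \<Rightarrow> nat" assume *: "\<forall>is. (\<integral>x. \<omega> x * of_real (lpow x is) \<partial>lborel) = 0"
    obtain js where "count_list js = \<alpha>" by (rule ex_count_list_eq)
    then have "mpower x \<alpha> = lpow x js" for x :: "real^'a" using mpower_count_list[of x js] by simp
    then show "(\<integral>x. of_real (mpower x \<alpha>) * \<omega> x \<partial>lborel) = 0" using * by (simp add: mult.commute)
  qed
  then show ?thesis by (simp add: Zspace_def)
qed

lemma Zspace_moment: "\<omega> \<in> Zspace \<Longrightarrow> (\<integral>x. \<omega> x * of_real (lpow x is) \<partial>lborel) = 0"
  by (simp add: Zspace_iff)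

lemma Zspace_add:
  assumes "v \<in> Zspace" "w \<in> Zspace"
  shows "(\<lambda>x. v x + w x) \<in> Zspace"
  unfolding Zspace_iff distrib_right
  using integrable_lpow[OF Zspace_rapid[OF assms(1)]] integrable_lpow[OF Zspace_rapid[OF assms(2)]]
    schwartz_add'[OF Zspace_schwartz[OF assms(1)] Zspace_schwartz[OF assms(2)]]
    Zspace_moment[OF assms(1)] Zspace_moment[OF assms(2)]
  by simp

lemma Zspace_cmult: "w \<in> Zspace \<Longrightarrow> (\<lambda>x. a * w x) \<in> Zspace"
  unfolding Zspace_iff by (auto simp: schwartz_cmult' mult.assoc)

lemma Zspace_flip:
  assumes "\<omega> \<in> Zspace"
  shows "(\<lambda>x. \<omega> (- x)) \<in> Zspace"
  unfolding Zspace_iff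
proof (intro conjI allI)
  show "(\<lambda>x. \<omega> (- x)) \<in> schwartz"
    using schwartz_affine[OF Zspace_schwartz[OF assms], of "-1" 0] by simp
  fix "is"
  let ?F = "\<lambda>x. (-1) ^ length is * (\<omega> x * of_real (lpow x is))"
  have "integrable lborel ?F" by (intro integrable_mult_right integrable_lpow Zspace_rapid assms)
  then have "(\<integral>x. ?F ((-1) *\<^sub>R x + 0) \<partial>lborel) = (1 / \<bar>-1\<bar> ^ CARD('a)) *\<^sub>R (\<integral>x. ?F x \<partial>lborel)"
    by (intro integral_affine) auto
  moreover have "?F ((-1) *\<^sub>R x + 0) = \<omega> (- x) * of_real (lpow x is)" for x
  proof -
    let ?m = "(-1) ^ length is :: complex"
    have l: "complex_of_real (lpow ((-1) *\<^sub>R x + 0) is) = ?m * of_real (lpow x is)"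
      using lpow_scaleR[of "-1" x "is"] by simp
    have "?m * (A * (?m * L)) = (?m * ?m) * (A * L)" for A L by (simp only: mult_ac)
    moreover have "?m * ?m = 1" by (simp add: power_mult_distrib[symmetric])
    ultimately show ?thesis unfolding l by simp
  qed
  ultimately have "(\<integral>x. \<omega> (- x) * of_real (lpow x is) \<partial>lborel) = (1 / \<bar>-1\<bar> ^ CARD('a)) *\<^sub>R (\<integral>x. ?F x \<partial>lborel)"
    by (simp only:)
  also have "(\<integral>x. ?F x \<partial>lborel) = 0"
    unfolding integral_mult_right_zero Zspace_moment[OF assms] by simp
  finally show "(\<integral>x. \<omega> (- x) * of_real (lpow x is) \<partial>lborel) = 0" by simp
qed

lemma moment_part_Zspace: "u \<in> Zspace \<Longrightarrow> moment_part p u g y = 0"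
  by (simp add: moment_part_def Zspace_moment)

lemma
  assumes "g \<in> schwartz"
  shows schwartz_times_lpow: "(\<lambda>x. of_real (lpow x is) * g x) \<in> schwartz"
    and D_fourier: "D is (fourier g) = (\<lambda>\<xi>. (- \<i>) ^ length is * fourier (\<lambda>x. of_real (lpow x is) * g x) \<xi>)"
proof -
  have *: "(\<lambda>x. of_real (lpow x (i # is)) * g x) = (\<lambda>x. of_real (x $ i) * (of_real (lpow x is) * g x))" for i and "is" :: "'a list"
    by (simp add: mult.assoc)
  show s: "(\<lambda>x. of_real (lpow x is) * g x) \<in> schwartz" for "is"
  proof (induction "is")
    case (Cons i "is")
    show ?case unfolding * by (rule schwartz_times_component[OF Cons])
  qed (simp add: assms)
  show "D is (fourier g) = (\<lambda>\<xi>. (- \<i>) ^ length is * fourier (\<lambda>x. of_real (lpow x is) * g x) \<xi>)"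
  proof (induction "is")
    case (Cons i "is")
    let ?F = "\<lambda>x. of_real (lpow x is) * g x"
    have "D (i # is) (fourier g) = partial_deriv i (\<lambda>\<xi>. (- \<i>) ^ length is * fourier ?F \<xi>)"
      using Cons by simp
    also have "\<dots> = (\<lambda>\<xi>. (- \<i>) ^ length is * partial_deriv i (fourier ?F) \<xi>)"
      using D_cmult[OF schwartz_fourier[OF s], of "[i]" "(- \<i>) ^ length is" "is"] by simp
    also have "\<dots> = (\<lambda>\<xi>. (- \<i>) ^ length is * (- \<i> * fourier (\<lambda>x. of_real (x $ i) * ?F x) \<xi>))"
      unfolding partial_deriv_fourier[OF s] fourier_cmult ..
    finally show ?case unfolding * by (simp add: mult_ac)
  qed simp
qed

text \<open>The moments of g are, up to powers of i, the derivatives of its transform at 0, and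
  these vanish when the transform is zero near 0.\<close>

lemma Zspace_of_fourier_vanishing:
  fixes g :: "real^'n::finite \<Rightarrow> complex"
  assumes "g \<in> schwartz" "0 < K" "\<And>\<xi>. norm \<xi> < K \<Longrightarrow> fourier g \<xi> = 0"
  shows "g \<in> Zspace"
  unfolding Zspace_iff
proof (intro conjI allI assms(1))
  fix js :: "'n list"
  have o: "open {\<xi>::real^'n. norm \<xi> < K}" by (intro open_Collect_less continuous_intros)
  have "D is (fourier g) \<xi> = 0" if "norm \<xi> < K" for "is" \<xi>
    using that
  proof (induction "is" arbitrary: \<xi>)
    case (Cons i "is")
    have "partial_deriv i (D is (fourier g)) \<xi> = partial_deriv i (\<lambda>x. 0) \<xi>"
      by (rule partial_deriv_local[OF o, where f = "\<lambda>x. 0"]) (use Cons in auto)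
    also have "partial_deriv i (\<lambda>x. 0) \<xi> = 0" by (simp add: partial_deriv_def)
    finally show ?case by (simp only: foldr.simps comp_apply)
  qed (simp add: assms(3))
  then have "fourier (\<lambda>x. of_real (lpow x js) * g x) 0 = 0"
    using fun_cong[OF D_fourier[OF assms(1), of js], of 0] assms(2) by simp
  then show "(\<integral>x. g x * of_real (lpow x js) \<partial>lborel) = 0" by (simp add: fourier_def mult.commute)
qed

text \<open>The Taylor polynomial of g at a, in the increment s z, integrates to zero against h. So
  the average equals that of the remainder, which is of order s^p with p at will.\<close>

lemma smear_Zspace_decay:
  fixes h g :: "real^'n::finite \<Rightarrow> complex"
  assumes h: "h \<in> Zspace" and g: "g \<in> schwartz"
  shows "\<exists>C\<ge>0. \<forall>s a. 0 \<le> s \<longrightarrow> s \<le> 1 \<longrightarrow> cmod (smear h g s a) \<le> C * s ^ p / (1 + norm a) ^ M"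
proof -
  obtain B where B: "B \<ge> 0" "\<And>y h. cmod (g (y + h) - taylor_sum p g y h) \<le> B * norm h ^ p * (1 + norm h) ^ M / (1 + norm y) ^ M"
    using schwartz_taylor_remainder[OF g, of p M] by blast
  have rh: "rapid h" by (rule Zspace_rapid[OF h])
  have "cmod (smear h g s a) \<le> (moment h (p + M) * B) * s ^ p / (1 + norm a) ^ M" if s: "0 \<le> s" "s \<le> 1" for s a
  proof -
    have eq: "h z * taylor_sum p g a (s *\<^sub>R z) = (\<Sum>k<p. \<Sum>is | length is = k. (D is g a / fact k * of_real (s ^ length is)) * (h z * of_real (lpow z is)))" for z
      by (simp add: taylor_sum_alt lpow_scaleR sum_distrib_left mult_ac)
    have "has_bochner_integral lborel (\<lambda>z. c * (h z * of_real (lpow z is))) 0" for c and "is" :: "'n list"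
      using integrable_lpow[OF rh, of "is"] by (simp add: has_bochner_integral_iff Zspace_moment[OF h])
    then have "has_bochner_integral lborel (\<lambda>z. h z * taylor_sum p g a (s *\<^sub>R z)) (\<Sum>k<p. \<Sum>is | length (is :: 'n list) = k. 0)"
      unfolding eq by (intro has_bochner_integral_sum)
    then have T: "integrable lborel (\<lambda>z. h z * taylor_sum p g a (s *\<^sub>R z))" "(\<integral>z. h z * taylor_sum p g a (s *\<^sub>R z) \<partial>lborel) = 0"
      by (auto simp: has_bochner_integral_iff)
    have "smear h g s a = (\<integral>z. h z * g (a + s *\<^sub>R z) \<partial>lborel) - (\<integral>z. h z * taylor_sum p g a (s *\<^sub>R z) \<partial>lborel)"
      by (simp add: smear_def T(2))
    also have "\<dots> = (\<integral>z. h z * g (a + s *\<^sub>R z) - h z * taylor_sum p g a (s *\<^sub>R z) \<partial>lborel)"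
      by (rule Bochner_Integration.integral_diff[symmetric]) (intro integrable_smear rh g T(1))+
    also have "cmod \<dots> \<le> (\<integral>z. cmod (h z) * (1 + norm z) ^ (p + M) * (B * s ^ p / (1 + norm a) ^ M) \<partial>lborel)"
    proof (rule cmod_integral_le)
      show "integrable lborel (\<lambda>z. cmod (h z) * (1 + norm z) ^ (p + M) * (B * s ^ p / (1 + norm a) ^ M))"
        by (intro integrable_mult_left integrable_rapid_weight rh)
      fix z :: "real^'n"
      have sz: "norm (s *\<^sub>R z) \<le> s * (1 + norm z)" "norm (s *\<^sub>R z) \<le> norm z"
        using s by (auto intro: mult_left_le_one_le mult_left_mono)
      have "cmod (g (a + s *\<^sub>R z) - taylor_sum p g a (s *\<^sub>R z)) \<le> B * norm (s *\<^sub>R z) ^ p * (1 + norm (s *\<^sub>R z)) ^ M / (1 + norm a) ^ M" by (rule B)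
      also have "\<dots> \<le> B * (s * (1 + norm z)) ^ p * (1 + norm z) ^ M / (1 + norm a) ^ M"
        using sz s B(1) by (intro divide_right_mono mult_mono mult_left_mono power_mono mult_nonneg_nonneg) auto
      also have "\<dots> = (1 + norm z) ^ (p + M) * (B * s ^ p / (1 + norm a) ^ M)"
        by (simp add: power_mult_distrib power_add)
      finally have "cmod (h z) * cmod (g (a + s *\<^sub>R z) - taylor_sum p g a (s *\<^sub>R z)) \<le> cmod (h z) * ((1 + norm z) ^ (p + M) * (B * s ^ p / (1 + norm a) ^ M))"
        by (intro mult_left_mono) auto
      then show "cmod (h z * g (a + s *\<^sub>R z) - h z * taylor_sum p g a (s *\<^sub>R z)) \<le> cmod (h z) * (1 + norm z) ^ (p + M) * (B * s ^ p / (1 + norm a) ^ M)"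
        unfolding right_diff_distrib[symmetric] norm_mult mult.assoc .
    qed
    also have "\<dots> = moment h (p + M) * (B * s ^ p / (1 + norm a) ^ M)"
      unfolding moment_def by (rule integral_mult_left_zero)
    finally show ?thesis by simp
  qed
  moreover have "0 \<le> moment h (p + M) * B" by (intro mult_nonneg_nonneg moment_nonneg B)
  ultimately show ?thesis by blast
qed

lemma pairing_polynomial_Zspace:
  fixes \<omega> :: "real^'n::finite \<Rightarrow> complex"
  assumes p: "polynomial_function p" and \<omega>: "\<omega> \<in> Zspace"
  shows "pairing p \<omega> = 0"
proof -
  \<comment> \<open>Strengthened for the induction over polynomials: all monomials are included, so
    that a linear factor can be absorbed into them, and I is shown for q g from I for g with g
    arbitrary, so that products compose. \<open>has_bochner_integral\<close> carries the
    integrability along.\<close>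
  define I where "I g \<longleftrightarrow> (\<forall>is. has_bochner_integral lborel (\<lambda>x. of_real (lpow x is) * (of_real (g x) * cnj (\<omega> x))) 0)" for g :: "real^'n \<Rightarrow> real"
  have "I (\<lambda>x. q x * g x)" if "real_polynomial_function q" "I g" for q g
    using that
  proof (induction q arbitrary: g rule: real_polynomial_function.induct)
    case (linear q)
    then interpret bounded_linear q by simp
    have q: "q x = (\<Sum>i\<in>UNIV. x $ i * q (axis i 1))" for x
      using basis_expansion[of x] sum[of "\<lambda>i. (x $ i) *\<^sub>R axis i 1" UNIV]
      by (simp add: scalar_mult_eq_scaleR scaleR)
    show ?case
      unfolding I_def
    proof
      fix "is"
      have "has_bochner_integral lborel (\<lambda>x. of_real (q (axis i 1)) * (of_real (lpow x (i # is)) * (of_real (g x) * cnj (\<omega> x)))) (of_real (q (axis i 1)) * 0)" for i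
        using linear.prems unfolding I_def by (intro has_bochner_integral_mult_right) blast
      then have "has_bochner_integral lborel (\<lambda>x. \<Sum>i\<in>UNIV. of_real (q (axis i 1)) * (of_real (lpow x (i # is)) * (of_real (g x) * cnj (\<omega> x)))) (\<Sum>i\<in>(UNIV :: 'n set). of_real (q (axis i 1)) * 0)"
        by (intro has_bochner_integral_sum)
      moreover have "(\<Sum>i\<in>UNIV. of_real (q (axis i 1)) * (of_real (lpow x (i # is)) * (of_real (g x) * cnj (\<omega> x))))
        = of_real (lpow x is) * (of_real (q x * g x) * cnj (\<omega> x))" for x
        unfolding q[of x] by (simp add: sum_distrib_left sum_distrib_right mult_ac)
      ultimately show "has_bochner_integral lborel (\<lambda>x. of_real (lpow x is) * (of_real (q x * g x) * cnj (\<omega> x))) 0" by simp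
    qed
  next
    case (const c)
    show ?case unfolding I_def
    proof
      fix "is"
      have "has_bochner_integral lborel (\<lambda>x. of_real c * (of_real (lpow x is) * (of_real (g x) * cnj (\<omega> x)))) (of_real c * 0)"
        using const unfolding I_def by (intro has_bochner_integral_mult_right) blast
      then show "has_bochner_integral lborel (\<lambda>x. of_real (lpow x is) * (of_real (c * g x) * cnj (\<omega> x))) 0"
        by (simp add: mult_ac)
    qed
  next
    case (add q r)
    show ?case unfolding I_def
    proof
      fix "is"
      have "has_bochner_integral lborel (\<lambda>x. of_real (lpow x is) * (of_real (q x * g x) * cnj (\<omega> x)) + of_real (lpow x is) * (of_real (r x * g x) * cnj (\<omega> x))) (0 + 0)"
        using add.IH(1)[OF add.prems] add.IH(2)[OF add.prems] unfolding I_def by (intro has_bochner_integral_add) blast+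
      then show "has_bochner_integral lborel (\<lambda>x. of_real (lpow x is) * (of_real ((q x + r x) * g x) * cnj (\<omega> x))) 0"
        by (simp add: algebra_simps)
    qed
  next
    case (mult q r)
    from mult.IH(1)[OF mult.IH(2)[OF mult.prems]] show ?case by (simp only: mult.assoc)
  qed
  moreover have "I (\<lambda>x. 1)"
    unfolding I_def
  proof
    fix "is"
    have 1: "integrable lborel (\<lambda>x. \<omega> x * of_real (lpow x is))" by (intro integrable_lpow Zspace_rapid \<omega>)
    have "(\<integral>x. cnj (\<omega> x * of_real (lpow x is)) \<partial>lborel) = 0"
      unfolding Bochner_Integration.integral_cnj Zspace_moment[OF \<omega>] by simp
    then have "has_bochner_integral lborel (\<lambda>x. cnj (\<omega> x * of_real (lpow x is))) 0"
      using 1 by (simp only: has_bochner_integral_iff integrable_cnj)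
    then show "has_bochner_integral lborel (\<lambda>x. of_real (lpow x is) * (of_real 1 * cnj (\<omega> x))) 0"
      by (simp add: mult.commute)
  qed
  ultimately have I: "I q" if "real_polynomial_function q" for q
    using that by fastforce
  have H: "has_bochner_integral lborel (\<lambda>x. of_real (q x) * cnj (\<omega> x)) 0" if "real_polynomial_function q" for q
  proof -
    have "has_bochner_integral lborel (\<lambda>x. of_real (lpow x []) * (of_real (q x) * cnj (\<omega> x))) 0"
      using I[OF that] unfolding I_def by (rule spec)
    then show ?thesis by simp
  qed
  have R: "real_polynomial_function (\<lambda>x. Re (p x))" "real_polynomial_function (\<lambda>x. Im (p x))"
    using p bounded_linear_Re bounded_linear_Im unfolding polynomial_function_def comp_def by blast+
  have "has_bochner_integral lborel (\<lambda>x. of_real (Re (p x)) * cnj (\<omega> x) + \<i> * (of_real (Im (p x)) * cnj (\<omega> x))) (0 + \<i> * 0)"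
    by (intro has_bochner_integral_add has_bochner_integral_mult_right H R)
  moreover have "of_real (Re (p x)) * cnj (\<omega> x) + \<i> * (of_real (Im (p x)) * cnj (\<omega> x)) = p x * cnj (\<omega> x)" for x
    unfolding mult.assoc[symmetric] distrib_right[symmetric] complex_eq[symmetric] ..
  ultimately show ?thesis
    unfolding pairing_def by (simp add: has_bochner_integral_integral_eq)
qed

lemma tempered_pairing:
  fixes q :: "real^'n::finite \<Rightarrow> complex"
  assumes q: "q \<in> borel_measurable borel" "\<And>x. cmod (q x) \<le> K * (1 + norm x) ^ p"
  shows "(\<lambda>\<omega>\<in>schwartz. pairing q \<omega>) \<in> tempered"
proof (rule temperedI)
  have K: "0 \<le> K" using order_trans[OF norm_ge_zero q(2)[of 0]] by simp
  have int: "integrable lborel (\<lambda>x. q x * cnj (\<omega> x))" if "\<omega> \<in> schwartz" for \<omega>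
    using integrable_rapid_mult[OF schwartz_rapid[OF schwartz_cnj'[OF that]] q] by (simp add: mult.commute)
  fix v w :: "real^'n \<Rightarrow> complex" and a
  assume v: "v \<in> schwartz"
  show "pairing q (\<lambda>x. a * v x) = cnj a * pairing q v"
    by (simp add: pairing_def mult.left_commute)
  \<comment> \<open>p orders of the weight compensate the growth of q, the other 2 n make the
    integrand integrable.\<close>
  let ?d = "2 * CARD('n) + p"
  let ?c = "K * (\<integral>x. 1 / (1 + norm x) ^ (2 * CARD('n)) \<partial>(lborel :: (real^'n) measure))"
  have "cmod (pairing q v) \<le> (\<integral>x. (K * schwartz_norm ?d v) * (1 / (1 + norm x) ^ (2 * CARD('n))) \<partial>(lborel :: (real^'n) measure))"
    unfolding pairing_def
  proof (rule cmod_integral_le)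
    show "integrable lborel (\<lambda>x::real^'n. (K * schwartz_norm ?d v) * (1 / (1 + norm x) ^ (2 * CARD('n))))"
      by (intro integrable_mult_right integrable_inverse_power_norm)
    fix x
    have "(1 + norm x) ^ ?d * cmod (v x) \<le> schwartz_norm ?d v"
      using schwartz_norm_bound[OF v, of "[]" ?d x] by simp
    then have "cmod (v x) \<le> schwartz_norm ?d v / (1 + norm x) ^ ?d" by (simp add: pos_le_divide_eq mult.commute)
    then have "cmod (q x) * cmod (v x) \<le> (K * (1 + norm x) ^ p) * (schwartz_norm ?d v / (1 + norm x) ^ ?d)"
      using q(2) K by (intro mult_mono) auto
    then show "cmod (q x * cnj (v x)) \<le> (K * schwartz_norm ?d v) * (1 / (1 + norm x) ^ (2 * CARD('n)))"
      by (simp add: norm_mult power_add)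
  qed
  also have "\<dots> = ?c * schwartz_norm ?d v" unfolding integral_mult_right_zero by simp
  finally show "cmod (pairing q v) \<le> ?c * schwartz_norm ?d v" .
  assume w: "w \<in> schwartz"
  show "pairing q (\<lambda>x. v x + w x) = pairing q v + pairing q w"
    using int[OF v] int[OF w] by (simp add: pairing_def distrib_left)
qed

lemma tempered_pairing_taylor_poly:
  fixes g :: "real^'n::finite \<Rightarrow> complex"
  assumes "smooth g"
  shows "(\<lambda>\<omega>\<in>schwartz. pairing (taylor_poly m g) \<omega>) \<in> tempered"
proof -
  let ?p = "nat (m + 1)"
  have eq: "taylor_poly m g x = taylor_sum ?p g 0 x" for x by (rule taylor_poly_eq_taylor_sum[OF assms])
  let ?K = "\<Sum>k<?p. \<Sum>is | length (is :: 'n list) = k. cmod (D is g 0)"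
  have cont: "continuous_on UNIV (\<lambda>x::real^'n. complex_of_real (lpow x is))" for "is"
    by (induction "is") (auto intro!: continuous_intros)
  have "continuous_on UNIV (taylor_poly m g)"
    unfolding eq[abs_def] taylor_sum_alt by (intro continuous_intros cont) auto
  then have meas: "taylor_poly m g \<in> borel_measurable borel" by (rule borel_measurable_continuous_onI)
  have "cmod (taylor_poly m g x) \<le> ?K * (1 + norm x) ^ ?p" for x
    unfolding eq taylor_sum_alt sum_distrib_right
  proof (intro sum_norm_le)
    fix k "is" assume k: "k \<in> {..<?p}" "is \<in> {is :: 'n list. length is = k}"
    have "\<bar>lpow x is\<bar> \<le> norm x ^ k" using abs_lpow_le[of x "is"] k by simp
    also have "\<dots> \<le> (1 + norm x) ^ k" by (intro power_mono) auto
    also have "\<dots> \<le> (1 + norm x) ^ ?p" using k by (intro one_add_norm_power_mono) auto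
    finally have l: "\<bar>lpow x is\<bar> \<le> (1 + norm x) ^ ?p" .
    have "\<bar>lpow x is\<bar> / fact k \<le> \<bar>lpow x is\<bar>" by (simp add: divide_le_eq mult_left_le fact_ge_1 mult_le_cancel_left1)
    with l have "\<bar>lpow x is\<bar> / fact k \<le> (1 + norm x) ^ ?p" by linarith
    then have "\<bar>lpow x is\<bar> / fact k * cmod (D is g 0) \<le> (1 + norm x) ^ ?p * cmod (D is g 0)"
      by (intro mult_right_mono) auto
    then show "cmod (of_real (lpow x is) / fact k * D is g 0) \<le> cmod (D is g 0) * (1 + norm x) ^ ?p"
      by (simp add: norm_mult norm_divide mult.commute)
  qed
  from tempered_pairing[OF meas this] show ?thesis .
qed

lemma min_inverse_cases:
  assumes "(a::real) > 0"
  obtains "1 \<le> a" "min a (1 / a) = 1 / a" | "a \<le> 1" "min a (1 / a) = a"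
proof (cases "1 \<le> a")
  case True
  then have "1 / a \<le> a" using assms by (simp add: divide_simps) (metis mult_mono' mult_1 zero_le_one)
  then show ?thesis using that(1) True by auto
next
  case False
  then have "a \<le> 1 / a" using assms by (simp add: divide_simps mult_le_one)
  then show ?thesis using that(2) False by auto
qed

lemma max_times_max_inverse:
  assumes "(a::real) > 0"
  shows "max 1 a * max 1 (1 / a) = 1 / min a (1 / a)"
  using assms
proof (cases rule: min_inverse_cases)
  case 1
  then have "max 1 a = a" "max 1 (1 / a) = 1" by auto
  then show ?thesis by (simp only: 1(2); simp)
next
  case 2
  then have "max 1 a = 1" "max 1 (1 / a) = 1 / a" using assms by auto
  then show ?thesis by (simp only: 2(2); simp)
qed

section \<open>Unconditional convergence on \<open>Zspace\<close>\<close>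

context frame_pair
begin

lemma c\<psi>_Zspace: "(\<lambda>x. cnj (\<psi> x)) \<in> Zspace"
  by (rule Zspace_of_fourier_vanishing[OF schwartz_cnj'[OF \<psi>] K0]) (use \<psi>_supp in \<open>force simp: fourier_cnj\<close>)

text \<open>The substitution z = a x - y moves the dilation from \<omega> to \<psi>; for small a it
  is \<psi> that varies slowly and can be expanded against the vanishing moments of
  \<omega>.\<close>

lemma coef_alt:
  assumes "\<omega> \<in> schwartz" "a > 0"
  shows "coef a \<omega> y = of_real (a ^ CARD('n)) * smear \<omega> (\<lambda>x. cnj (\<psi> x)) a (- y)"
proof -
  let ?F = "\<lambda>z. cnj (\<psi> z) * \<omega> ((1 / a) *\<^sub>R (y + 1 *\<^sub>R z))"
  have [measurable]: "\<omega> \<in> borel_measurable borel" "\<psi> \<in> borel_measurable borel"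
    by (intro schwartz_measurable assms \<psi>)+
  have "(\<lambda>z. cnj (\<psi> z)) \<in> borel_measurable borel" by (intro schwartz_measurable schwartz_cnj' \<psi>)
  then have m: "?F \<in> borel_measurable borel" by measurable
  have "(\<integral>x. ?F (a *\<^sub>R x + (- y)) \<partial>lborel) = (1 / \<bar>a\<bar> ^ CARD('n)) *\<^sub>R (\<integral>z. ?F z \<partial>lborel)"
    by (rule integral_affine[OF _ m]) (use assms in simp)
  moreover have "?F (a *\<^sub>R x + (- y)) = \<omega> x * cnj (\<psi> (- y + a *\<^sub>R x))" for x
    using assms(2) by (simp add: mult.commute)
  ultimately have "smear \<omega> (\<lambda>x. cnj (\<psi> x)) a (- y) = (1 / \<bar>a\<bar> ^ CARD('n)) *\<^sub>R coef a \<omega> y"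
    unfolding smear_def coef_def by (simp only:)
  then show ?thesis using assms(2) by (simp add: scaleR_conv_of_real)
qed

text \<open>For a >= 1 the vanishing moments of \<psi> act on the expansion of \<omega> at scale 1 /
  a, and M extra orders pay for passing from the weight at y / a to the weight at y. For a <= 1 the
  roles are exchanged by \<open>coef_alt\<close>, where the weight already stands at y.\<close>

lemma coef_decay:
  assumes \<omega>: "\<omega> \<in> Zspace"
  shows "\<exists>C\<ge>0. \<forall>a y. 0 < a \<longrightarrow> cmod (coef a \<omega> y) \<le> C * (min a (1 / a)) ^ q / (1 + norm y) ^ M"
proof -
  note \<omega>S = Zspace_schwartz[OF \<omega>]
  obtain C1 where C1: "C1 \<ge> 0" "\<forall>s y. 0 \<le> s \<longrightarrow> s \<le> 1 \<longrightarrow> cmod (smear (\<lambda>x. cnj (\<psi> x)) \<omega> s y) \<le> C1 * s ^ (q + M) / (1 + norm y) ^ M"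
    using smear_Zspace_decay[OF c\<psi>_Zspace \<omega>S, of "q + M" M] by blast
  obtain C2 where C2: "C2 \<ge> 0" "\<forall>s y. 0 \<le> s \<longrightarrow> s \<le> 1 \<longrightarrow> cmod (smear \<omega> (\<lambda>x. cnj (\<psi> x)) s y) \<le> C2 * s ^ q / (1 + norm y) ^ M"
    using smear_Zspace_decay[OF \<omega> schwartz_cnj'[OF \<psi>], of q M] by blast
  have "cmod (coef a \<omega> y) \<le> (C1 + C2) * (min a (1 / a)) ^ q / (1 + norm y) ^ M" if a: "0 < a" for a y
    using a
  proof (cases rule: min_inverse_cases)
    case 1
    let ?s = "1 / a"
    have s: "0 < ?s" "?s \<le> 1" using 1 a by auto
    have "coef a \<omega> y = smear (\<lambda>x. cnj (\<psi> x)) \<omega> ?s (?s *\<^sub>R y)"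
      by (simp add: coef_def smear_def scaleR_add_right)
    also have "cmod \<dots> \<le> C1 * ?s ^ (q + M) / (1 + norm (?s *\<^sub>R y)) ^ M"
      by (rule C1(2)[rule_format]) (use s in auto)
    also have "\<dots> \<le> C1 * ?s ^ (q + M) / (?s * (1 + norm y)) ^ M"
    proof (intro divide_left_mono power_mono)
      show "?s * (1 + norm y) \<le> 1 + norm (?s *\<^sub>R y)" using s by (simp add: distrib_left)
    qed (use s C1(1) in \<open>auto intro!: mult_pos_pos zero_less_power simp: add_pos_nonneg\<close>)
    also have "\<dots> = C1 * ?s ^ q / (1 + norm y) ^ M"
      using a by (simp add: power_add power_mult_distrib power_divide)
    also have "\<dots> \<le> (C1 + C2) * ?s ^ q / (1 + norm y) ^ M"
      using C1(1) C2(1) s by (intro divide_right_mono mult_right_mono) auto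
    finally show ?thesis using 1 by simp
  next
    case 2
    have "cmod (coef a \<omega> y) = a ^ CARD('n) * cmod (smear \<omega> (\<lambda>x. cnj (\<psi> x)) a (- y))"
      unfolding coef_alt[OF \<omega>S a] norm_mult norm_of_real using a by simp
    also have "\<dots> \<le> 1 * (C2 * a ^ q / (1 + norm (- y)) ^ M)"
      using C2(2)[rule_format, of a "- y"] 2 a by (intro mult_mono power_le_one) auto
    also have "\<dots> \<le> (C1 + C2) * a ^ q / (1 + norm y) ^ M"
      using C1(1) C2(1) a unfolding mult_1 norm_minus_cancel by (intro divide_right_mono mult_right_mono) auto
    finally show ?thesis using 2 by simp
  qed
  then show ?thesis using C1(1) C2(1) by (intro exI[of _ "C1 + C2"]) auto
qed

text \<open>The function \<omega>(- z) has vanishing moments, so the Taylor part is zero. With d + 1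
  orders the remainder is bounded by a multiple of 2^(-N (n + 1)), whatever d is.\<close>

lemma low_tendsto_0:
  assumes f: "f \<in> tempered" and \<omega>: "\<omega> \<in> Zspace"
  shows "(\<lambda>N. f (smear cPhi \<omega> (2 ^ N))) \<longlonglongrightarrow> 0"
proof -
  note \<omega>S = Zspace_schwartz[OF \<omega>]
  obtain c d where c: "c \<ge> 0" "\<And>\<omega>. \<omega> \<in> schwartz \<Longrightarrow> cmod (f \<omega>) \<le> c * schwartz_norm d \<omega>"
    by (rule tempered_bound[OF f]) blast
  have f0: "f (\<lambda>y. 0) = 0" using antidual_cmult[OF f schwartz_zero, of 0] by simp
  have "\<exists>C. \<forall>N. cmod (f (smear cPhi \<omega> (2 ^ N))
      - f (\<lambda>y. of_real ((1/2) ^ (CARD('n) * N)) * moment_part (Suc d) (\<lambda>z. \<omega> (- z)) (low_kernel N) y))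
    \<le> C * 2 powr (- (real N * (real CARD('n) + real (Suc d) - real d)))"
    by (rule low_minus_moment_part_bound[OF \<omega>S f c(2), where p = "Suc d"], assumption, intro exI allI)
  then obtain C where "\<forall>N. cmod (f (smear cPhi \<omega> (2 ^ N))
      - f (\<lambda>y. of_real ((1/2) ^ (CARD('n) * N)) * moment_part (Suc d) (\<lambda>z. \<omega> (- z)) (low_kernel N) y))
    \<le> C * 2 powr (- (real N * (real CARD('n) + real (Suc d) - real d)))" ..
  then have C: "cmod (f (smear cPhi \<omega> (2 ^ N))) \<le> C * 2 powr (- (real N * (real CARD('n) + 1)))" for N
    by (simp add: moment_part_Zspace[OF Zspace_flip[OF \<omega>]] f0)
  have eq: "(2::real) powr (- (real N * (real CARD('n) + 1))) = (2 powr (- (real CARD('n) + 1))) ^ N" for N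
    by (simp add: powr_power algebra_simps)
  have "(\<lambda>N. C * (2 powr (- (real CARD('n) + 1))) ^ N) \<longlonglongrightarrow> C * 0"
  proof (intro tendsto_mult tendsto_const LIMSEQ_realpow_zero)
    show "2 powr (- (real CARD('n) + 1)) < (1::real)" using powr_less_mono[of "- (real CARD('n) + 1)" 0 2] by simp
  qed simp
  then have lim: "(\<lambda>N. C * (2 powr (- (real CARD('n) + 1))) ^ N) \<longlonglongrightarrow> 0" by simp
  show ?thesis
  proof (rule Lim_null_comparison[OF _ lim])
    show "\<forall>\<^sub>F N in sequentially. norm (f (smear cPhi \<omega> (2 ^ N))) \<le> C * (2 powr (- (real CARD('n) + 1))) ^ N"
      using C unfolding eq by (intro always_eventually allI)
  qed
qed

text \<open>The levels from 0 on are those summed in \<open>level_sums\<close> with N = 0; below 0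
  they telescope, the level -(N + 1) being the difference of the low-frequency parts at scales 2^N
  and 2^(N + 1).\<close>

lemma level_partial_sum:
  assumes f: "f \<in> tempered" and \<omega>: "\<omega> \<in> schwartz"
  shows "(\<Sum>\<nu>\<in>{- int N..<int N}. f (level (2 powi \<nu>) \<omega>))
    = (\<Sum>j<N. f (level (2 powi (int j - int 0)) \<omega>)) + f (smear cPhi \<omega> (2 ^ 0)) - f (smear cPhi \<omega> (2 ^ N))"
proof (induction N)
  case (Suc N)
  have set: "{- int (Suc N)..<int (Suc N)} = insert (- int (Suc N)) (insert (int N) {- int N..<int N})" by auto
  have a: "(2::real) powi (- int (Suc N)) = 1 / 2 ^ Suc N"
    unfolding power_int_minus power_int_of_nat by (rule inverse_eq_divide)
  have "f (level (2 powi (- int (Suc N))) \<omega>) = f (smear cPhi \<omega> (2 ^ N)) - f (smear cPhi \<omega> (2 ^ Suc N))"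
    unfolding a by (subst level_eq[OF \<omega>]) (simp_all add: antidual_diff[OF f] schwartz_smear cPhi_rapid \<omega>)
  then show ?case unfolding set using Suc by simp
qed simp

lemma summable_half_powers: "(\<lambda>\<nu>::int. (1/2::real) ^ nat \<bar>\<nu>\<bar>) summable_on UNIV"
proof -
  have g: "(\<lambda>n::nat. (1/2::real) ^ n) summable_on UNIV"
    by (intro norm_summable_imp_summable_on) (simp add: norm_power summable_geometric)
  have "UNIV = range int \<union> range (\<lambda>n. - int n)"
  proof (intro equalityI subsetI)
    fix \<nu> :: int show "\<nu> \<in> range int \<union> range (\<lambda>n. - int n)" by (cases \<nu> rule: int_cases2) auto
  qed simp
  moreover have "(\<lambda>\<nu>::int. (1/2::real) ^ nat \<bar>\<nu>\<bar>) summable_on range int"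
    by (subst summable_on_reindex) (use g in \<open>auto simp: comp_def\<close>)
  moreover have "(\<lambda>\<nu>::int. (1/2::real) ^ nat \<bar>\<nu>\<bar>) summable_on range (\<lambda>n. - int n)"
    by (subst summable_on_reindex) (use g in \<open>auto simp: comp_def inj_on_def\<close>)
  ultimately show ?thesis using summable_on_union by metis
qed

lemma min_powi: "min (2 powi \<nu>) (1 / 2 powi \<nu>) = (1/2::real) ^ nat \<bar>\<nu>\<bar>"
proof (cases "\<nu> \<ge> 0")
  case True
  then have "(2::real) powi \<nu> = 2 ^ nat \<nu>" by (simp add: power_int_def)
  moreover have "1 / 2 ^ nat \<nu> \<le> (2::real) ^ nat \<nu>"
    using one_le_power[of "2::real" "nat \<nu>"] by (simp add: divide_le_eq mult_ge1_I)
  ultimately show ?thesis using True by (simp add: power_one_over)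
next
  case False
  then have "(2::real) powi \<nu> = 1 / 2 ^ nat (- \<nu>)" by (simp add: power_int_def inverse_eq_divide power_one_over)
  moreover have "1 / 2 ^ nat (- \<nu>) \<le> (2::real) ^ nat (- \<nu>)"
    using one_le_power[of "2::real" "nat (- \<nu>)"] by (simp add: divide_le_eq mult_ge1_I)
  ultimately show ?thesis using False by (simp add: power_one_over)
qed

definition cube_term :: "'n distribution \<Rightarrow> (real^'n \<Rightarrow> complex) \<Rightarrow> int \<Rightarrow> int^'n \<Rightarrow> complex" where
  "cube_term f \<omega> \<nu> k = f (\<lambda>x. coef (2 powi \<nu>) \<omega> (ivec k) * translate (2 powi \<nu>) k x)"

text \<open>With \<epsilon> = 2^(-|\<nu>|): the coefficient decays like \<epsilon>^(d + 1), the
  seminorm of the translate grows at most like \<epsilon>^(-d), and one factor \<epsilon> remains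
  for the sum over \<nu>. In k, the exponent 2 n + d loses d to the translation and keeps 2
  n.\<close>

lemma cube_term_summable:
  assumes f: "f \<in> tempered" and \<omega>: "\<omega> \<in> Zspace"
  shows "(\<lambda>(\<nu>, k). cmod (cube_term f \<omega> \<nu> k)) summable_on UNIV"
proof -
  obtain c d where c: "c \<ge> 0" "\<And>\<omega>. \<omega> \<in> schwartz \<Longrightarrow> cmod (f \<omega>) \<le> c * schwartz_norm d \<omega>"
    by (rule tempered_bound[OF f]) blast
  let ?M = "2 * CARD('n)"
  let ?N = "schwartz_norm d \<phi>"
  obtain C where C: "C \<ge> 0" "\<forall>a y. 0 < a \<longrightarrow> cmod (coef a \<omega> y) \<le> C * (min a (1 / a)) ^ Suc d / (1 + norm y) ^ (?M + d)"
    using coef_decay[OF \<omega>, of "Suc d" "?M + d"] by blast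
  let ?w = "\<lambda>k::int^'n. 1 / (1 + norm (ivec k)) ^ ?M"
  let ?e = "\<lambda>\<nu>::int. (1/2::real) ^ nat \<bar>\<nu>\<bar>"
  have gen: "(C * x1 / w1) * (c * (x2 * w2 * n)) = (c * C * n) * (x1 * x2) * (w2 / w1)" for x1 x2 w1 w2 n :: real
    by simp
  have bound: "cmod (cube_term f \<omega> \<nu> k) \<le> (c * C * ?N) * ?e \<nu> * ?w k" for \<nu> k
  proof -
    let ?a = "2 powi \<nu> :: real"
    have a: "?a > 0" by simp
    have e: "?e \<nu> > 0" by simp
    have "cmod (cube_term f \<omega> \<nu> k) = cmod (coef ?a \<omega> (ivec k)) * cmod (f (translate ?a k))"
      by (simp add: cube_term_def antidual_cmult[OF f translate_schwartz[OF a]] norm_mult)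
    also have "\<dots> \<le> (C * ?e \<nu> ^ Suc d / (1 + norm (ivec k)) ^ (?M + d)) * (c * ((1 / ?e \<nu>) ^ d * (1 + norm (ivec k)) ^ d * ?N))"
    proof (intro mult_mono)
      show "cmod (coef ?a \<omega> (ivec k)) \<le> C * ?e \<nu> ^ Suc d / (1 + norm (ivec k)) ^ (?M + d)"
        using C(2)[rule_format, OF a, of "ivec k"] unfolding min_powi .
      have "cmod (f (translate ?a k)) \<le> c * schwartz_norm d (translate ?a k)"
        by (intro c translate_schwartz a)
      also have "\<dots> \<le> c * ((1 / ?e \<nu>) ^ d * (1 + norm (ivec k)) ^ d * ?N)"
        using schwartz_norm_translate_le[OF a, of d k] unfolding max_times_max_inverse[OF a] min_powi
        by (intro mult_left_mono c)
      finally show "cmod (f (translate ?a k)) \<le> c * ((1 / ?e \<nu>) ^ d * (1 + norm (ivec k)) ^ d * ?N)" .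
    qed (use C(1) in \<open>auto intro!: divide_nonneg_nonneg mult_nonneg_nonneg\<close>)
    also have "\<dots> = (c * C * ?N) * (?e \<nu> ^ Suc d * (1 / ?e \<nu>) ^ d) * ((1 + norm (ivec k)) ^ d / (1 + norm (ivec k)) ^ (?M + d))"
      by (rule gen)
    also have "?e \<nu> ^ Suc d * (1 / ?e \<nu>) ^ d = ?e \<nu>"
      using e by (simp add: power_divide)
    also have "(1 + norm (ivec k)) ^ d / (1 + norm (ivec k)) ^ (?M + d) = ?w k"
      by (simp add: power_add)
    finally show ?thesis .
  qed
  have "(\<lambda>(\<nu>, k). (c * C * ?N) * ?e \<nu> * ?w k) summable_on Sigma UNIV (\<lambda>_. UNIV)"
  proof (rule summable_on_SigmaI)
    show "((\<lambda>k. case (\<nu>, k) of (\<nu>, k) \<Rightarrow> (c * C * ?N) * ?e \<nu> * ?w k) has_sum (c * C * ?N) * ?e \<nu> * (\<Sum>\<^sub>\<infinity>k. ?w k)) UNIV" for \<nu>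
      unfolding prod.case by (intro has_sum_cmult_right has_sum_infsum summable_inverse_power_ivec)
    show "(\<lambda>\<nu>. (c * C * ?N) * ?e \<nu> * (\<Sum>\<^sub>\<infinity>k. ?w k)) summable_on UNIV"
      by (intro summable_on_cmult_left summable_on_cmult_right summable_half_powers)
    show "(case (\<nu>, k) of (\<nu>, k) \<Rightarrow> (c * C * ?N) * ?e \<nu> * ?w k) \<ge> 0" for \<nu> k
      using c(1) C(1) schwartz_norm_nonneg[OF \<phi>, of d] by simp
  qed
  then have s: "(\<lambda>(\<nu>, k). (c * C * ?N) * ?e \<nu> * ?w k) summable_on UNIV" by (simp only: UNIV_Times_UNIV)
  show ?thesis
  proof (rule summable_on_comparison_test[OF s])
    fix p :: "int \<times> (int^'n)"
    show "(case p of (\<nu>, k) \<Rightarrow> cmod (cube_term f \<omega> \<nu> k)) \<le> (case p of (\<nu>, k) \<Rightarrow> (c * C * ?N) * ?e \<nu> * ?w k)"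
      by (cases p) (simp only: prod.case bound)
    show "0 \<le> (case p of (\<nu>, k) \<Rightarrow> cmod (cube_term f \<omega> \<nu> k))"
      by (cases p) (simp only: prod.case norm_ge_zero)
  qed
qed

text \<open>Absolute summability gives some limit. Summing over k first reduces it to a sum over
  levels, and evaluating that along the windows from -N to N - 1 identifies the limit as f \<omega>,
  because the low-frequency part tends to 0.\<close>

lemma cube_term_has_sum:
  assumes f: "f \<in> tempered" and \<omega>: "\<omega> \<in> Zspace"
  shows "((\<lambda>(\<nu>, k). cube_term f \<omega> \<nu> k) has_sum f \<omega>) UNIV"
proof -
  note \<omega>S = Zspace_schwartz[OF \<omega>]
  let ?A = "\<lambda>(\<nu>, k). cube_term f \<omega> \<nu> k"
  have "(\<lambda>p. norm (?A p)) = (\<lambda>(\<nu>, k). cmod (cube_term f \<omega> \<nu> k))" by auto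
  then have "(\<lambda>p. norm (?A p)) summable_on UNIV"
    using cube_term_summable[OF f \<omega>] by (simp only:)
  then have S: "(?A has_sum infsum ?A UNIV) UNIV" by (rule has_sum_infsum[OF abs_summable_summable])
  have "((\<lambda>\<nu>. f (level (2 powi \<nu>) \<omega>)) has_sum infsum ?A UNIV) UNIV"
  proof (rule has_sum_SigmaD)
    show "(?A has_sum infsum ?A UNIV) (Sigma UNIV (\<lambda>_. UNIV))" using S by simp
    show "((\<lambda>k. ?A (\<nu>, k)) has_sum f (level (2 powi \<nu>) \<omega>)) UNIV" for \<nu>
      unfolding prod.case cube_term_def by (intro level_has_sum f \<omega>S) simp
  qed
  then have "(sum (\<lambda>\<nu>. f (level (2 powi \<nu>) \<omega>)) \<longlongrightarrow> infsum ?A UNIV) (finite_subsets_at_top UNIV)"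
    by (simp only: has_sum_def)
  moreover have "filterlim (\<lambda>N. {- int N..<int N}) (finite_subsets_at_top UNIV) sequentially"
    unfolding filterlim_finite_subsets_at_top
  proof (intro allI impI)
    fix X :: "int set" assume X: "finite X \<and> X \<subseteq> UNIV"
    define m where "m = (if X = {} then 0 else Max ((\<lambda>\<nu>. nat \<bar>\<nu>\<bar>) ` X))"
    have m: "nat \<bar>\<nu>\<bar> \<le> m" if "\<nu> \<in> X" for \<nu> using X that by (auto simp: m_def)
    show "\<forall>\<^sub>F N in sequentially. finite {- int N..<int N} \<and> X \<subseteq> {- int N..<int N} \<and> {- int N..<int N} \<subseteq> UNIV"
    proof (rule eventually_sequentiallyI[of "Suc m"])
      fix N assume "Suc m \<le> N"
      then have "X \<subseteq> {- int N..<int N}" using m by fastforce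
      then show "finite {- int N..<int N} \<and> X \<subseteq> {- int N..<int N} \<and> {- int N..<int N} \<subseteq> UNIV" by simp
    qed
  qed
  ultimately have 1: "(\<lambda>N. \<Sum>\<nu>\<in>{- int N..<int N}. f (level (2 powi \<nu>) \<omega>)) \<longlonglongrightarrow> infsum ?A UNIV"
    by (rule filterlim_compose)
  have "(\<lambda>N. \<Sum>j<N. f (level (2 powi (int j - int 0)) \<omega>)) \<longlonglongrightarrow> f \<omega> - f (smear cPhi \<omega> (2 ^ 0))"
    using level_sums[OF f \<omega>S, of 0] unfolding sums_def .
  then have "(\<lambda>N. (\<Sum>j<N. f (level (2 powi (int j - int 0)) \<omega>)) + f (smear cPhi \<omega> (2 ^ 0)) - f (smear cPhi \<omega> (2 ^ N)))
      \<longlonglongrightarrow> f \<omega> - f (smear cPhi \<omega> (2 ^ 0)) + f (smear cPhi \<omega> (2 ^ 0)) - 0"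
    by (intro tendsto_diff tendsto_add tendsto_const low_tendsto_0 f \<omega>)
  then have 2: "(\<lambda>N. \<Sum>\<nu>\<in>{- int N..<int N}. f (level (2 powi \<nu>) \<omega>)) \<longlonglongrightarrow> f \<omega>"
    unfolding level_partial_sum[OF f \<omega>S] by simp
  from S show ?thesis unfolding LIMSEQ_unique[OF 1 2] .
qed

lemma at_cube_eq: "at_cube \<phi> (dyadic_cube \<nu> k) =
  (\<lambda>x. of_real (2 powr (real CARD('n) * of_int \<nu> / 2)) * translate (2 powi \<nu>) k x)"
  by (rule ext) (simp add: at_cube_dyadic_cube translate_def ivec_def)

lemma at_cube_schwartz: "at_cube \<phi> (dyadic_cube \<nu> k) \<in> schwartz"
  unfolding at_cube_eq by (intro schwartz_cmult' translate_schwartz) simp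

lemma at_cube_Zspace: "at_cube \<phi> (dyadic_cube \<nu> k) \<in> Zspace"
proof (rule Zspace_of_fourier_vanishing[OF at_cube_schwartz])
  let ?a = "2 powi \<nu> :: real"
  show "0 < ?a * K0" using K0 by simp
  fix \<xi> :: "real^'n" assume "norm \<xi> < ?a * K0"
  then have "norm ((1 / ?a) *\<^sub>R \<xi>) < K0" by (simp add: field_simps)
  then have "fourier \<phi> ((1 / ?a) *\<^sub>R \<xi>) = 0" using \<phi>_supp by force
  then have "fourier (\<lambda>x. \<phi> (?a *\<^sub>R x + (- ivec k))) \<xi> = 0"
    by (subst fourier_affine[OF schwartz_measurable[OF \<phi>]]) auto
  then have "fourier (translate ?a k) \<xi> = 0" by (simp add: translate_def[abs_def])
  then show "fourier (at_cube \<phi> (dyadic_cube \<nu> k)) \<xi> = 0" unfolding at_cube_eq fourier_cmult by simp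
qed

text \<open>The two normalizations 2^(n \<nu> / 2) multiply to the factor a^n of
  \<open>coef_alt\<close>, and the coefficient, conjugated on leaving f, becomes the pairing of
  \<psi>_Q with \<omega>.\<close>

lemma cube_term_eq:
  assumes f: "f \<in> tempered" and \<omega>: "\<omega> \<in> schwartz"
  shows "f (at_cube \<phi> (dyadic_cube \<nu> k)) * pairing (at_cube \<psi> (dyadic_cube \<nu> k)) \<omega> = cube_term f \<omega> \<nu> k"
proof -
  let ?a = "2 powi \<nu> :: real"
  let ?r = "2 powr (real CARD('n) * of_int \<nu> / 2) :: real"
  have a: "?a > 0" by simp
  have r: "?r * ?r = ?a ^ CARD('n)"
  proof -
    have "?r * ?r = 2 powr (of_int \<nu> * real CARD('n))" by (simp add: powr_add[symmetric] mult.commute)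
    also have "\<dots> = (2 powr of_int \<nu>) ^ CARD('n)" by (simp add: powr_powr[symmetric] powr_realpow)
    also have "2 powr of_int \<nu> = ?a" by (simp add: powr_real_of_int power_int_def inverse_eq_divide power_one_over)
    finally show ?thesis .
  qed
  have p: "pairing (at_cube \<psi> (dyadic_cube \<nu> k)) \<omega> = of_real ?r * cnj (smear \<omega> (\<lambda>x. cnj (\<psi> x)) ?a (- ivec k))"
  proof -
    have "cnj (smear \<omega> (\<lambda>x. cnj (\<psi> x)) ?a (- ivec k)) = (\<integral>x. cnj (\<omega> x * cnj (\<psi> (- ivec k + ?a *\<^sub>R x))) \<partial>lborel)"
      unfolding smear_def by (rule Bochner_Integration.integral_cnj[symmetric])
    then have "of_real ?r * cnj (smear \<omega> (\<lambda>x. cnj (\<psi> x)) ?a (- ivec k)) = (\<integral>x. of_real ?r * cnj (\<omega> x * cnj (\<psi> (- ivec k + ?a *\<^sub>R x))) \<partial>lborel)"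
      by (simp only: integral_mult_right_zero)
    also have "\<dots> = pairing (at_cube \<psi> (dyadic_cube \<nu> k)) \<omega>"
      unfolding pairing_def at_cube_dyadic_cube
      by (intro Bochner_Integration.integral_cong refl) (simp add: ivec_def[symmetric] mult_ac)
    finally show ?thesis ..
  qed
  have "f (at_cube \<phi> (dyadic_cube \<nu> k)) = of_real ?r * f (translate ?a k)"
    unfolding at_cube_eq antidual_cmult[OF f translate_schwartz[OF a]] by simp
  moreover have "cube_term f \<omega> \<nu> k = of_real (?r * ?r) * cnj (smear \<omega> (\<lambda>x. cnj (\<psi> x)) ?a (- ivec k)) * f (translate ?a k)"
    unfolding cube_term_def antidual_cmult[OF f translate_schwartz[OF a]] coef_alt[OF \<omega> a] r by simp
  ultimately show ?thesis unfolding p by simp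
qed

end

section \<open>Passage to the quotient modulo polynomials and assembly of the two statements\<close>

lemma Zfunctional_class:
  fixes u :: "'n::finite distribution"
  assumes u: "u \<in> tempered"
  shows "Zfunctional (poly_equiv `` {u}) = restrict u Zspace"
  unfolding Zfunctional_def
proof (rule restrict_ext)
  fix \<omega> :: "real^'n \<Rightarrow> complex" assume \<omega>: "\<omega> \<in> Zspace"
  have same: "v \<omega> = u \<omega>" if "v \<in> poly_equiv `` {u}" for v
  proof -
    obtain p where "polynomial_function p" "u \<omega> - v \<omega> = pairing p \<omega>"
      using \<open>v \<in> poly_equiv `` {u}\<close> Zspace_schwartz[OF \<omega>] unfolding poly_equiv_def by auto
    with pairing_polynomial_Zspace[OF _ \<omega>] show ?thesis by simp
  qed
  have self: "u \<in> poly_equiv `` {u}"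
  proof -
    have "polynomial_function (\<lambda>x::real^'n. 0 :: complex)" by simp
    moreover have "pairing (\<lambda>x. 0) \<theta> = 0" for \<theta> :: "real^'n \<Rightarrow> complex" by (simp add: pairing_def)
    ultimately have "polynomial_function (\<lambda>x::real^'n. 0 :: complex) \<and> (\<forall>\<theta>\<in>schwartz. u \<theta> - u \<theta> = pairing (\<lambda>x. 0) \<theta>)"
    proof (intro conjI ballI)
      fix \<theta> :: "real^'n \<Rightarrow> complex"
      show "u \<theta> - u \<theta> = pairing (\<lambda>x. 0) \<theta>"
        unfolding \<open>pairing (\<lambda>x. 0) \<theta> = 0\<close> by (rule diff_self)
    qed
    then have "\<exists>p :: real^'n \<Rightarrow> complex. polynomial_function p \<and> (\<forall>\<theta>\<in>schwartz. u \<theta> - u \<theta> = pairing p \<theta>)"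
      by - (rule exI[where x = "\<lambda>x::real^'n. 0 :: complex"])
    with u show ?thesis unfolding poly_equiv_def Image_singleton mem_Collect_eq prod.case by (intro conjI)
  qed
  have "(\<lambda>v. v \<omega>) ` (poly_equiv `` {u}) = {u \<omega>}"
  proof (intro subset_antisym image_subsetI subsetI)
    fix v assume "v \<in> poly_equiv `` {u}"
    from same[OF this] show "v \<omega> \<in> {u \<omega>}" by (rule ssubst) (rule singletonI)
  next
    fix z assume "z \<in> {u \<omega>}"
    then have "z = u \<omega>" by (rule singletonD)
    from this self show "z \<in> (\<lambda>v. v \<omega>) ` (poly_equiv `` {u})" by (rule image_eqI)
  qed
  then show "the_elem ((\<lambda>v. v \<omega>) ` (poly_equiv `` {u})) = u \<omega>" by simp
qed

lemma restrict_Zdual: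
  assumes "u \<in> tempered"
  shows "restrict u Zspace \<in> Zdual"
proof -
  obtain d c where c: "\<And>\<omega>. \<omega> \<in> schwartz \<Longrightarrow> cmod (u \<omega>) \<le> c * schwartz_norm d \<omega>"
    using tempered_bound[OF assms] by metis
  have "\<exists>d c. \<forall>\<phi>\<in>Zspace. cmod (restrict u Zspace \<phi>) \<le> c * schwartz_norm d \<phi>"
  proof (intro exI ballI)
    fix \<omega> :: "real^'a \<Rightarrow> complex" assume "\<omega> \<in> Zspace"
    then show "cmod (restrict u Zspace \<omega>) \<le> c * schwartz_norm d \<omega>"
      using c[OF Zspace_schwartz] by simp
  qed
  then show ?thesis
    unfolding antidual_def mem_Collect_eq
    by (simp add: Zspace_add Zspace_cmult antidual_add[OF assms] antidual_cmult[OF assms] Zspace_schwartz)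
qed

context frame_pair
begin

lemma dyadic_cubes_eq: "dyadic_cubes = (\<lambda>(\<nu>, k :: int^'n). dyadic_cube \<nu> k) ` UNIV"
  by (auto simp: dyadic_cubes_def image_def)

text \<open>f and its representative u agree on all \<phi>_Q, since these lie in
  \<open>Zspace\<close>; the sum over pairs (\<nu>, k) is then reindexed to cubes by injectivity of
  \<open>dyadic_cube\<close>.\<close>

lemma expansion_in_Zdual:
  assumes u: "u \<in> tempered" and f: "f = restrict u Zspace"
  shows "S_op \<phi> f \<in> T_domain \<psi>"
    and "has_weak_sum Zspace (\<lambda>Q \<omega>. f (at_cube \<phi> Q) * pairing (at_cube \<psi> Q) \<omega>) f dyadic_cubes"
    and "f = T_op \<psi> (S_op \<phi> f)"
proof -
  have f_cube: "f (at_cube \<phi> (dyadic_cube \<nu> k)) * pairing (at_cube \<psi> (dyadic_cube \<nu> k)) \<omega> = cube_term u \<omega> \<nu> k"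
    if "\<omega> \<in> Zspace" for \<omega> \<nu> k
    using cube_term_eq[OF u Zspace_schwartz[OF that]] at_cube_Zspace by (simp add: f)
  have S: "S_op \<phi> f Q = f (at_cube \<phi> Q)" if "Q \<in> dyadic_cubes" for Q
    using that by (simp add: S_op_def)
  have hs: "((\<lambda>Q. f (at_cube \<phi> Q) * pairing (at_cube \<psi> Q) \<omega>) has_sum f \<omega>) dyadic_cubes" if \<omega>: "\<omega> \<in> Zspace" for \<omega>
  proof -
    have "(\<lambda>Q. f (at_cube \<phi> Q) * pairing (at_cube \<psi> Q) \<omega>) \<circ> (\<lambda>(\<nu>, k). dyadic_cube \<nu> k) = (\<lambda>(\<nu>, k). cube_term u \<omega> \<nu> k)"
      using f_cube[OF \<omega>] by auto
    then show ?thesis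
      unfolding dyadic_cubes_eq has_sum_reindex[OF inj_dyadic_cube]
      using cube_term_has_sum[OF u \<omega>] \<omega> by (simp only: f restrict_apply if_True)
  qed
  have fZ: "f \<in> Zdual" unfolding f by (rule restrict_Zdual[OF u])
  show "has_weak_sum Zspace (\<lambda>Q \<omega>. f (at_cube \<phi> Q) * pairing (at_cube \<psi> Q) \<omega>) f dyadic_cubes"
    unfolding has_weak_sum_def using fZ hs by blast
  show "S_op \<phi> f \<in> T_domain \<psi>"
    unfolding T_domain_def mem_Collect_eq
  proof (intro conjI ballI)
    show "S_op \<phi> f \<in> extensional dyadic_cubes" by (simp add: S_op_def)
    fix \<omega> :: "real^'n \<Rightarrow> complex" assume \<omega>: "\<omega> \<in> Zspace"
    have "(\<lambda>Q. cmod (S_op \<phi> f Q) * cmod (pairing (at_cube \<psi> Q) \<omega>)) \<circ> (\<lambda>(\<nu>, k). dyadic_cube \<nu> k) = (\<lambda>(\<nu>, k). cmod (cube_term u \<omega> \<nu> k))"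
    proof
      fix p :: "int \<times> (int^'n)"
      obtain \<nu> k where p: "p = (\<nu>, k)" by (cases p)
      have "dyadic_cube \<nu> k \<in> dyadic_cubes" by (auto simp: dyadic_cubes_def)
      from S[OF this] show "((\<lambda>Q. cmod (S_op \<phi> f Q) * cmod (pairing (at_cube \<psi> Q) \<omega>)) \<circ> (\<lambda>(\<nu>, k). dyadic_cube \<nu> k)) p = (case p of (\<nu>, k) \<Rightarrow> cmod (cube_term u \<omega> \<nu> k))"
        by (simp add: p norm_mult[symmetric] f_cube[OF \<omega>])
    qed
    then show "(\<lambda>Q. cmod (S_op \<phi> f Q) * cmod (pairing (at_cube \<psi> Q) \<omega>)) summable_on dyadic_cubes"
      unfolding dyadic_cubes_eq summable_on_reindex[OF inj_dyadic_cube]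
      using cube_term_summable[OF u \<omega>] by (simp only:)
  qed
  have sum: "f \<omega> = (\<Sum>\<^sub>\<infinity>Q\<in>dyadic_cubes. S_op \<phi> f Q * pairing (at_cube \<psi> Q) \<omega>)" if "\<omega> \<in> Zspace" for \<omega>
  proof -
    have "(\<Sum>\<^sub>\<infinity>Q\<in>dyadic_cubes. S_op \<phi> f Q * pairing (at_cube \<psi> Q) \<omega>) = (\<Sum>\<^sub>\<infinity>Q\<in>dyadic_cubes. f (at_cube \<phi> Q) * pairing (at_cube \<psi> Q) \<omega>)"
      by (intro infsum_cong) (simp only: S)
    also have "\<dots> = f \<omega>" by (rule infsumI[OF hs[OF that]])
    finally show ?thesis ..
  qed
  show "f = T_op \<psi> (S_op \<phi> f)"
    unfolding T_op_def
  proof (rule the_equality[symmetric])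
    show "f \<in> Zdual \<and> (\<forall>\<omega>\<in>Zspace. f \<omega> = (\<Sum>\<^sub>\<infinity>Q\<in>dyadic_cubes. S_op \<phi> f Q * pairing (at_cube \<psi> Q) \<omega>))"
      using fZ sum by blast
    \<comment> \<open>Uniqueness for the definite description in \<open>T_op\<close>: elements of
      \<open>Zdual\<close> are extensional, so their values on \<open>Zspace\<close> determine
      them.\<close>
    fix v assume v: "v \<in> Zdual \<and> (\<forall>\<omega>\<in>Zspace. v \<omega> = (\<Sum>\<^sub>\<infinity>Q\<in>dyadic_cubes. S_op \<phi> f Q * pairing (at_cube \<psi> Q) \<omega>))"
    have "v \<in> extensional Zspace" "f \<in> extensional Zspace" using v fZ by (auto simp: antidual_def)
    then show "v = f" using v sum by (intro extensionalityI[of v Zspace f]) auto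
  qed
qed

lemma expansion_in_tempered:
  assumes f: "f \<in> tempered"
  shows "\<exists>g :: int \<Rightarrow> 'n distribution. \<exists>h :: nat \<Rightarrow> 'n distribution.
          (\<forall>\<nu>. has_weak_sum schwartz
                 (\<lambda>k \<omega>. f (at_cube \<phi> (dyadic_cube \<nu> k)) * pairing (at_cube \<psi> (dyadic_cube \<nu> k)) \<omega>)
                 (g \<nu>) UNIV) \<and>
          (\<forall>N. weak_sums schwartz (\<lambda>j. g (int j - int N)) (h N)) \<and>
          (\<forall>m::int. m \<ge> -1 \<longrightarrow>
            (\<exists>R :: nat \<Rightarrow> 'n distribution.
              (\<forall>N. R N \<in> tempered \<and>
                (\<forall>\<omega>\<in>schwartz. f \<omega> = h N \<omega>
                    + pairing (taylor_poly m (conv (dilate N (Phi \<phi> \<psi>)) f)) \<omega> + R N \<omega>)) \<and>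
              (\<forall>\<omega>\<in>schwartz. (\<lambda>N. cmod (R N \<omega>)) \<in>
                O(\<lambda>N. 2 powr (- (real N * (real CARD('n) + of_int m + 1 - real (S_order f))))))))"
proof -
  \<comment> \<open>Witnesses: \<open>L N\<close> is the low-frequency part, \<open>h N\<close> is f
    minus \<open>L N\<close>, and \<open>R N\<close> below is \<open>L N\<close> minus the pairing
    with the Taylor polynomial. The decomposition of f thus holds by construction; the content is
    the convergence to \<open>g\<close> and \<open>h\<close> and the bound on
    \<open>R\<close>.\<close>
  define g where "g \<nu> = (\<lambda>\<omega>\<in>schwartz. f (level (2 powi \<nu>) \<omega>))" for \<nu> :: int
  define L where "L N = (\<lambda>\<omega>\<in>schwartz. f (smear cPhi \<omega> (2 ^ N)))" for N :: nat
  define h where "h N = (\<lambda>\<omega>\<in>schwartz. f \<omega> - L N \<omega>)" for N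
  have L: "L N \<in> tempered" for N unfolding L_def by (rule tempered_smear[OF f cPhi_rapid])
  have h: "h N \<in> tempered" for N unfolding h_def by (rule tempered_diff[OF f L])
  have g: "g \<nu> \<in> tempered" for \<nu> unfolding g_def by (rule level_tempered[OF f]) simp
  let ?d = "S_order f"
  have "\<exists>d c. \<forall>\<omega>\<in>schwartz. cmod (f \<omega>) \<le> c * schwartz_norm d \<omega>"
    using f by (simp add: antidual_def)
  then have "\<exists>c. \<forall>\<omega>\<in>schwartz. cmod (f \<omega>) \<le> c * schwartz_norm ?d \<omega>"
    unfolding S_order_def by (rule LeastI_ex)
  then obtain c where c: "\<And>\<omega>. \<omega> \<in> schwartz \<Longrightarrow> cmod (f \<omega>) \<le> c * schwartz_norm ?d \<omega>" by blast
  show ?thesis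
  proof (rule exI[of _ g], rule exI[of _ h], intro conjI allI impI)
    fix \<nu>
    show "has_weak_sum schwartz (\<lambda>k \<omega>. f (at_cube \<phi> (dyadic_cube \<nu> k)) * pairing (at_cube \<psi> (dyadic_cube \<nu> k)) \<omega>) (g \<nu>) UNIV"
      unfolding has_weak_sum_def
    proof (intro conjI ballI g)
      fix \<omega> :: "real^'n \<Rightarrow> complex" assume \<omega>: "\<omega> \<in> schwartz"
      show "((\<lambda>k. f (at_cube \<phi> (dyadic_cube \<nu> k)) * pairing (at_cube \<psi> (dyadic_cube \<nu> k)) \<omega>) has_sum g \<nu> \<omega>) UNIV"
        unfolding cube_term_eq[OF f \<omega>] cube_term_def g_def restrict_apply'[OF \<omega>]
        by (rule level_has_sum[OF f \<omega>]) simp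
    qed
  next
    fix N
    show "weak_sums schwartz (\<lambda>j. g (int j - int N)) (h N)"
      unfolding weak_sums_def
    proof (intro conjI ballI h)
      fix \<omega> :: "real^'n \<Rightarrow> complex" assume \<omega>: "\<omega> \<in> schwartz"
      show "(\<lambda>j. g (int j - int N) \<omega>) sums h N \<omega>"
        unfolding g_def h_def L_def restrict_apply'[OF \<omega>] by (rule level_sums[OF f \<omega>])
    qed
  next
    fix m :: int assume m: "m \<ge> -1"
    let ?p = "nat (m + 1)"
    let ?c = "\<lambda>N. conv (dilate N (Phi \<phi> \<psi>)) f"
    define R where "R N = (\<lambda>\<omega>\<in>schwartz. L N \<omega> - (\<lambda>\<omega>\<in>schwartz. pairing (taylor_poly m (?c N)) \<omega>) \<omega>)" for N
    show "\<exists>R :: nat \<Rightarrow> 'n distribution. (\<forall>N. R N \<in> tempered \<and>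
                (\<forall>\<omega>\<in>schwartz. f \<omega> = h N \<omega> + pairing (taylor_poly m (?c N)) \<omega> + R N \<omega>)) \<and>
              (\<forall>\<omega>\<in>schwartz. (\<lambda>N. cmod (R N \<omega>)) \<in>
                O(\<lambda>N. 2 powr (- (real N * (real CARD('n) + of_int m + 1 - real ?d)))))"
    proof (intro exI[of _ R] conjI allI ballI)
      fix N
      show "R N \<in> tempered"
        unfolding R_def
        by (rule tempered_diff[OF L tempered_pairing_taylor_poly[OF smooth_conv[OF f dilate_Phi_schwartz]]])
      fix \<omega> :: "real^'n \<Rightarrow> complex" assume \<omega>: "\<omega> \<in> schwartz"
      show "f \<omega> = h N \<omega> + pairing (taylor_poly m (?c N)) \<omega> + R N \<omega>"
        unfolding h_def R_def restrict_apply'[OF \<omega>] by simp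
    next
      fix \<omega> :: "real^'n \<Rightarrow> complex" assume \<omega>: "\<omega> \<in> schwartz"
      have R: "R N \<omega> = f (smear cPhi \<omega> (2 ^ N))
          - f (\<lambda>y. of_real ((1/2) ^ (CARD('n) * N)) * moment_part ?p (\<lambda>z. \<omega> (- z)) (low_kernel N) y)" for N
        unfolding R_def L_def restrict_apply'[OF \<omega>] pairing_taylor_conv[OF f \<omega>] ..
      \<comment> \<open>For m >= -1 nothing is truncated by \<open>nat\<close>, and the m + 1 orders
        of the expansion give the exponent n + m + 1 - d.\<close>
      have p: "real CARD('n) + real ?p = real CARD('n) + of_int m + 1" using m by simp
      have "\<exists>C. \<forall>N. cmod (R N \<omega>) \<le> C * 2 powr (- (real N * (real CARD('n) + real ?p - real ?d)))"
        unfolding R by (rule low_minus_moment_part_bound[OF \<omega> f c, where p = ?p], assumption, intro exI allI)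
      then obtain C where C: "\<forall>N. cmod (R N \<omega>) \<le> C * 2 powr (- (real N * (real CARD('n) + real ?p - real ?d)))" ..
      show "(\<lambda>N. cmod (R N \<omega>)) \<in> O(\<lambda>N. 2 powr (- (real N * (real CARD('n) + of_int m + 1 - real ?d))))"
        by (rule bigoI[where c = C]) (use C in \<open>simp add: p\<close>)
    qed
  qed
qed

end

theorem proposition3p5:
  fixes \<phi> \<psi> :: "real^'n::finite \<Rightarrow> complex"
    and K0 K1 L1 L0 :: real
  assumes "0 < K0" "K0 < K1" "K1 < 1" "1 < L1" "L1 < L0" "2 * K1 < L1" "L0 < pi"
    and "admissible K0 K1 L1 L0 \<phi>" and "admissible K0 K1 L1 L0 \<psi>"
    and "\<And>\<xi>. \<xi> \<noteq> 0 \<Longrightarrow>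
      ((\<lambda>\<nu>::int. cnj (fourier \<phi> (2 powi (-\<nu>) *\<^sub>R \<xi>)) * fourier \<psi> (2 powi (-\<nu>) *\<^sub>R \<xi>)) has_sum 1) UNIV"
  shows
    "(\<forall>F \<in> tempered_mod_poly. \<forall>f. f = Zfunctional F \<longrightarrow>
        S_op \<phi> f \<in> T_domain \<psi> \<and>
        has_weak_sum Zspace (\<lambda>Q \<omega>. f (at_cube \<phi> Q) * pairing (at_cube \<psi> Q) \<omega>) f dyadic_cubes \<and>
        f = T_op \<psi> (S_op \<phi> f)) \<and>
     (\<forall>f \<in> tempered. \<forall>d. d = S_order f \<longrightarrow>
        (\<exists>g :: int \<Rightarrow> 'n distribution. \<exists>h :: nat \<Rightarrow> 'n distribution.
          (\<forall>\<nu>. has_weak_sum schwartz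
                 (\<lambda>k \<omega>. f (at_cube \<phi> (dyadic_cube \<nu> k)) * pairing (at_cube \<psi> (dyadic_cube \<nu> k)) \<omega>)
                 (g \<nu>) UNIV) \<and>
          (\<forall>N. weak_sums schwartz (\<lambda>j. g (int j - int N)) (h N)) \<and>
          (\<forall>m::int. m \<ge> -1 \<longrightarrow>
            (\<exists>R :: nat \<Rightarrow> 'n distribution.
              (\<forall>N. R N \<in> tempered \<and>
                (\<forall>\<omega>\<in>schwartz. f \<omega> = h N \<omega>
                    + pairing (taylor_poly m (conv (dilate N (Phi \<phi> \<psi>)) f)) \<omega> + R N \<omega>)) \<and>
              (\<forall>\<omega>\<in>schwartz. (\<lambda>N. cmod (R N \<omega>)) \<in>
                O(\<lambda>N. 2 powr (- (real N * (real CARD('n) + of_int m + 1 - real d)))))))))"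
proof -
  have supp: "K0 \<le> norm \<xi> \<and> norm \<xi> \<le> L0" if "admissible K0 K1 L1 L0 \<eta>" "fourier \<eta> \<xi> \<noteq> 0"
    for \<eta> :: "real^'n \<Rightarrow> complex" and \<xi>
    using that closure_subset[of "{\<xi>. fourier \<eta> \<xi> \<noteq> 0}"] unfolding admissible_def by blast
  interpret frame_pair \<phi> \<psi> K0 L0
  proof
    show "0 < K0" "L0 < pi" "0 < L0" using assms(1-7) by auto
    show "\<phi> \<in> schwartz" "\<psi> \<in> schwartz" using assms(8,9) by (auto simp: admissible_def)
    show "K0 \<le> norm \<xi> \<and> norm \<xi> \<le> L0" if "fourier \<phi> \<xi> \<noteq> 0" for \<xi> by (rule supp[OF assms(8) that])
    show "K0 \<le> norm \<xi> \<and> norm \<xi> \<le> L0" if "fourier \<psi> \<xi> \<noteq> 0" for \<xi> by (rule supp[OF assms(9) that])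
    show "((\<lambda>\<nu>::int. cnj (fourier \<phi> (2 powi (-\<nu>) *\<^sub>R \<xi>)) * fourier \<psi> (2 powi (-\<nu>) *\<^sub>R \<xi>)) has_sum 1) UNIV"
      if "\<xi> \<noteq> 0" for \<xi> by (rule assms(10)[OF that])
  qed
  show ?thesis
  proof (rule conjI, intro ballI allI impI)
    fix F and f :: "'n distribution" assume "F \<in> tempered_mod_poly" and f: "f = Zfunctional F"
    then obtain u where u: "u \<in> tempered" "F = poly_equiv `` {u}"
      by (auto simp: tempered_mod_poly_def quotient_def)
    have fu: "f = restrict u Zspace" unfolding f u(2) by (rule Zfunctional_class[OF u(1)])
    show "S_op \<phi> f \<in> T_domain \<psi> \<and>
        has_weak_sum Zspace (\<lambda>Q \<omega>. f (at_cube \<phi> Q) * pairing (at_cube \<psi> Q) \<omega>) f dyadic_cubes \<and>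
        f = T_op \<psi> (S_op \<phi> f)"
      using expansion_in_Zdual[OF u(1) fu] by blast
  qed (intro ballI allI impI, simp only:, rule expansion_in_tempered)
qed

end
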